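(* Suppose Assumption A (see context) holds. Let $D_g$ be a fixed diameter bound, $D_g\ge\operatorname{diam}(\operatorname{dom}(g_2))$, and let $B_f\ge1$ be a Lipschitz constant for $f$ on $\operatorname{dom}(g_2)$. Let the inputs of the algorithm SNtVFA described in the context satisfy $0<\delta_{\rm init}\le 1/B_f$, $0<\epsilon\le\min\{1,36\delta_{\rm init}\}$, $x^f_{\rm init},x^g_{\rm init}\in\operatorname{dom}(g_2)$. Then SNtVFA$(\epsilon,D_g,B_f,\delta_{\rm init},x^f_{\rm init},x^g_{\rm init})$ returns an $(\epsilon,\epsilon)$-optimal solution of (SBO), i.e. a point $\widehat x\in\operatorname{dom}(g_2)$ with $f(\widehat x)-p^*\le\epsilon$ and $g(\widehat x)-g^*\le\epsilon$, and its total number of basic operations satisfies $$T_{\rm SNtVFA}=T_{\rm pre}+\mathcal O\!\left(D_g\sqrt{\frac{L_{g_1}}{\epsilon}}+\sqrt{\frac{C_D(D_g^2+2)(L_{g_1}+L_{f_1}\Omega_gQ_{\rm init})}{\epsilon}}\left(1+\log\frac1\epsilon\right)^3\right),$$ where $$T_{\rm pre}=\mathcal O\!\left(\left[\sqrt{C_DL_{f_1}\Omega_g}\,Q_{\rm init}+\sqrt{C_DL_{g_1}}\sqrt{Q_{\rm init}}\right](1+\log Q_{\rm init})^2\right).$$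
   Context: **Problem.** $f=f_1+f_2$, $g=g_1+g_2$ on $\mathbb R^n$; $f_1,g_1:\mathbb R^n\to\mathbb R$ are convex and continuously differentiable with gradients Lipschitz with constants $L_{f_1}>0$, $L_{g_1}\ge1$; $f_2,g_2:\mathbb R^n\to\mathbb R\cup\{+\infty\}$ are proper, l.s.c., convex. (SBO) is: $\min_x f(x)$ s.t. $x\in\arg\min_{z\in\mathbb R^n}g(z)$. The lower-level and SBO solution sets are assumed nonempty. $g^*=\min_{\operatorname{dom}(g_2)}g$, $f^*=\min_{\operatorname{dom}(g_2)}f$, and $p^*$ is the optimal value of (SBO). **Assumption A.** (i) The restriction of $g_2$ to $\operatorname{dom}(g_2)$ is continuous; $\operatorname{dom}(g_2)$ is nonempty, compact, convex; $\operatorname{dom}(g_2)\subseteq\operatorname{dom}(f_2)$; $f_2$ is $l_{f_2}$-Lipschitz on $\operatorname{dom}(g_2)$. (ii) $p^*>f^*$. **Constants.** $\Omega_g=\sup_{x\in\operatorname{dom}(g_2)}\{g(x)-g^*+1\}<\infty$, $C_D=1+D_g(1+D_g)$, $\bar g(c)=\min\{g(x): f(x)\le c\}$, $m_0=\bar g((p^*+f^* )/2)-g^*>0$, $Q_{\rm init}=\max\{1/\delta_{\rm init},\,8/(p^*-f^* ),\,8/m_0\}$. $[a]_+=\max\{a,0\}$. **Operations and $\mathcal O$.** A basic operation is one evaluation of $f_1,f_2,g_1,g_2,\nabla f_1,\nabla g_1$, $\operatorname{prox}_{\tau(g_2+\theta f_2)}$ or $\operatorname{prox}_{\tau(f_2+I_{\operatorname{dom}(g_2)})}$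 ($\tau>0$, $\theta\ge0$; $I_C$ is the indicator function of $C$, equal to $0$ on $C$ and $+\infty$ elsewhere). Constants hidden in $\mathcal O$ are independent of $\epsilon$; they may depend (through logarithmic factors) on the fixed problem data and $\delta_{\rm init}$. **Black-box APG subroutines** (for $\varphi=\varphi_1+\varphi_2$, $\varphi_1$ convex differentiable with $L_{\varphi_1}$-Lipschitz gradient, $L_{\varphi_1}>0$, $\varphi_2$ proper l.s.c. convex with computable prox; a proximal-gradient operation uses a bounded number of basic operations). ${\rm APG}_0(\varphi_1,\varphi_2,\delta,x_{\rm init},D)$, with $\delta>0$ and $D\ge\operatorname{dist}(x_{\rm init},\arg\min\varphi)$, returns $\tilde x\in\operatorname{dom}(\varphi_2)$ with $\varphi(\tilde x)-\min\varphi\le\delta$ within $\mathcal O(D\sqrt{L_{\varphi_1}/\delta})$ proximal-gradient operations. ${\rm APG}_\mu(\varphi_1,\varphi_2,\delta,x_{\rm init})$, where $\varphi_1$ is $\mu$-strongly convex with $\mu>0$, $\operatorname{diam}(\operatorname{dom}\varphi_2)\le D$ and $x_{\rm init}\in\operatorname{dom}(\varphi_2)$, returns $\tilde x\in\operatorname{dom}(\varphi_2)$ with $\operatorname{dist}(0,\partial\varphi(\tilde x))\le\delta$ using $\mathcal O(\sqrt{L_{\varphi_1}/\mu}\,(1+\lceil\log_2(L_{\varphi_1}D/\delta)\rceil_+))$ proximal-gradient operations ($\lceil a\rceil_+$ is the smallest nonnegative integer $\ge a$). **Routine Dual$(\phi,\psi,\sigma,M,x_{\rm init};\delta)$**, $\phi=\phi_1+\phi_2$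 with $\phi_1$ $\mu_{\phi_1}$-strongly convex, $\psi=\psi_1+\psi_2$. Set $\varepsilon_1=\mu_{\phi_1}\delta^2$, $\varepsilon_2=\delta$, $\varepsilon_3=4M\delta$ and $A(z)={\rm APG}_\mu(\phi_1+z\psi_1,\phi_2+z\psi_2,\varepsilon_1,x_{\rm init})$. *Interval search*: $\tilde x=A(0)$; if $[\psi(\tilde x)]_+\le\varepsilon_2$ return $(\tilde x,0)$. Else $a=0$, $b=\sigma$, $\tilde x_a=\tilde x$, $\tilde x_b=A(b)$; while $[\psi(\tilde x_b)]_+>\varepsilon_2$ and $b<M$: $a\gets b$, $b\gets2b$, $\tilde x_a\gets\tilde x_b$, $\tilde x_b\gets A(b)$. If $|b\psi(\tilde x_b)|\le\varepsilon_3$ return $(\tilde x_b,b)$. *Bisection*: otherwise, while $b-a>\mu_{\phi_1}\delta^3$: $z=(a+b)/2$, $x=A(z)$; if $[\psi(x)]_+>\varepsilon_2$ set $a\gets z,\tilde x_a\gets x$; else if $|z\psi(x)|\le\varepsilon_3$ return $(x,z)$; else $b\gets z,\tilde x_b\gets x$. On loop exit return $(\tilde x_b,b)$. **Routine LBInit$(\delta_{\rm init},D_g,B_f,x^f_{\rm init},x^g_{\rm init})$** ($D_g>0$). Start with $\Delta\gets2\delta_{\rm init}$, $x_f\gets x^f_{\rm init}$, $x_g^{\rm ref}\gets x^g_{\rm init}$, $\tilde x\gets x^f_{\rm init}$. For $k=0,1,\dots$: $\Delta\gets\Delta/2$; $x_f\gets{\rm APG}_0(f_1,f_2+I_{\operatorname{dom}(g_2)},\Delta,x_f,D_g)$;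 $x_g^{\rm ref}\gets{\rm APG}_0(g_1,g_2,\Delta,x_g^{\rm ref},D_g)$; $l\gets f(x_f)+\Delta$; $M_\Delta\gets\max\{(g(x_f)-g(x_g^{\rm ref})+1)/\Delta,1\}$; $C_\Delta\gets4C_DM_\Delta$; $\eta\gets\Delta/C_D$; $(\tilde x,\cdot)\gets$ Dual$(G_\eta,f-l,1,M_\Delta,\tilde x;\Delta/C_\Delta)$; if $g(\tilde x)-g(x_g^{\rm ref})>\Delta$ return $(l,\Delta,x_f,M_\Delta)$. Here and below $G_\eta=g+\frac\eta2\|\cdot-x_f\|^2$, and Dual is applied to $(G_\eta,f-c)$ with $\phi_1=g_1+\frac\eta2\|\cdot-x_f\|^2$, $\phi_2=g_2$, $\psi_1=f_1-c$, $\psi_2=f_2$, $\mu_{\phi_1}=\eta$. **VTest.** Given $(l_0,\Delta,x_f,M_\Delta)$ returned by LBInit and $C_\Delta=4C_DM_\Delta$, for $c\ge l_0$, $0<\delta\le1/B_f$, $x_{\rm in}\in\operatorname{dom}(g_2)$: VTest$(c,\delta,x_{\rm in})=$ Dual$(G_\eta,f-c,1,M_\Delta,x_{\rm in};\delta/C_\Delta)$ with $\eta=\delta/C_D$. **Algorithm SNtVFA.** 1. $(l_0,\Delta,x_f,M_\Delta)\gets$ LBInit$(\delta_{\rm init},D_g,B_f,x^f_{\rm init},x^g_{\rm init})$. 2. $x_g\gets{\rm APG}_0(g_1,g_2,\epsilon/8,x^g_{\rm init},D_g)$, $u_0\gets f(x_g)$; if $u_0-l_0\le\epsilon$ return $x_g$.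 3. $c_0\gets l_0$, $\delta_0^0\gets\delta_{\rm init}$, $x_{\rm warm}\gets x_g$. 4. For $t=0,1,\dots$, for $j=0,1,\dots$: $(x_t^j,z_t^j)\gets$ VTest$(c_t,\delta_t^j,x_{\rm warm})$; ${\sf gap}_t^j=g(x_t^j)-g(x_g)$, ${\sf err}_t^j=(D_g^2+2)\delta_t^j$; then, testing in this order: (a) if ${\sf gap}_t^j\le7\epsilon/8$ and $\delta_t^j\le\epsilon$, return $x_t^j$; (b) else if $z_t^j=0$ and ${\sf err}_t^j\le\epsilon$, return $x_t^j$; (c) else if $z_t^j>0$ and ${\sf err}_t^j\le{\sf gap}_t^j/8$, set $c_{t+1}\gets c_t+({\sf gap}_t^j-{\sf err}_t^j)/z_t^j$, $x_{\rm warm}\gets x_t^j$, $\delta_{t+1}^0\gets\delta_t^j$ and leave the $j$-loop (go to $t+1$); (d) else $x_{\rm warm}\gets x_t^j$, $\delta_t^{j+1}\gets\delta_t^j/2$. *)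

theory Defs
  imports "HOL-Analysis.Analysis"
begin

section \<open>Convex-analytic notions for functions with values in \<open>(-\<infinity>, \<infinity>]\<close>\<close>

definition edom :: "('a \<Rightarrow> ereal) \<Rightarrow> 'a set" where
  "edom h = {x. h x < \<infinity>}"

definition proper_fun :: "('a \<Rightarrow> ereal) \<Rightarrow> bool" where
  "proper_fun h \<longleftrightarrow> (\<forall>x. h x \<noteq> -\<infinity>) \<and> (\<exists>x. h x \<noteq> \<infinity>)"

definition lsc_fun :: "('a::topological_space \<Rightarrow> ereal) \<Rightarrow> bool" where
  "lsc_fun h \<longleftrightarrow> (\<forall>x. h x \<le> Liminf (at x) h)"

definition convex_fun :: "('a::real_vector \<Rightarrow> ereal) \<Rightarrow> bool" where
  "convex_fun h \<longleftrightarrow> (\<forall>x y. \<forall>u\<in>{0<..<1}.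
     h ((1 - u) *\<^sub>R x + u *\<^sub>R y) \<le> ereal (1 - u) * h x + ereal u * h y)"

definition proper_lsc_convex :: "('a::euclidean_space \<Rightarrow> ereal) \<Rightarrow> bool" where
  "proper_lsc_convex h \<longleftrightarrow> proper_fun h \<and> lsc_fun h \<and> convex_fun h"

definition lipschitz_gradient :: "real \<Rightarrow> ('a::euclidean_space \<Rightarrow> real) \<Rightarrow> bool" where
  "lipschitz_gradient L \<phi> \<longleftrightarrow>
     (\<exists>\<phi>'. (\<forall>x. GDERIV \<phi> x :> \<phi>' x) \<and> L-lipschitz_on UNIV \<phi>')"

definition smooth_convex :: "real \<Rightarrow> ('a::euclidean_space \<Rightarrow> real) \<Rightarrow> bool" where
  "smooth_convex L \<phi> \<longleftrightarrow> 0 < L \<and> convex_on UNIV \<phi> \<and> lipschitz_gradient L \<phi>"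

definition strongly_convex :: "real \<Rightarrow> ('a::euclidean_space \<Rightarrow> real) \<Rightarrow> bool" where
  "strongly_convex \<mu> \<phi> \<longleftrightarrow> (\<forall>x y. \<forall>u\<in>{0..1}.
     \<phi> ((1 - u) *\<^sub>R x + u *\<^sub>R y)
       \<le> (1 - u) * \<phi> x + u * \<phi> y - \<mu> / 2 * u * (1 - u) * (norm (x - y))\<^sup>2)"

definition subdiff :: "('a::euclidean_space \<Rightarrow> ereal) \<Rightarrow> 'a \<Rightarrow> 'a set" where
  "subdiff h x = {v. \<forall>y. h x + ereal (v \<bullet> (y - x)) \<le> h y}"

definition minimizers :: "('a \<Rightarrow> ereal) \<Rightarrow> 'a set" where
  "minimizers h = {x. \<forall>y. h x \<le> h y}"

definition indicator_fun :: "'a set \<Rightarrow> 'a \<Rightarrow> ereal" where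
  "indicator_fun C x = (if x \<in> C then 0 else \<infinity>)"

definition composite :: "('a \<Rightarrow> real) \<Rightarrow> ('a \<Rightarrow> ereal) \<Rightarrow> 'a \<Rightarrow> ereal" where
  "composite \<phi>\<^sub>1 \<phi>\<^sub>2 x = ereal (\<phi>\<^sub>1 x) + \<phi>\<^sub>2 x"

text \<open>The real number computed by evaluating a composite function; meaningful on the domain
  only. All points at which the algorithms below evaluate lie in the domain.\<close>

definition cval :: "('a \<Rightarrow> real) \<Rightarrow> ('a \<Rightarrow> ereal) \<Rightarrow> 'a \<Rightarrow> real" where
  "cval \<phi>\<^sub>1 \<phi>\<^sub>2 x = real_of_ereal (composite \<phi>\<^sub>1 \<phi>\<^sub>2 x)"


section \<open>The simple bilevel problem\<close>

record 'a sbo =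
  f_1 :: "'a \<Rightarrow> real"
  f_2 :: "'a \<Rightarrow> ereal"
  g_1 :: "'a \<Rightarrow> real"
  g_2 :: "'a \<Rightarrow> ereal"
  L_f1 :: real
  L_g1 :: real

definition obj_f :: "'a sbo \<Rightarrow> 'a \<Rightarrow> ereal" where
  "obj_f P = composite (f_1 P) (f_2 P)"

definition obj_g :: "'a sbo \<Rightarrow> 'a \<Rightarrow> ereal" where
  "obj_g P = composite (g_1 P) (g_2 P)"

abbreviation "rf P \<equiv> cval (f_1 P) (f_2 P)"
abbreviation "rg P \<equiv> cval (g_1 P) (g_2 P)"

definition sbo_solutions :: "'a sbo \<Rightarrow> 'a set" where
  "sbo_solutions P =
     {x \<in> minimizers (obj_g P). \<forall>y \<in> minimizers (obj_g P). obj_f P x \<le> obj_f P y}"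

definition sbo_problem :: "('a::euclidean_space) sbo \<Rightarrow> bool" where
  "sbo_problem P \<longleftrightarrow>
     smooth_convex (L_f1 P) (f_1 P) \<and> smooth_convex (L_g1 P) (g_1 P) \<and> 1 \<le> L_g1 P \<and>
     proper_lsc_convex (f_2 P) \<and> proper_lsc_convex (g_2 P) \<and>
     minimizers (obj_g P) \<noteq> {} \<and> sbo_solutions P \<noteq> {}"

definition p_star :: "'a sbo \<Rightarrow> real" where
  "p_star P = real_of_ereal (INF x\<in>minimizers (obj_g P). obj_f P x)"

definition f_star :: "'a sbo \<Rightarrow> real" where
  "f_star P = real_of_ereal (INF x\<in>edom (g_2 P). obj_f P x)"

definition g_star :: "'a sbo \<Rightarrow> real" where
  "g_star P = real_of_ereal (INF x\<in>edom (g_2 P). obj_g P x)"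

definition assumption_A :: "('a::euclidean_space) sbo \<Rightarrow> real \<Rightarrow> bool" where
  "assumption_A P l_f2 \<longleftrightarrow>
     continuous_on (edom (g_2 P)) (g_2 P) \<and>
     edom (g_2 P) \<noteq> {} \<and> compact (edom (g_2 P)) \<and> convex (edom (g_2 P)) \<and>
     edom (g_2 P) \<subseteq> edom (f_2 P) \<and>
     l_f2-lipschitz_on (edom (g_2 P)) (\<lambda>x. real_of_ereal (f_2 P x)) \<and>
     p_star P > f_star P"

definition eps_optimal :: "'a sbo \<Rightarrow> real \<Rightarrow> real \<Rightarrow> 'a \<Rightarrow> bool" where
  "eps_optimal P \<epsilon>\<^sub>f \<epsilon>\<^sub>g x \<longleftrightarrow> x \<in> edom (g_2 P) \<and>
     obj_f P x - ereal (p_star P) \<le> ereal \<epsilon>\<^sub>f \<and>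
     obj_g P x - ereal (g_star P) \<le> ereal \<epsilon>\<^sub>g"

definition Omega_g :: "'a sbo \<Rightarrow> real" where
  "Omega_g P = (SUP x\<in>edom (g_2 P). rg P x - g_star P + 1)"

definition C_D :: "real \<Rightarrow> real" where
  "C_D D = 1 + D * (1 + D)"

definition g_bar :: "'a sbo \<Rightarrow> real \<Rightarrow> real" where
  "g_bar P c = real_of_ereal (INF x\<in>{x. obj_f P x \<le> ereal c}. obj_g P x)"

definition m_0 :: "'a sbo \<Rightarrow> real" where
  "m_0 P = g_bar P ((p_star P + f_star P) / 2) - g_star P"

definition Q_init :: "'a sbo \<Rightarrow> real \<Rightarrow> real" where
  "Q_init P \<delta>\<^sub>i\<^sub>n\<^sub>i\<^sub>t = Max {1 / \<delta>\<^sub>i\<^sub>n\<^sub>i\<^sub>t, 8 / (p_star P - f_star P), 8 / m_0 P}"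


section \<open>Black-box accelerated proximal gradient subroutines\<close>

text \<open>A subroutine returns a point together with the number of basic operations it used.
  Since one proximal-gradient operation takes a bounded number of basic operations, the
  constant \<open>K\<close> in the specifications below is the product of that bound and of the constant
  hidden in the \<open>\<O>\<close>-bound on the number of proximal-gradient operations. The constants which
  come with the arguments (the Lipschitz constant \<open>L\<close> of the gradient; for \<open>APG\<^sub>\<mu>\<close> also the
  modulus \<open>\<mu>\<close> and the diameter bound \<open>D\<close>) are passed explicitly; a subroutine may ignore them.
  Argument order: \<open>\<phi>\<^sub>1 \<phi>\<^sub>2 L \<delta> x\<^sub>i\<^sub>n\<^sub>i\<^sub>t D\<close> and \<open>\<phi>\<^sub>1 \<phi>\<^sub>2 L \<mu> D \<delta> x\<^sub>i\<^sub>n\<^sub>i\<^sub>t\<close>.\<close>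

type_synonym 'a apg_0 =
  "('a \<Rightarrow> real) \<Rightarrow> ('a \<Rightarrow> ereal) \<Rightarrow> real \<Rightarrow> real \<Rightarrow> 'a \<Rightarrow> real \<Rightarrow> 'a \<times> nat"
type_synonym 'a apg_mu =
  "('a \<Rightarrow> real) \<Rightarrow> ('a \<Rightarrow> ereal) \<Rightarrow> real \<Rightarrow> real \<Rightarrow> real \<Rightarrow> real \<Rightarrow> 'a \<Rightarrow> 'a \<times> nat"

text \<open>The summand 1 in the cost bound allows for the at least one operation used by a call even
  if \<open>D * sqrt (L / \<delta>)\<close> is tiny; this only enlarges the class of admissible subroutines.\<close>

definition apg_0_spec :: "real \<Rightarrow> ('a::euclidean_space) apg_0 \<Rightarrow> bool" where
  "apg_0_spec K apg \<longleftrightarrow> (\<forall>\<phi>\<^sub>1 \<phi>\<^sub>2 L \<delta> x D.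
     smooth_convex L \<phi>\<^sub>1 \<and> proper_lsc_convex \<phi>\<^sub>2 \<and> 0 < \<delta> \<and>
     minimizers (composite \<phi>\<^sub>1 \<phi>\<^sub>2) \<noteq> {} \<and> infdist x (minimizers (composite \<phi>\<^sub>1 \<phi>\<^sub>2)) \<le> D \<longrightarrow>
     (case apg \<phi>\<^sub>1 \<phi>\<^sub>2 L \<delta> x D of (y, n) \<Rightarrow>
        y \<in> edom \<phi>\<^sub>2 \<and>
        (\<forall>u. composite \<phi>\<^sub>1 \<phi>\<^sub>2 y \<le> composite \<phi>\<^sub>1 \<phi>\<^sub>2 u + ereal \<delta>) \<and>
        real n \<le> K * (1 + D * sqrt (L / \<delta>))))"

text \<open>The condition \<open>subdiff \<dots> \<noteq> {}\<close> is needed because \<^term>\<open>infdist x {} = 0\<close>, and boundedness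
  because \<^const>\<open>diameter\<close> is meaningless for unbounded sets.\<close>

definition apg_mu_spec :: "real \<Rightarrow> ('a::euclidean_space) apg_mu \<Rightarrow> bool" where
  "apg_mu_spec K apg \<longleftrightarrow> (\<forall>\<phi>\<^sub>1 \<phi>\<^sub>2 L \<mu> D \<delta> x.
     smooth_convex L \<phi>\<^sub>1 \<and> 0 < \<mu> \<and> strongly_convex \<mu> \<phi>\<^sub>1 \<and> proper_lsc_convex \<phi>\<^sub>2 \<and> 0 < \<delta> \<and>
     bounded (edom \<phi>\<^sub>2) \<and> diameter (edom \<phi>\<^sub>2) \<le> D \<and> x \<in> edom \<phi>\<^sub>2 \<longrightarrow>
     (case apg \<phi>\<^sub>1 \<phi>\<^sub>2 L \<mu> D \<delta> x of (y, n) \<Rightarrow>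
        y \<in> edom \<phi>\<^sub>2 \<and>
        subdiff (composite \<phi>\<^sub>1 \<phi>\<^sub>2) y \<noteq> {} \<and> infdist 0 (subdiff (composite \<phi>\<^sub>1 \<phi>\<^sub>2) y) \<le> \<delta> \<and>
        real n \<le> K * (sqrt (L / \<mu>) * (1 + real (nat \<lceil>log 2 (L * D / \<delta>)\<rceil>)))))"


section \<open>The algorithms\<close>

text \<open>All routines return \<open>None\<close> if they do not terminate, and otherwise their result paired with
  the number of basic operations. The argument \<open>T\<close> of a loop is the number of operations used
  before. Evaluating \<open>f\<close> or \<open>g\<close> at a point costs two basic operations (smooth and nonsmooth
  part), and every value is computed once and then reused. The points \<open>x\<^sub>a\<close> attached to the left
  ends of the search intervals are never read and are not stored.\<close>

partial_function (option) interval_search ::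
  "(real \<Rightarrow> 'a \<times> nat) \<Rightarrow> ('a \<Rightarrow> real) \<Rightarrow> real \<Rightarrow> real \<Rightarrow> real \<Rightarrow> real \<Rightarrow> 'a \<Rightarrow> nat
    \<Rightarrow> ((real \<times> real \<times> 'a) \<times> nat) option" where
  "interval_search A \<psi> M \<epsilon>\<^sub>2 a b x\<^sub>b T =
     (if max (\<psi> x\<^sub>b) 0 > \<epsilon>\<^sub>2 \<and> b < M
      then (let (x, n) = A (2 * b) in interval_search A \<psi> M \<epsilon>\<^sub>2 b (2 * b) x (T + n + 2))
      else Some ((a, b, x\<^sub>b), T))"

partial_function (option) bisection ::
  "(real \<Rightarrow> 'a \<times> nat) \<Rightarrow> ('a \<Rightarrow> real) \<Rightarrow> real \<Rightarrow> real \<Rightarrow> real \<Rightarrow> real \<Rightarrow> real \<Rightarrow> 'a \<Rightarrow> nat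
    \<Rightarrow> (('a \<times> real) \<times> nat) option" where
  "bisection A \<psi> \<epsilon>\<^sub>2 \<epsilon>\<^sub>3 w a b x\<^sub>b T =
     (if b - a > w
      then (let z = (a + b) / 2; (x, n) = A z; T' = T + n + 2 in
        if max (\<psi> x) 0 > \<epsilon>\<^sub>2 then bisection A \<psi> \<epsilon>\<^sub>2 \<epsilon>\<^sub>3 w z b x\<^sub>b T'
        else if \<bar>z * \<psi> x\<bar> \<le> \<epsilon>\<^sub>3 then Some ((x, z), T')
        else bisection A \<psi> \<epsilon>\<^sub>2 \<epsilon>\<^sub>3 w a z x T')
      else Some ((x\<^sub>b, b), T))"

text \<open>\<open>L\<^sub>\<phi>\<close> and \<open>L\<^sub>\<psi>\<close> are Lipschitz constants of the gradients of \<open>\<phi>\<^sub>1\<close> and \<open>\<psi>\<^sub>1\<close>. For \<open>z = 0\<close> the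
  convention \<open>0 * \<infinity> = 0\<close> of \<^typ>\<open>ereal\<close> makes \<open>\<phi>\<^sub>2 + z \<psi>\<^sub>2\<close> equal to \<open>\<phi>\<^sub>2\<close>.\<close>

definition dual ::
  "'a apg_mu \<Rightarrow> real
    \<Rightarrow> ('a \<Rightarrow> real) \<Rightarrow> ('a \<Rightarrow> ereal) \<Rightarrow> real \<Rightarrow> real
    \<Rightarrow> ('a \<Rightarrow> real) \<Rightarrow> ('a \<Rightarrow> ereal) \<Rightarrow> real
    \<Rightarrow> real \<Rightarrow> real \<Rightarrow> 'a \<Rightarrow> real \<Rightarrow> (('a \<times> real) \<times> nat) option" where
  "dual apg D \<phi>\<^sub>1 \<phi>\<^sub>2 L\<^sub>\<phi> \<mu> \<psi>\<^sub>1 \<psi>\<^sub>2 L\<^sub>\<psi> \<sigma> M x\<^sub>i\<^sub>n\<^sub>i\<^sub>t \<delta> =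
     (let \<epsilon>\<^sub>1 = \<mu> * \<delta>\<^sup>2; \<epsilon>\<^sub>2 = \<delta>; \<epsilon>\<^sub>3 = 4 * M * \<delta>;
          \<psi> = cval \<psi>\<^sub>1 \<psi>\<^sub>2;
          A = (\<lambda>z. apg (\<lambda>x. \<phi>\<^sub>1 x + z * \<psi>\<^sub>1 x) (\<lambda>x. \<phi>\<^sub>2 x + ereal z * \<psi>\<^sub>2 x)
                       (L\<^sub>\<phi> + z * L\<^sub>\<psi>) \<mu> D \<epsilon>\<^sub>1 x\<^sub>i\<^sub>n\<^sub>i\<^sub>t);
          (x\<^sub>0, n\<^sub>0) = A 0
      in if max (\<psi> x\<^sub>0) 0 \<le> \<epsilon>\<^sub>2 then Some ((x\<^sub>0, 0), n\<^sub>0 + 2)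
         else let (x\<^sub>1, n\<^sub>1) = A \<sigma> in
           case interval_search A \<psi> M \<epsilon>\<^sub>2 0 \<sigma> x\<^sub>1 (n\<^sub>0 + 2 + n\<^sub>1 + 2) of
             None \<Rightarrow> None
           | Some ((a, b, x\<^sub>b), T) \<Rightarrow>
               if \<bar>b * \<psi> x\<^sub>b\<bar> \<le> \<epsilon>\<^sub>3 then Some ((x\<^sub>b, b), T)
               else bisection A \<psi> \<epsilon>\<^sub>2 \<epsilon>\<^sub>3 (\<mu> * \<delta> ^ 3) a b x\<^sub>b T)"

text \<open>\<open>Dual(G\<^sub>\<eta>, f - c, 1, M, x\<^sub>i\<^sub>n; \<delta> / (4 C\<^sub>D M))\<close> with \<open>\<eta> = \<delta> / C\<^sub>D\<close> and
  \<open>G\<^sub>\<eta> = g + (\<eta> / 2) \<parallel>\<cdot> - x\<^sub>f\<parallel>\<^sup>2\<close>. The call of \<open>Dual\<close> in \<open>LBInit\<close> has the same form, with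
  \<open>c = l\<close> and \<open>\<delta> = \<Delta>\<close>.\<close>

definition vtest ::
  "('a::euclidean_space) apg_mu \<Rightarrow> 'a sbo \<Rightarrow> real \<Rightarrow> 'a \<Rightarrow> real
    \<Rightarrow> real \<Rightarrow> real \<Rightarrow> 'a \<Rightarrow> (('a \<times> real) \<times> nat) option" where
  "vtest apg P D\<^sub>g x\<^sub>f M c \<delta> x\<^sub>i\<^sub>n =
     (let \<eta> = \<delta> / C_D D\<^sub>g in
      dual apg D\<^sub>g
        (\<lambda>x. g_1 P x + \<eta> / 2 * (norm (x - x\<^sub>f))\<^sup>2) (g_2 P) (L_g1 P + \<eta>) \<eta>
        (\<lambda>x. f_1 P x - c) (f_2 P) (L_f1 P)
        1 M x\<^sub>i\<^sub>n (\<delta> / (4 * C_D D\<^sub>g * M)))"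

partial_function (option) lbinit_loop ::
  "('a::euclidean_space) apg_0 \<Rightarrow> 'a apg_mu \<Rightarrow> 'a sbo \<Rightarrow> real
    \<Rightarrow> real \<Rightarrow> 'a \<Rightarrow> 'a \<Rightarrow> 'a \<Rightarrow> nat \<Rightarrow> ((real \<times> real \<times> 'a \<times> real) \<times> nat) option" where
  "lbinit_loop apg\<^sub>0 apg\<^sub>\<mu> P D\<^sub>g \<Delta>' x\<^sub>f' x\<^sub>g' x\<^sub>t T =
     (let \<Delta> = \<Delta>' / 2;
          (x\<^sub>f, n\<^sub>1) = apg\<^sub>0 (f_1 P) (\<lambda>x. f_2 P x + indicator_fun (edom (g_2 P)) x)
                         (L_f1 P) \<Delta> x\<^sub>f' D\<^sub>g;
          (x\<^sub>g, n\<^sub>2) = apg\<^sub>0 (g_1 P) (g_2 P) (L_g1 P) \<Delta> x\<^sub>g' D\<^sub>g;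
          l = rf P x\<^sub>f + \<Delta>;
          M = max ((rg P x\<^sub>f - rg P x\<^sub>g + 1) / \<Delta>) 1
      in case vtest apg\<^sub>\<mu> P D\<^sub>g x\<^sub>f M l \<Delta> x\<^sub>t of
           None \<Rightarrow> None
         | Some ((x, z), n\<^sub>3) \<Rightarrow>
             (let T' = T + n\<^sub>1 + n\<^sub>2 + n\<^sub>3 + 8 in
              if rg P x - rg P x\<^sub>g > \<Delta> then Some ((l, \<Delta>, x\<^sub>f, M), T')
              else lbinit_loop apg\<^sub>0 apg\<^sub>\<mu> P D\<^sub>g \<Delta> x\<^sub>f x\<^sub>g x T'))"

definition lbinit ::
  "('a::euclidean_space) apg_0 \<Rightarrow> 'a apg_mu \<Rightarrow> 'a sbo \<Rightarrow> real \<Rightarrow> real \<Rightarrow> 'a \<Rightarrow> 'a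
    \<Rightarrow> ((real \<times> real \<times> 'a \<times> real) \<times> nat) option" where
  "lbinit apg\<^sub>0 apg\<^sub>\<mu> P \<delta>\<^sub>i\<^sub>n\<^sub>i\<^sub>t D\<^sub>g x\<^sub>f x\<^sub>g =
     lbinit_loop apg\<^sub>0 apg\<^sub>\<mu> P D\<^sub>g (2 * \<delta>\<^sub>i\<^sub>n\<^sub>i\<^sub>t) x\<^sub>f x\<^sub>g x\<^sub>f 0"

text \<open>The nested loops over \<open>t\<close> and \<open>j\<close> form one loop with state \<open>(c, \<delta>, x\<^sub>w\<^sub>a\<^sub>r\<^sub>m)\<close>: case (c) starts
  the next \<open>t\<close> with the current \<open>\<delta>\<close>, and case (d) is the next \<open>j\<close>. The argument \<open>v\<close> is \<open>g(x\<^sub>g)\<close>.\<close>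

partial_function (option) sntvfa_loop ::
  "('a::euclidean_space) apg_mu \<Rightarrow> 'a sbo \<Rightarrow> real \<Rightarrow> real \<Rightarrow> real \<Rightarrow> 'a \<Rightarrow> real
    \<Rightarrow> real \<Rightarrow> real \<Rightarrow> 'a \<Rightarrow> nat \<Rightarrow> ('a \<times> nat) option" where
  "sntvfa_loop apg\<^sub>\<mu> P \<epsilon> D\<^sub>g v x\<^sub>f M c \<delta> x\<^sub>w T =
     (case vtest apg\<^sub>\<mu> P D\<^sub>g x\<^sub>f M c \<delta> x\<^sub>w of
        None \<Rightarrow> None
      | Some ((x, z), n) \<Rightarrow>
          (let gap = rg P x - v; err = (D\<^sub>g\<^sup>2 + 2) * \<delta>; T' = T + n + 2 in
           if gap \<le> 7 * \<epsilon> / 8 \<and> \<delta> \<le> \<epsilon> then Some (x, T')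
           else if z = 0 \<and> err \<le> \<epsilon> then Some (x, T')
           else if z > 0 \<and> err \<le> gap / 8
             then sntvfa_loop apg\<^sub>\<mu> P \<epsilon> D\<^sub>g v x\<^sub>f M (c + (gap - err) / z) \<delta> x T'
           else sntvfa_loop apg\<^sub>\<mu> P \<epsilon> D\<^sub>g v x\<^sub>f M c (\<delta> / 2) x T'))"

text \<open>The Lipschitz constant \<open>B\<^sub>f\<close> only restricts the admissible \<open>\<delta>\<^sub>i\<^sub>n\<^sub>i\<^sub>t\<close>; no step of \<open>LBInit\<close> or of
  \<open>SNtVFA\<close> uses it, so it is not an argument here.\<close>

definition sntvfa ::
  "('a::euclidean_space) apg_0 \<Rightarrow> 'a apg_mu \<Rightarrow> 'a sbo \<Rightarrow> real \<Rightarrow> real \<Rightarrow> real \<Rightarrow> 'a \<Rightarrow> 'a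
    \<Rightarrow> ('a \<times> nat) option" where
  "sntvfa apg\<^sub>0 apg\<^sub>\<mu> P \<epsilon> D\<^sub>g \<delta>\<^sub>i\<^sub>n\<^sub>i\<^sub>t xf\<^sub>i\<^sub>n\<^sub>i\<^sub>t xg\<^sub>i\<^sub>n\<^sub>i\<^sub>t =
     (case lbinit apg\<^sub>0 apg\<^sub>\<mu> P \<delta>\<^sub>i\<^sub>n\<^sub>i\<^sub>t D\<^sub>g xf\<^sub>i\<^sub>n\<^sub>i\<^sub>t xg\<^sub>i\<^sub>n\<^sub>i\<^sub>t of
        None \<Rightarrow> None
      | Some ((l\<^sub>0, \<Delta>, x\<^sub>f, M), T\<^sub>p\<^sub>r\<^sub>e) \<Rightarrow>
          (let (x\<^sub>g, n) = apg\<^sub>0 (g_1 P) (g_2 P) (L_g1 P) (\<epsilon> / 8) xg\<^sub>i\<^sub>n\<^sub>i\<^sub>t D\<^sub>g in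
           if rf P x\<^sub>g - l\<^sub>0 \<le> \<epsilon> then Some (x\<^sub>g, T\<^sub>p\<^sub>r\<^sub>e + n + 2)
           else sntvfa_loop apg\<^sub>\<mu> P \<epsilon> D\<^sub>g (rg P x\<^sub>g) x\<^sub>f M l\<^sub>0 \<delta>\<^sub>i\<^sub>n\<^sub>i\<^sub>t x\<^sub>g (T\<^sub>p\<^sub>r\<^sub>e + n + 4)))"


section \<open>Complexity bounds\<close>

text \<open>Constants hidden in \<open>\<O>\<close> are independent of \<open>\<epsilon>\<close> and may depend on the problem data
  through logarithmic factors only. We make this precise by writing a hidden constant as
  \<open>K * \<Lambda> ^ p\<close>, where \<open>K\<close> and \<open>p\<close> depend neither on the problem nor on the inputs and \<open>\<Lambda>\<close> is the
  following logarithmic factor, to which the second bound adds \<open>ln (Q_init P \<delta>\<^sub>i\<^sub>n\<^sub>i\<^sub>t)\<close>. (The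
  first bound has an explicit power of \<open>1 + log Q\<^sub>i\<^sub>n\<^sub>i\<^sub>t\<close> already.)\<close>

definition log_factor :: "'a sbo \<Rightarrow> real \<Rightarrow> real" where
  "log_factor P D\<^sub>g =
     1 + ln (1 + L_f1 P) + ln (L_g1 P) + ln (C_D D\<^sub>g) + ln (Omega_g P)"

definition pre_bound :: "'a sbo \<Rightarrow> real \<Rightarrow> real \<Rightarrow> real" where
  "pre_bound P D\<^sub>g \<delta>\<^sub>i\<^sub>n\<^sub>i\<^sub>t =
     (let Q = Q_init P \<delta>\<^sub>i\<^sub>n\<^sub>i\<^sub>t in
      (sqrt (C_D D\<^sub>g * L_f1 P * Omega_g P) * Q + sqrt (C_D D\<^sub>g * L_g1 P) * sqrt Q)
        * (1 + ln Q)\<^sup>2)"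

definition main_bound :: "'a sbo \<Rightarrow> real \<Rightarrow> real \<Rightarrow> real \<Rightarrow> real" where
  "main_bound P D\<^sub>g \<delta>\<^sub>i\<^sub>n\<^sub>i\<^sub>t \<epsilon> =
     D\<^sub>g * sqrt (L_g1 P / \<epsilon>)
     + sqrt (C_D D\<^sub>g * (D\<^sub>g\<^sup>2 + 2) * (L_g1 P + L_f1 P * Omega_g P * Q_init P \<delta>\<^sub>i\<^sub>n\<^sub>i\<^sub>t) / \<epsilon>)
       * (1 + ln (1 / \<epsilon>)) ^ 3"

end

theory Submission
  imports Defs
begin

text \<open>
  Write \<open>X = dom g\<^sub>2\<close>, and let \<open>v(c)\<close> be the minimum of \<open>g\<close> over the points of \<open>X\<close> with \<open>f \<le> c\<close>. The
  number \<open>p\<^sup>*\<close> is the smallest root of the convex decreasing function \<open>v - g\<^sup>*\<close>, and the algorithm is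
  an inexact Newton method for this root, started from the left.

  The test (\<open>vtest_correct\<close>) returns a point \<open>x\<close> with \<open>f x\<close> at most slightly above \<open>c\<close> and a
  multiplier \<open>z\<close> such that \<open>g x - \<delta> - z (c' - c)\<close> minorizes \<open>v(c')\<close>. Its core is the dual search
  (\<open>dual_correct\<close>). Since the penalized functions are strongly convex, approximate minimizers for
  close multipliers have close constraint values (\<open>penalized_compare\<close>); a bisection interval
  without a nearly complementary pair therefore cannot become short. The Slater point found by
  the initialization bounds the multipliers.

  Minorants give the soundness of the method: evaluated at a solution of the bilevel problem they
  show that the initial level and every Newton iterate are at most \<open>p\<^sup>*\<close>, and that a returned point
  with multiplier zero almost minimizes \<open>g\<close>; a small gap certifies this directly.

  For the complexity, the initialization (\<open>lbinit_loop_correct\<close>) ends before \<open>\<Delta>\<close> falls below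
  \<open>1 / (2 Q)\<close>, and its costs form geometric sums. In the Newton iteration
  (\<open>sntvfa_loop_correct\<close>), \<open>\<delta>\<close> never falls below a fixed multiple of \<open>\<epsilon> / (D\<^sup>2 + 2)\<close>, and each Newton
  step at least halves the product of gap and multiplier, which is bounded below by a multiple of
  \<open>\<epsilon>\<^sup>2\<close>; so the number of tests is logarithmic. Each test makes logarithmically many calls of the
  inner solver, and each call contributes one more logarithm, which accounts for the third power.
\<close>

section \<open>Closure properties of the function classes\<close>

lemma lsc_fun_iff:
  "lsc_fun h \<longleftrightarrow> (\<forall>x. \<forall>y<h x. eventually (\<lambda>u. y < h u) (at x))"
  unfolding lsc_fun_def le_Liminf_iff ..

text \<open>The sum of two lower semicontinuous functions needs a real bound below each summand; in
  \<^typ>\<open>ereal\<close> these exist also when a summand is infinite.\<close>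

lemma ereal_less_add_split:
  fixes p q :: ereal
  assumes "p \<noteq> -\<infinity>" "q \<noteq> -\<infinity>" "ereal r < p + q"
  shows "\<exists>a b. ereal a < p \<and> ereal b < q \<and> r \<le> a + b"
proof (cases p)
  case (real p')
  show ?thesis
  proof (cases q)
    case (real q')
    then have "r < p' + q'" using assms \<open>p = ereal p'\<close> by simp
    then show ?thesis using real \<open>p = ereal p'\<close>
      by (intro exI[of _ "p' - (p' + q' - r) / 2"] exI[of _ "q' - (p' + q' - r) / 2"])
         (auto simp: field_simps)
  next
    case PInf
    then show ?thesis using real
      by (intro exI[of _ "p' - 1"] exI[of _ "r - p' + 1"]) auto
  qed (use assms in auto)
next
  case PInf
  show ?thesis
  proof (cases q)
    case (real q')
    then show ?thesis using PInf
      by (intro exI[of _ "r - q' + 1"] exI[of _ "q' - 1"]) auto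
  next
    case q: PInf
    then show ?thesis using PInf by (intro exI[of _ r] exI[of _ 0]) auto
  qed (use assms in auto)
qed (use assms in auto)

lemma lsc_fun_add:
  assumes "lsc_fun h" "lsc_fun k" "\<And>x. h x \<noteq> -\<infinity>" "\<And>x. k x \<noteq> -\<infinity>"
  shows "lsc_fun (\<lambda>x. h x + k x)"
  unfolding lsc_fun_iff
proof (intro allI impI)
  fix x and y :: ereal
  assume y: "y < h x + k x"
  have fin: "h u + k u \<noteq> -\<infinity>" for u
    using assms(3,4)[of u] by (cases "h u"; cases "k u") auto
  show "eventually (\<lambda>u. y < h u + k u) (at x)"
  proof (cases y)
    case (real r)
    obtain a b where ab: "ereal a < h x" "ereal b < k x" "r \<le> a + b"
      using ereal_less_add_split[OF assms(3,4), of r x x] y real by auto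
    have "eventually (\<lambda>u. ereal a < h u) (at x)" "eventually (\<lambda>u. ereal b < k u) (at x)"
      using assms(1,2) ab unfolding lsc_fun_iff by auto
    then show ?thesis
    proof eventually_elim
      case (elim u)
      have "ereal r \<le> ereal a + ereal b" using ab by simp
      also have "\<dots> < h u + k u"
        using elim by (cases "h u"; cases "k u") auto
      finally show ?case using real by simp
    qed
  next
    case MInf
    have "y < h u + k u" for u
      unfolding MInf by (rule ereal_MInfty_lessI[OF fin])
    then show ?thesis by (intro always_eventually allI)
  qed (use y in auto)
qed

lemma convex_fun_add:
  fixes h k :: "'a::real_vector \<Rightarrow> ereal"
  assumes "convex_fun h" "convex_fun k" "\<And>x. h x \<noteq> -\<infinity>" "\<And>x. k x \<noteq> -\<infinity>"
  shows "convex_fun (\<lambda>x. h x + k x)"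
  unfolding convex_fun_def
proof (intro allI ballI)
  fix x y :: 'a and u :: real
  assume u: "u \<in> {0<..<1}"
  let ?w = "(1 - u) *\<^sub>R x + u *\<^sub>R y"
  have "h ?w + k ?w \<le> (ereal (1 - u) * h x + ereal u * h y) + (ereal (1 - u) * k x + ereal u * k y)"
    using assms(1,2) u unfolding convex_fun_def by (intro add_mono) auto
  also have "\<dots> = ereal (1 - u) * (h x + k x) + ereal u * (h y + k y)"
    using assms(3)[of x] assms(3)[of y] assms(4)[of x] assms(4)[of y] u
    by (cases "h x"; cases "h y"; cases "k x"; cases "k y") (auto simp: algebra_simps)
  finally show "h ?w + k ?w \<le> ereal (1 - u) * (h x + k x) + ereal u * (h y + k y)" .
qed

lemma proper_lsc_convex_add:
  assumes "proper_lsc_convex h" "proper_lsc_convex k" "edom h \<inter> edom k \<noteq> {}"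
  shows "proper_lsc_convex (\<lambda>x. h x + k x)"
proof -
  have m: "\<And>x. h x \<noteq> -\<infinity>" "\<And>x. k x \<noteq> -\<infinity>"
    using assms(1,2) by (auto simp: proper_lsc_convex_def proper_fun_def)
  obtain x where "h x < \<infinity>" "k x < \<infinity>" using assms(3) by (auto simp: edom_def)
  then have "h x + k x \<noteq> \<infinity>" by auto
  moreover have "h u + k u \<noteq> -\<infinity>" for u
    using m[of u] by (cases "h u"; cases "k u") auto
  ultimately have "proper_fun (\<lambda>x. h x + k x)"
    unfolding proper_fun_def by blast
  then show ?thesis
    using lsc_fun_add[OF _ _ m] convex_fun_add[OF _ _ m] assms(1,2)
    by (auto simp: proper_lsc_convex_def)
qed

lemma proper_lsc_convex_scale:
  assumes "proper_lsc_convex (h :: 'a::euclidean_space \<Rightarrow> ereal)" "0 < z"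
  shows "proper_lsc_convex (\<lambda>x. ereal z * h x)"
proof -
  have m: "\<And>x. h x \<noteq> -\<infinity>"
    using assms(1) by (auto simp: proper_lsc_convex_def proper_fun_def)
  obtain x where "h x \<noteq> \<infinity>" using assms(1) by (auto simp: proper_lsc_convex_def proper_fun_def)
  then have "ereal z * h x \<noteq> \<infinity>" using assms(2) m by (cases "h x") auto
  moreover have "ereal z * h u \<noteq> -\<infinity>" for u using m[of u] assms(2) by (cases "h u") auto
  ultimately have p: "proper_fun (\<lambda>x. ereal z * h x)" unfolding proper_fun_def by blast
  have "ereal z * h x \<le> Liminf (at x) (\<lambda>x. ereal z * h x)" for x
    using assms
    by (subst Liminf_ereal_mult_left)
       (auto intro!: ereal_mult_left_mono simp: proper_lsc_convex_def lsc_fun_def)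
  moreover have "convex_fun (\<lambda>x. ereal z * h x)"
    unfolding convex_fun_def
  proof (intro allI ballI)
    fix x y :: 'a and u :: real
    assume u: "u \<in> {0<..<1}"
    let ?w = "(1 - u) *\<^sub>R x + u *\<^sub>R y"
    have "ereal z * h ?w \<le> ereal z * (ereal (1 - u) * h x + ereal u * h y)"
      using assms u by (intro ereal_mult_left_mono) (auto simp: proper_lsc_convex_def convex_fun_def)
    also have "\<dots> = ereal (1 - u) * (ereal z * h x) + ereal u * (ereal z * h y)"
      using m[of x] m[of y] u assms(2)
      by (cases "h x"; cases "h y") (auto simp: algebra_simps)
    finally show "ereal z * h ?w \<le> \<dots>" .
  qed
  ultimately show ?thesis using p by (simp add: proper_lsc_convex_def lsc_fun_def)
qed

text \<open>For \<open>z = 0\<close> the convention \<open>0 * \<infinity> = 0\<close> makes the second summand vanish everywhere, so this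
  case does not follow from the case of a positive factor.\<close>

lemma proper_lsc_convex_add_scale:
  assumes "proper_lsc_convex h" "proper_lsc_convex k" "edom h \<inter> edom k \<noteq> {}" "0 \<le> z"
  shows "proper_lsc_convex (\<lambda>x. h x + ereal z * k x)"
proof (cases "z = 0")
  case True
  then show ?thesis using assms(1) by (simp add: zero_ereal_def[symmetric])
next
  case False
  have "edom h \<inter> edom (\<lambda>x. ereal z * k x) \<noteq> {}"
    using assms(3,4) by (auto simp: edom_def)
  then show ?thesis
    using proper_lsc_convex_add[OF assms(1) proper_lsc_convex_scale[OF assms(2)]] False assms(4)
    by simp
qed

lemma proper_lsc_convex_indicator:
  assumes "closed C" "convex C" "C \<noteq> {}"
  shows "proper_lsc_convex (indicator_fun (C :: 'a::euclidean_space set))"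
proof -
  have "lsc_fun (indicator_fun C)"
    unfolding lsc_fun_iff
  proof (intro allI impI)
    fix x and y :: ereal
    assume y: "y < indicator_fun C x"
    show "eventually (\<lambda>u. y < indicator_fun C u) (at x)"
    proof (cases "x \<in> C")
      case True
      then show ?thesis using y by (intro always_eventually) (auto simp: indicator_fun_def)
    next
      case False
      have "eventually (\<lambda>u. u \<in> - C) (at x)"
        using False assms(1) by (intro eventually_at_topological[THEN iffD2]) auto
      then show ?thesis
      proof eventually_elim
        case (elim u)
        then show ?case using y False by (simp add: indicator_fun_def)
      qed
    qed
  qed
  moreover have "convex_fun (indicator_fun C)"
    unfolding convex_fun_def
  proof (intro allI ballI)
    fix x y :: 'a and u :: real
    assume u: "u \<in> {0<..<1}"
    show "indicator_fun C ((1 - u) *\<^sub>R x + u *\<^sub>R y)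
      \<le> ereal (1 - u) * indicator_fun C x + ereal u * indicator_fun C y"
    proof (cases "x \<in> C \<and> y \<in> C")
      case True
      then have "(1 - u) *\<^sub>R x + u *\<^sub>R y \<in> C" using assms(2) u by (auto simp: convex_alt)
      then show ?thesis using True by (simp add: indicator_fun_def)
    qed (use u in \<open>auto simp: indicator_fun_def\<close>)
  qed
  moreover have "proper_fun (indicator_fun C)"
    using assms(3) by (auto simp: proper_fun_def indicator_fun_def)
  ultimately show ?thesis by (simp add: proper_lsc_convex_def)
qed

lemma smooth_convex_add_scale:
  fixes \<phi> \<psi> :: "'a::euclidean_space \<Rightarrow> real"
  assumes "smooth_convex L1 \<phi>" "smooth_convex L2 \<psi>" "0 \<le> z"
  shows "smooth_convex (L1 + z * L2) (\<lambda>x. \<phi> x + z * (\<psi> x - c))"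
proof -
  obtain \<phi>' \<psi>' where d: "\<And>x. GDERIV \<phi> x :> \<phi>' x" "L1-lipschitz_on UNIV \<phi>'"
    "\<And>x. GDERIV \<psi> x :> \<psi>' x" "L2-lipschitz_on UNIV \<psi>'"
    using assms(1,2) unfolding smooth_convex_def lipschitz_gradient_def by blast
  have "GDERIV (\<lambda>x. \<phi> x + z * (\<psi> x - c)) x :> \<phi>' x + z *\<^sub>R \<psi>' x" for x
    using GDERIV_add[OF d(1) GDERIV_mult[OF GDERIV_const[of z] GDERIV_diff[OF d(3) GDERIV_const[of c]]]]
    by simp
  moreover have "(L1 + z * L2)-lipschitz_on UNIV (\<lambda>x. \<phi>' x + z *\<^sub>R \<psi>' x)"
    using lipschitz_on_add[OF d(2) lipschitz_on_cmult_nonneg[OF d(4) assms(3)]] .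
  moreover have "convex_on UNIV (\<lambda>x. \<phi> x + z * (\<psi> x - c))"
    unfolding convex_on_def
  proof (intro conjI ballI allI impI)
    fix x y :: 'a and u v :: real
    assume uv: "0 \<le> u" "0 \<le> v" "u + v = 1"
    have a: "\<phi> (u *\<^sub>R x + v *\<^sub>R y) \<le> u * \<phi> x + v * \<phi> y" "\<psi> (u *\<^sub>R x + v *\<^sub>R y) \<le> u * \<psi> x + v * \<psi> y"
      using assms(1,2) uv by (auto simp: smooth_convex_def convex_on_def)
    have "z * (\<psi> (u *\<^sub>R x + v *\<^sub>R y) - c) \<le> z * (u * \<psi> x + v * \<psi> y - (u + v) * c)"
      using a(2) uv assms(3) by (intro mult_left_mono) auto
    with a(1) show "\<phi> (u *\<^sub>R x + v *\<^sub>R y) + z * (\<psi> (u *\<^sub>R x + v *\<^sub>R y) - c)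
      \<le> u * (\<phi> x + z * (\<psi> x - c)) + v * (\<phi> y + z * (\<psi> y - c))"
      by (simp add: algebra_simps)
  qed simp
  moreover have "0 < L1 + z * L2"
    using assms by (auto simp: smooth_convex_def add_pos_nonneg)
  ultimately show ?thesis
    unfolding smooth_convex_def lipschitz_gradient_def
    by (auto intro!: exI[of _ "\<lambda>x. \<phi>' x + z *\<^sub>R \<psi>' x"])
qed

lemma norm_convex_combination_sq:
  fixes x y :: "'a::real_inner"
  shows "(norm ((1 - u) *\<^sub>R x + u *\<^sub>R y))\<^sup>2
    = (1 - u) * (norm x)\<^sup>2 + u * (norm y)\<^sup>2 - u * (1 - u) * (norm (x - y))\<^sup>2"
  unfolding power2_norm_eq_inner by (simp add: algebra_simps inner_commute)

lemma strongly_convex_quadratic: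
  "strongly_convex \<eta> (\<lambda>x. \<eta> / 2 * (norm (x - a))\<^sup>2)"
  unfolding strongly_convex_def
proof (intro allI ballI)
  fix x y :: 'a and u :: real
  have "(1 - u) *\<^sub>R x + u *\<^sub>R y - a = (1 - u) *\<^sub>R (x - a) + u *\<^sub>R (y - a)"
    by (simp add: algebra_simps)
  then have eq: "(norm ((1 - u) *\<^sub>R x + u *\<^sub>R y - a))\<^sup>2
    = (1 - u) * (norm (x - a))\<^sup>2 + u * (norm (y - a))\<^sup>2 - u * (1 - u) * (norm (x - y))\<^sup>2"
    using norm_convex_combination_sq[of u "x - a" "y - a"] by simp
  show "\<eta> / 2 * (norm ((1 - u) *\<^sub>R x + u *\<^sub>R y - a))\<^sup>2
    \<le> (1 - u) * (\<eta> / 2 * (norm (x - a))\<^sup>2) + u * (\<eta> / 2 * (norm (y - a))\<^sup>2)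
      - \<eta> / 2 * u * (1 - u) * (norm (x - y))\<^sup>2"
    unfolding eq by (simp add: field_simps)
qed

lemma strongly_convex_add_convex:
  assumes "strongly_convex \<eta> \<phi>" "convex_on UNIV \<psi>"
  shows "strongly_convex \<eta> (\<lambda>x. \<psi> x + \<phi> x)"
  unfolding strongly_convex_def
proof (intro allI ballI)
  fix x y :: 'a and u :: real
  assume u: "u \<in> {0..1}"
  have "\<psi> ((1 - u) *\<^sub>R x + u *\<^sub>R y) \<le> (1 - u) * \<psi> x + u * \<psi> y"
    using u by (intro convex_onD[OF assms(2)]) auto
  moreover have "\<phi> ((1 - u) *\<^sub>R x + u *\<^sub>R y)
       \<le> (1 - u) * \<phi> x + u * \<phi> y - \<eta> / 2 * u * (1 - u) * (norm (x - y))\<^sup>2"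
    using assms(1) u by (auto simp: strongly_convex_def)
  ultimately show "\<psi> ((1 - u) *\<^sub>R x + u *\<^sub>R y) + \<phi> ((1 - u) *\<^sub>R x + u *\<^sub>R y)
    \<le> (1 - u) * (\<psi> x + \<phi> x) + u * (\<psi> y + \<phi> y) - \<eta> / 2 * u * (1 - u) * (norm (x - y))\<^sup>2"
    by (simp add: algebra_simps)
qed

lemma smooth_convex_add_quadratic:
  assumes "smooth_convex L \<phi>" "0 < \<eta>"
  shows "smooth_convex (L + \<eta>) (\<lambda>x. \<phi> x + \<eta> / 2 * (norm (x - a))\<^sup>2)"
proof -
  have sq: "GDERIV (\<lambda>x. (norm (x - a))\<^sup>2 / 2) x :> x - a" for x :: 'a
    unfolding gderiv_def power2_norm_eq_inner
    by (rule derivative_eq_intros refl | simp add: inner_commute)+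
  have "smooth_convex 1 (\<lambda>x. (norm (x - a))\<^sup>2 / 2)"
    unfolding smooth_convex_def lipschitz_gradient_def
  proof (intro conjI exI[of _ "\<lambda>x. x - a"] allI sq)
    show "1-lipschitz_on UNIV (\<lambda>x. x - a)"
      by (intro lipschitz_onI) (auto simp: dist_norm)
    show "convex_on UNIV (\<lambda>x. (norm (x - a))\<^sup>2 / 2)"
    proof (intro convex_onI)
      fix t :: real and x y :: 'a
      assume t: "0 < t" "t < 1"
      have "1 / 2 * t * (1 - t) * (norm (x - y))\<^sup>2 \<ge> 0" using t by auto
      moreover have "(1 / 2) * (norm ((1 - t) *\<^sub>R x + t *\<^sub>R y - a))\<^sup>2
        \<le> (1 - t) * ((1 / 2) * (norm (x - a))\<^sup>2) + t * ((1 / 2) * (norm (y - a))\<^sup>2)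
          - 1 / 2 * t * (1 - t) * (norm (x - y))\<^sup>2"
        using strongly_convex_quadratic[of 1 a] t by (auto simp: strongly_convex_def)
      ultimately show "(norm ((1 - t) *\<^sub>R x + t *\<^sub>R y - a))\<^sup>2 / 2
        \<le> (1 - t) * ((norm (x - a))\<^sup>2 / 2) + t * ((norm (y - a))\<^sup>2 / 2)" by linarith
    qed simp
  qed simp
  from smooth_convex_add_scale[OF assms(1) this, of \<eta> 0] show ?thesis
    using assms(2) by (simp add: algebra_simps)
qed

section \<open>Approximate minimizers of strongly convex functions\<close>

text \<open>A subgradient of a strongly convex composite function bounds it below by a quadratic,
  although the subgradient inequality itself is only linear.\<close>

lemma subdiff_strongly_convex:
  assumes "strongly_convex \<mu> \<phi>\<^sub>1" "convex_fun \<phi>\<^sub>2"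
    and x: "\<bar>\<phi>\<^sub>2 x\<bar> \<noteq> \<infinity>" and y: "\<bar>\<phi>\<^sub>2 y\<bar> \<noteq> \<infinity>"
    and v: "v \<in> subdiff (composite \<phi>\<^sub>1 \<phi>\<^sub>2) x"
  shows "cval \<phi>\<^sub>1 \<phi>\<^sub>2 x + v \<bullet> (y - x) + \<mu> / 2 * (norm (y - x))\<^sup>2 \<le> cval \<phi>\<^sub>1 \<phi>\<^sub>2 y"
proof -
  obtain p q where pq: "\<phi>\<^sub>2 x = ereal p" "\<phi>\<^sub>2 y = ereal q" using x y by auto
  \<comment> \<open>Apply the subgradient inequality at the point \<open>(1 - u) x + u y\<close>, divide by \<open>u\<close> and let \<open>u\<close>
    tend to zero.\<close>
  have key: "\<phi>\<^sub>1 x + p + v \<bullet> (y - x) + \<mu> / 2 * (1 - u) * (norm (y - x))\<^sup>2 \<le> \<phi>\<^sub>1 y + q"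
    if u: "0 < u" "u < 1" for u
  proof -
    let ?w = "(1 - u) *\<^sub>R x + u *\<^sub>R y"
    have wx: "?w - x = u *\<^sub>R (y - x)" by (simp add: algebra_simps)
    have "ereal (\<phi>\<^sub>1 x + p) + ereal (v \<bullet> (?w - x)) \<le> ereal (\<phi>\<^sub>1 ?w) + \<phi>\<^sub>2 ?w"
      using v pq unfolding subdiff_def composite_def by (metis (mono_tags, lifting) mem_Collect_eq plus_ereal.simps(1))
    also have "\<phi>\<^sub>2 ?w \<le> ereal ((1 - u) * p + u * q)"
      using assms(2) u pq unfolding convex_fun_def by (metis greaterThanLessThan_iff plus_ereal.simps(1) times_ereal.simps(1))
    finally have "\<phi>\<^sub>1 x + p + u * (v \<bullet> (y - x)) \<le> \<phi>\<^sub>1 ?w + ((1 - u) * p + u * q)"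
      by (simp add: wx add_left_mono)
    moreover have "\<phi>\<^sub>1 ?w \<le> (1 - u) * \<phi>\<^sub>1 x + u * \<phi>\<^sub>1 y - \<mu> / 2 * u * (1 - u) * (norm (x - y))\<^sup>2"
      using assms(1) u by (auto simp: strongly_convex_def)
    ultimately have "u * (\<phi>\<^sub>1 x + p + v \<bullet> (y - x) + \<mu> / 2 * (1 - u) * (norm (y - x))\<^sup>2)
      \<le> u * (\<phi>\<^sub>1 y + q)"
      by (simp add: algebra_simps norm_minus_commute)
    then show ?thesis using u by simp
  qed
  have "((\<lambda>u. \<phi>\<^sub>1 x + p + v \<bullet> (y - x) + \<mu> / 2 * (1 - u) * (norm (y - x))\<^sup>2)
    \<longlongrightarrow> \<phi>\<^sub>1 x + p + v \<bullet> (y - x) + \<mu> / 2 * (1 - 0) * (norm (y - x))\<^sup>2) (at_right 0)"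
    by (intro tendsto_intros)
  moreover have "eventually (\<lambda>u. \<phi>\<^sub>1 x + p + v \<bullet> (y - x) + \<mu> / 2 * (1 - u) * (norm (y - x))\<^sup>2
      \<le> \<phi>\<^sub>1 y + q) (at_right (0::real))"
    using key by (auto simp: eventually_at_right_field intro!: exI[of _ 1])
  ultimately have "\<phi>\<^sub>1 x + p + v \<bullet> (y - x) + \<mu> / 2 * (1 - 0) * (norm (y - x))\<^sup>2 \<le> \<phi>\<^sub>1 y + q"
    by (rule tendsto_upperbound) simp
  then show ?thesis by (simp add: cval_def composite_def pq)
qed

text \<open>Consequently a point whose subdifferential comes within \<open>\<delta>\<close> of the origin minimizes the
  function up to an error controlled by \<open>\<delta>\<close>. The distance need not be attained, hence the limit
  in the proof.\<close>

lemma infdist_subdiff_strongly_convex: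
  assumes "strongly_convex \<mu> \<phi>\<^sub>1" "convex_fun \<phi>\<^sub>2"
    and x: "\<bar>\<phi>\<^sub>2 x\<bar> \<noteq> \<infinity>" and y: "\<bar>\<phi>\<^sub>2 y\<bar> \<noteq> \<infinity>"
    and ne: "subdiff (composite \<phi>\<^sub>1 \<phi>\<^sub>2) x \<noteq> {}"
    and d: "infdist 0 (subdiff (composite \<phi>\<^sub>1 \<phi>\<^sub>2) x) \<le> \<delta>"
  shows "cval \<phi>\<^sub>1 \<phi>\<^sub>2 x - \<delta> * norm (y - x) + \<mu> / 2 * (norm (y - x))\<^sup>2 \<le> cval \<phi>\<^sub>1 \<phi>\<^sub>2 y"
proof -
  have *: "cval \<phi>\<^sub>1 \<phi>\<^sub>2 x - (\<delta> + e) * norm (y - x) + \<mu> / 2 * (norm (y - x))\<^sup>2 \<le> cval \<phi>\<^sub>1 \<phi>\<^sub>2 y"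
    if "e > 0" for e
  proof -
    have "(INF v\<in>subdiff (composite \<phi>\<^sub>1 \<phi>\<^sub>2) x. dist 0 v) < \<delta> + e"
      using d ne that by (simp add: infdist_def)
    then obtain v where v: "v \<in> subdiff (composite \<phi>\<^sub>1 \<phi>\<^sub>2) x" "norm v < \<delta> + e"
      using ne by (subst (asm) cINF_less_iff) (auto intro!: bdd_belowI2[of _ 0])
    have "\<bar>v \<bullet> (y - x)\<bar> \<le> (\<delta> + e) * norm (y - x)"
      using Cauchy_Schwarz_ineq2[of v "y - x"] v(2) mult_right_mono[of "norm v" "\<delta> + e" "norm (y - x)"]
      by auto
    then show ?thesis using subdiff_strongly_convex[OF assms(1,2) x y v(1)] by auto
  qed
  have "((\<lambda>e. cval \<phi>\<^sub>1 \<phi>\<^sub>2 x - (\<delta> + e) * norm (y - x) + \<mu> / 2 * (norm (y - x))\<^sup>2)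
    \<longlongrightarrow> cval \<phi>\<^sub>1 \<phi>\<^sub>2 x - (\<delta> + 0) * norm (y - x) + \<mu> / 2 * (norm (y - x))\<^sup>2) (at_right 0)"
    by (intro tendsto_intros)
  moreover have "eventually (\<lambda>e. cval \<phi>\<^sub>1 \<phi>\<^sub>2 x - (\<delta> + e) * norm (y - x) + \<mu> / 2 * (norm (y - x))\<^sup>2
      \<le> cval \<phi>\<^sub>1 \<phi>\<^sub>2 y) (at_right (0::real))"
    using * by (auto simp: eventually_at_right_field intro!: exI[of _ 1])
  ultimately have "cval \<phi>\<^sub>1 \<phi>\<^sub>2 x - (\<delta> + 0) * norm (y - x) + \<mu> / 2 * (norm (y - x))\<^sup>2 \<le> cval \<phi>\<^sub>1 \<phi>\<^sub>2 y"
    by (rule tendsto_upperbound) simp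
  then show ?thesis by simp
qed

section \<open>The bilevel problem on the compact domain of the lower level\<close>

text \<open>A bilevel problem satisfying \<^const>\<open>assumption_A\<close> together with admissible subroutines. One constant
  \<open>K \<ge> 1\<close> bounds both hidden constants of the subroutines. All points that the algorithms visit lie
  in \<open>X = dom g\<^sub>2\<close>, where \<open>f\<close> and \<open>g\<close> are real valued; from here on \<open>f\<close> and \<open>g\<close> denote these
  real functions.\<close>

locale sbo_setting =
  fixes P :: "('a::euclidean_space) sbo" and apg\<^sub>0 :: "'a apg_0" and apg\<^sub>\<mu> :: "'a apg_mu"
    and K D B l_f2 :: real
  assumes problem: "sbo_problem P"
    and asm_A: "assumption_A P l_f2"
    and apg0: "apg_0_spec K apg\<^sub>0"
    and apgm: "apg_mu_spec K apg\<^sub>\<mu>"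
    and K_ge_1: "1 \<le> K"
    and diam: "diameter (edom (g_2 P)) \<le> D"
    and B_ge_1: "1 \<le> B"
    and lip: "B-lipschitz_on (edom (g_2 P)) (\<lambda>x. real_of_ereal (obj_f P x))"
begin

abbreviation "X \<equiv> edom (g_2 P)"
abbreviation "f \<equiv> rf P"
abbreviation "g \<equiv> rg P"
abbreviation "\<Omega> \<equiv> Omega_g P"
abbreviation "C\<^sub>D \<equiv> C_D D"

lemma X_props: "compact X" "convex X" "X \<noteq> {}" "closed X" "bounded X"
  using asm_A by (auto simp: assumption_A_def compact_imp_closed compact_imp_bounded)

lemma smooth: "smooth_convex (L_f1 P) (f_1 P)" "smooth_convex (L_g1 P) (g_1 P)"
  and L_f1_pos: "0 < L_f1 P" and L_g1_ge_1: "1 \<le> L_g1 P"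
  and plc: "proper_lsc_convex (f_2 P)" "proper_lsc_convex (g_2 P)"
  using problem by (auto simp: sbo_problem_def smooth_convex_def)

lemma X_finite:
  assumes "x \<in> X"
  shows "\<bar>g_2 P x\<bar> \<noteq> \<infinity>" "\<bar>f_2 P x\<bar> \<noteq> \<infinity>"
proof -
  have "x \<in> edom (f_2 P)" using asm_A assms by (auto simp: assumption_A_def)
  then show "\<bar>g_2 P x\<bar> \<noteq> \<infinity>" "\<bar>f_2 P x\<bar> \<noteq> \<infinity>"
    using assms plc by (auto simp: edom_def proper_lsc_convex_def proper_fun_def)
qed

lemma obj_X:
  assumes "x \<in> X"
  shows "obj_g P x = ereal (g x)" "obj_f P x = ereal (f x)"
  using X_finite[OF assms] by (auto simp: obj_g_def obj_f_def cval_def composite_def)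

lemma obj_g_outside: "x \<notin> X \<Longrightarrow> obj_g P x = \<infinity>"
  by (auto simp: obj_g_def composite_def edom_def)

lemma dist_le_D: "x \<in> X \<Longrightarrow> y \<in> X \<Longrightarrow> norm (x - y) \<le> D"
  using diameter_bounded_bound[OF X_props(5)] diam by (force simp: dist_norm)

lemma f_lip: "x \<in> X \<Longrightarrow> y \<in> X \<Longrightarrow> \<bar>f x - f y\<bar> \<le> B * norm (x - y)"
  using lipschitz_onD[OF lip, of x y] by (simp add: obj_X dist_norm)

lemma f_cont: "continuous_on X f"
proof -
  have "B-lipschitz_on X f"
    using f_lip B_ge_1 by (intro lipschitz_onI) (auto simp: dist_norm)
  then show ?thesis by (rule lipschitz_on_continuous_on)
qed

lemma g_cont: "continuous_on X g"
proof -
  have "continuous_on X (real_of_ereal \<circ> g_2 P)"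
    using continuous_on_iff_real[of X "g_2 P"] X_finite asm_A by (auto simp: assumption_A_def)
  moreover have "continuous_on X (g_1 P)"
  proof -
    obtain g' where "\<And>x. GDERIV (g_1 P) x :> g' x"
      using smooth(2) by (auto simp: smooth_convex_def lipschitz_gradient_def)
    then show ?thesis
      by (intro continuous_at_imp_continuous_on ballI) (auto simp: gderiv_def intro: has_derivative_continuous)
  qed
  ultimately have "continuous_on X (\<lambda>x. g_1 P x + (real_of_ereal \<circ> g_2 P) x)"
    by (intro continuous_on_add)
  moreover have "g_1 P x + (real_of_ereal \<circ> g_2 P) x = g x" if "x \<in> X" for x
    using X_finite[OF that] by (auto simp: cval_def composite_def)
  ultimately show ?thesis by (simp cong: continuous_on_cong)
qed

lemma solution_exists:
  obtains x where "x \<in> X" "g x = g_star P" "f x = p_star P" "\<And>y. y \<in> X \<Longrightarrow> g_star P \<le> g y"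
    "x \<in> minimizers (obj_g P)"
proof -
  obtain x where x: "x \<in> sbo_solutions P" using problem by (auto simp: sbo_problem_def)
  then have min: "\<And>y. obj_g P x \<le> obj_g P y" and xm: "x \<in> minimizers (obj_g P)"
    and fmin: "\<And>y. y \<in> minimizers (obj_g P) \<Longrightarrow> obj_f P x \<le> obj_f P y"
    by (auto simp: sbo_solutions_def minimizers_def)
  obtain w where w: "w \<in> X" using X_props by auto
  have xX: "x \<in> X"
    using min[of w] obj_g_outside[of x] obj_X(1)[OF w] by force
  have "(INF y\<in>X. obj_g P y) = obj_g P x"
    using xX min by (intro antisym INF_lower INF_greatest) auto
  then have gs: "g_star P = g x" by (simp add: g_star_def obj_X xX)
  have "(INF y\<in>minimizers (obj_g P). obj_f P y) = obj_f P x"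
    using xm fmin by (intro antisym INF_lower INF_greatest) auto
  then have ps: "p_star P = f x" by (simp add: p_star_def obj_X xX)
  have "g_star P \<le> g y" if "y \<in> X" for y
    using min[of y] that xX by (simp add: gs obj_X)
  then show ?thesis using that[OF xX] gs ps xm by simp
qed

lemma g_star_le: "y \<in> X \<Longrightarrow> g_star P \<le> g y"
  using solution_exists by blast

lemma f_star_attained:
  obtains x where "x \<in> X" "f x = f_star P" "\<And>y. y \<in> X \<Longrightarrow> f_star P \<le> f y"
proof -
  obtain x where x: "x \<in> X" "\<And>y. y \<in> X \<Longrightarrow> f x \<le> f y"
    using continuous_attains_inf[OF X_props(1,3) f_cont] by auto
  have "(INF y\<in>X. obj_f P y) = obj_f P x"
    using x by (intro antisym INF_lower INF_greatest) (auto simp: obj_X)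
  then have "f_star P = f x" by (simp add: f_star_def obj_X x)
  then show ?thesis using that x by auto
qed

lemma p_star_gt: "p_star P > f_star P"
  using asm_A by (simp add: assumption_A_def)

lemma Omega_bound: "x \<in> X \<Longrightarrow> g x - g_star P + 1 \<le> \<Omega>"
proof -
  obtain w where w: "w \<in> X" "\<And>y. y \<in> X \<Longrightarrow> g y \<le> g w"
    using continuous_attains_sup[OF X_props(1,3) g_cont] by auto
  assume "x \<in> X"
  then show ?thesis
    unfolding Omega_g_def
    by (intro cSUP_upper bdd_aboveI2[of _ _ "g w - g_star P + 1"]) (auto simp: w)
qed

lemma Omega_ge_1: "1 \<le> \<Omega>"
proof -
  obtain x where "x \<in> X" "g x = g_star P" using solution_exists by metis
  then show ?thesis using Omega_bound[of x] by simp
qed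

text \<open>The domain is not a single point, since \<open>f\<close> takes the two values \<open>f\<^sup>*\<close> and \<open>p\<^sup>*\<close> on it.\<close>

lemma D_pos: "0 < D"
proof -
  obtain x where x: "x \<in> X" "f x = f_star P" using f_star_attained by metis
  obtain y where y: "y \<in> X" "f y = p_star P" using solution_exists by metis
  have "x \<noteq> y" using x y p_star_gt by auto
  then show ?thesis using dist_le_D[OF x(1) y(1)] by (smt (verit) zero_less_norm_iff right_minus_eq)
qed

lemma C_D_ge: "1 \<le> C\<^sub>D" "D \<le> C\<^sub>D" "D\<^sup>2 \<le> C\<^sub>D" "C\<^sub>D = 1 + D + D\<^sup>2"
  using D_pos by (auto simp: C_D_def power2_eq_square algebra_simps)

text \<open>On the sublevel set of \<open>f\<close> for a level below \<open>p\<^sup>*\<close> the function \<open>g\<close> attains its minimum, and a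
  minimizer of \<open>g\<close> over \<open>X\<close> cannot lie there.\<close>

lemma m_0_bounds: "0 < m_0 P" "\<And>x. x \<in> X \<Longrightarrow> f x \<le> (p_star P + f_star P) / 2 \<Longrightarrow> g_star P + m_0 P \<le> g x"
proof -
  let ?c = "(p_star P + f_star P) / 2"
  let ?S = "X \<inter> f -` {..?c}"
  obtain xf where xf: "xf \<in> X" "f xf = f_star P" using f_star_attained by metis
  have "closed ?S"
    by (intro continuous_closed_preimage f_cont X_props) auto
  from compact_Int_closed[OF X_props(1) this] have "compact ?S"
    by (simp add: Int_assoc[symmetric])
  moreover have "?S \<noteq> {}" using xf p_star_gt by auto
  moreover have "continuous_on ?S g" using g_cont by (rule continuous_on_subset) auto
  ultimately obtain w where w: "w \<in> ?S" "\<And>y. y \<in> ?S \<Longrightarrow> g w \<le> g y"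
    using continuous_attains_inf[of ?S g] by blast
  have "(INF x\<in>{x. obj_f P x \<le> ereal ?c}. obj_g P x) = obj_g P w"
  proof (rule antisym)
    show "(INF x\<in>{x. obj_f P x \<le> ereal ?c}. obj_g P x) \<le> obj_g P w"
      using w by (intro INF_lower) (auto simp: obj_X)
    show "obj_g P w \<le> (INF x\<in>{x. obj_f P x \<le> ereal ?c}. obj_g P x)"
    proof (rule INF_greatest)
      fix y assume "y \<in> {x. obj_f P x \<le> ereal ?c}"
      then show "obj_g P w \<le> obj_g P y"
        using w obj_g_outside[of y] by (cases "y \<in> X") (auto simp: obj_X)
    qed
  qed
  then have m0: "m_0 P = g w - g_star P" using w by (simp add: m_0_def g_bar_def obj_X)
  then show "\<And>x. x \<in> X \<Longrightarrow> f x \<le> ?c \<Longrightarrow> g_star P + m_0 P \<le> g x"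
    using w by auto
  have "g w \<noteq> g_star P"
  proof
    assume eq: "g w = g_star P"
    have "obj_g P w \<le> obj_g P y" for y
      using g_star_le[of y] eq w(1) obj_g_outside[of y] by (cases "y \<in> X") (auto simp: obj_X)
    then have wm: "w \<in> minimizers (obj_g P)" by (auto simp: minimizers_def)
    obtain x where x: "x \<in> sbo_solutions P" using problem by (auto simp: sbo_problem_def)
    have "(INF y\<in>minimizers (obj_g P). obj_f P y) = obj_f P x"
      using x by (intro antisym INF_lower INF_greatest) (auto simp: sbo_solutions_def)
    also have "obj_f P x \<le> obj_f P w" using x wm by (auto simp: sbo_solutions_def)
    finally have *: "(INF y\<in>minimizers (obj_g P). obj_f P y) \<le> ereal (f w)"
      using w by (simp add: obj_X)
    obtain x' where x': "x' \<in> X" "f x' = p_star P" "x' \<in> minimizers (obj_g P)"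
      using solution_exists by metis
    have "f_star P \<le> f y" if "y \<in> X" for y using that f_star_attained by metis
    moreover have "y \<in> X" if "y \<in> minimizers (obj_g P)" for y
    proof (rule ccontr)
      assume "y \<notin> X"
      moreover have "obj_g P y \<le> obj_g P w" using that by (auto simp: minimizers_def)
      ultimately show False using w(1) by (simp add: obj_g_outside obj_X)
    qed
    ultimately have "ereal (f_star P) \<le> (INF y\<in>minimizers (obj_g P). obj_f P y)"
      by (intro INF_greatest) (auto simp: obj_X)
    then have "p_star P \<le> f w" using * unfolding p_star_def
      by (cases "INF y\<in>minimizers (obj_g P). obj_f P y") auto
    then show False using w p_star_gt by auto
  qed
  then show "0 < m_0 P" using m0 g_star_le[of w] w by auto
qed

section \<open>The accelerated proximal gradient subroutines on that domain\<close>

lemma apg0_f: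
  assumes "x \<in> X" "0 < \<Delta>"
    and eq: "apg\<^sub>0 (f_1 P) (\<lambda>x. f_2 P x + indicator_fun X x) (L_f1 P) \<Delta> x D = (y, n)"
  shows "y \<in> X" "\<And>u. u \<in> X \<Longrightarrow> f y \<le> f u + \<Delta>" "real n \<le> K * (1 + D * sqrt (L_f1 P / \<Delta>))"
proof -
  let ?h = "\<lambda>x. f_2 P x + indicator_fun X x"
  have dom: "edom ?h = X"
  proof (intro set_eqI iffI)
    fix u assume "u \<in> edom ?h"
    then show "u \<in> X" by (auto simp: edom_def indicator_fun_def split: if_splits)
  next
    fix u assume "u \<in> X"
    then show "u \<in> edom ?h" using X_finite[of u] by (auto simp: edom_def indicator_fun_def)
  qed
  have "X \<subseteq> edom (f_2 P)" using asm_A by (auto simp: assumption_A_def)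
  moreover have "edom (indicator_fun X) = X" by (auto simp: edom_def indicator_fun_def split: if_splits)
  ultimately have h: "proper_lsc_convex ?h"
    using X_props by (intro proper_lsc_convex_add plc proper_lsc_convex_indicator) auto
  have hX: "composite (f_1 P) ?h u = ereal (f u)" if "u \<in> X" for u
    using X_finite[OF that] that by (auto simp: composite_def indicator_fun_def cval_def)
  have hn: "composite (f_1 P) ?h u = \<infinity>" if "u \<notin> X" for u
    using that plc by (auto simp: composite_def indicator_fun_def)
  obtain w where w: "w \<in> X" "\<And>u. u \<in> X \<Longrightarrow> f w \<le> f u"
    by (metis f_star_attained)
  have "composite (f_1 P) ?h w \<le> composite (f_1 P) ?h u" for u
    by (cases "u \<in> X") (auto simp: hX hn w)
  then have wm: "w \<in> minimizers (composite (f_1 P) ?h)" by (auto simp: minimizers_def)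
  have "infdist x (minimizers (composite (f_1 P) ?h)) \<le> D"
    using infdist_le2[OF wm] dist_le_D[OF assms(1) w(1)] by (simp add: dist_norm)
  then have pre: "smooth_convex (L_f1 P) (f_1 P) \<and> proper_lsc_convex ?h \<and> 0 < \<Delta> \<and>
      minimizers (composite (f_1 P) ?h) \<noteq> {} \<and> infdist x (minimizers (composite (f_1 P) ?h)) \<le> D"
    using smooth(1) h assms(2) wm by auto
  have "case apg\<^sub>0 (f_1 P) ?h (L_f1 P) \<Delta> x D of (y, n) \<Rightarrow>
      y \<in> edom ?h \<and> (\<forall>u. composite (f_1 P) ?h y \<le> composite (f_1 P) ?h u + ereal \<Delta>) \<and>
      real n \<le> K * (1 + D * sqrt (L_f1 P / \<Delta>))"
    using apg0[unfolded apg_0_spec_def, THEN spec, THEN spec, THEN spec, THEN spec, THEN spec,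
        THEN spec, THEN mp, OF pre] .
  then have 1: "y \<in> X" "\<And>u. composite (f_1 P) ?h y \<le> composite (f_1 P) ?h u + ereal \<Delta>"
    and "real n \<le> K * (1 + D * sqrt (L_f1 P / \<Delta>))"
    unfolding eq prod.case dom by blast+
  then show "y \<in> X" "real n \<le> K * (1 + D * sqrt (L_f1 P / \<Delta>))" by auto
  show "f y \<le> f u + \<Delta>" if "u \<in> X" for u
    using 1(2)[of u] by (simp add: hX that 1(1))
qed

lemma apg0_g:
  assumes "x \<in> X" "0 < \<Delta>"
    and eq: "apg\<^sub>0 (g_1 P) (g_2 P) (L_g1 P) \<Delta> x D = (y, n)"
  shows "y \<in> X" "g y \<le> g_star P + \<Delta>" "real n \<le> K * (1 + D * sqrt (L_g1 P / \<Delta>))"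
proof -
  obtain w where w: "w \<in> X" "g w = g_star P" "w \<in> minimizers (obj_g P)"
    using solution_exists by metis
  have "infdist x (minimizers (obj_g P)) \<le> D"
    using infdist_le2[OF w(3)] dist_le_D[OF assms(1) w(1)] by (simp add: dist_norm)
  then have pre: "smooth_convex (L_g1 P) (g_1 P) \<and> proper_lsc_convex (g_2 P) \<and> 0 < \<Delta> \<and>
      minimizers (composite (g_1 P) (g_2 P)) \<noteq> {} \<and>
      infdist x (minimizers (composite (g_1 P) (g_2 P))) \<le> D"
    using smooth(2) plc(2) assms(2) w(3) by (auto simp: obj_g_def)
  have "case apg\<^sub>0 (g_1 P) (g_2 P) (L_g1 P) \<Delta> x D of (y, n) \<Rightarrow>
      y \<in> X \<and> (\<forall>u. composite (g_1 P) (g_2 P) y \<le> composite (g_1 P) (g_2 P) u + ereal \<Delta>) \<and>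
      real n \<le> K * (1 + D * sqrt (L_g1 P / \<Delta>))"
    using apg0[unfolded apg_0_spec_def, THEN spec, THEN spec, THEN spec, THEN spec, THEN spec,
        THEN spec, THEN mp, OF pre] .
  then have 1: "y \<in> X" "obj_g P y \<le> obj_g P w + ereal \<Delta>"
    and "real n \<le> K * (1 + D * sqrt (L_g1 P / \<Delta>))"
    by (auto simp: eq obj_g_def)
  then show "y \<in> X" "real n \<le> K * (1 + D * sqrt (L_g1 P / \<Delta>))" by auto
  show "g y \<le> g_star P + \<Delta>" using 1 w by (simp add: obj_X)
qed

text \<open>The penalized objective \<open>G\<^sub>\<eta> + z (f - c)\<close> that the dual search minimizes approximately;
  \<open>a\<close> is the centre of the regularization.\<close>

definition penalized :: "'a \<Rightarrow> real \<Rightarrow> real \<Rightarrow> real \<Rightarrow> 'a \<Rightarrow> real" where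
  "penalized a \<eta> c z u = g u + \<eta> / 2 * (norm (u - a))\<^sup>2 + z * (f u - c)"

lemma apg_mu_penalized:
  assumes "x \<in> X" "0 < \<eta>" "0 \<le> z" "0 < \<epsilon>\<^sub>1"
    and eq: "apg\<^sub>\<mu> (\<lambda>x. g_1 P x + \<eta> / 2 * (norm (x - a))\<^sup>2 + z * (f_1 P x - c))
      (\<lambda>x. g_2 P x + ereal z * f_2 P x) (L_g1 P + \<eta> + z * L_f1 P) \<eta> D \<epsilon>\<^sub>1 x = (y, n)"
  shows "y \<in> X"
    "\<And>u. u \<in> X \<Longrightarrow> penalized a \<eta> c z y - \<epsilon>\<^sub>1 * norm (u - y) + \<eta> / 2 * (norm (u - y))\<^sup>2
        \<le> penalized a \<eta> c z u"
    "real n \<le> K * (sqrt ((L_g1 P + \<eta> + z * L_f1 P) / \<eta>)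
        * (1 + real (nat \<lceil>log 2 ((L_g1 P + \<eta> + z * L_f1 P) * D / \<epsilon>\<^sub>1)\<rceil>)))"
proof -
  let ?\<phi> = "\<lambda>x. g_1 P x + \<eta> / 2 * (norm (x - a))\<^sup>2 + z * (f_1 P x - c)"
  let ?h = "\<lambda>x. g_2 P x + ereal z * f_2 P x"
  let ?L = "L_g1 P + \<eta> + z * L_f1 P"
  have dom: "edom ?h = X"
  proof (intro set_eqI iffI)
    fix u assume "u \<in> edom ?h"
    then show "u \<in> X" by (auto simp: edom_def)
  next
    fix u assume "u \<in> X"
    then show "u \<in> edom ?h" using X_finite[of u] by (auto simp: edom_def)
  qed
  have "X \<inter> edom (f_2 P) \<noteq> {}" using asm_A by (auto simp: assumption_A_def)
  then have h: "proper_lsc_convex ?h"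
    using assms(3) by (intro proper_lsc_convex_add_scale plc)
  have s: "smooth_convex ?L ?\<phi>"
    using smooth_convex_add_scale[OF smooth_convex_add_quadratic[OF smooth(2) assms(2)] smooth(1) assms(3)] .
  have "convex_on UNIV (\<lambda>x. g_1 P x + z * (f_1 P x - c))"
    using smooth_convex_add_scale[OF smooth(2,1) assms(3)] by (simp add: smooth_convex_def)
  from strongly_convex_add_convex[OF strongly_convex_quadratic this, of \<eta> a]
  have sc: "strongly_convex \<eta> ?\<phi>" by (simp add: algebra_simps)
  have fin: "\<bar>?h u\<bar> \<noteq> \<infinity>" if "u \<in> X" for u
    using X_finite[OF that] by auto
  have val: "cval ?\<phi> ?h u = penalized a \<eta> c z u" if "u \<in> X" for u
    using X_finite[OF that] by (auto simp: cval_def composite_def penalized_def algebra_simps)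
  have "case apg\<^sub>\<mu> ?\<phi> ?h ?L \<eta> D \<epsilon>\<^sub>1 x of (y, n) \<Rightarrow>
     y \<in> edom ?h \<and> subdiff (composite ?\<phi> ?h) y \<noteq> {} \<and>
     infdist 0 (subdiff (composite ?\<phi> ?h) y) \<le> \<epsilon>\<^sub>1 \<and>
     real n \<le> K * (sqrt (?L / \<eta>) * (1 + real (nat \<lceil>log 2 (?L * D / \<epsilon>\<^sub>1)\<rceil>)))"
  proof -
    have pre: "smooth_convex ?L ?\<phi> \<and> 0 < \<eta> \<and> strongly_convex \<eta> ?\<phi> \<and> proper_lsc_convex ?h \<and> 0 < \<epsilon>\<^sub>1 \<and>
     bounded (edom ?h) \<and> diameter (edom ?h) \<le> D \<and> x \<in> edom ?h"
      using assms s sc h X_props diam unfolding dom by auto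
    show ?thesis
      using apgm[unfolded apg_mu_spec_def, THEN spec, THEN spec, THEN spec, THEN spec, THEN spec,
          THEN spec, THEN spec, THEN mp, OF pre] .
  qed
  then have 1: "y \<in> X" "subdiff (composite ?\<phi> ?h) y \<noteq> {}"
    "infdist 0 (subdiff (composite ?\<phi> ?h) y) \<le> \<epsilon>\<^sub>1"
    and "real n \<le> K * (sqrt (?L / \<eta>) * (1 + real (nat \<lceil>log 2 (?L * D / \<epsilon>\<^sub>1)\<rceil>)))"
    unfolding eq prod.case dom by blast+
  then show "y \<in> X" "real n \<le> K * (sqrt (?L / \<eta>) * (1 + real (nat \<lceil>log 2 (?L * D / \<epsilon>\<^sub>1)\<rceil>)))"
    by auto
  have hc: "convex_fun ?h" using h by (simp add: proper_lsc_convex_def)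
  show "penalized a \<eta> c z y - \<epsilon>\<^sub>1 * norm (u - y) + \<eta> / 2 * (norm (u - y))\<^sup>2
        \<le> penalized a \<eta> c z u" if "u \<in> X" for u
    using infdist_subdiff_strongly_convex[OF sc hc fin[OF 1(1)] fin[OF that] 1(2,3)]
    unfolding val[OF 1(1)] val[OF that] .
qed

end

section \<open>Interval search and bisection\<close>

lemma le_two_power_nat_ceil_log: "0 < y \<Longrightarrow> y \<le> 2 ^ nat \<lceil>log 2 y\<rceil>"
proof -
  assume y: "0 < y"
  have "y = 2 powr (log 2 y)" using y by simp
  also have "\<dots> \<le> 2 powr (real (nat \<lceil>log 2 y\<rceil>))" by (intro powr_mono) (auto, linarith)
  also have "\<dots> = 2 ^ nat \<lceil>log 2 y\<rceil>" by (simp add: powr_realpow)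
  finally show ?thesis .
qed

lemma nat_ceil_log_le:
  assumes "0 < y" "y \<le> W ^ k" "2 \<le> W"
  shows "real (nat \<lceil>log 2 y\<rceil>) \<le> real k * log 2 W + 1"
proof -
  have "log 2 y \<le> log 2 (W ^ k)" using assms by simp
  also have "\<dots> = real k * log 2 W" using assms by (simp add: log_nat_power)
  finally have "real_of_int \<lceil>log 2 y\<rceil> \<le> real k * log 2 W + 1" by linarith
  moreover have "0 \<le> real k * log 2 W + 1" using assms by simp
  ultimately show ?thesis by linarith
qed

text \<open>In the next three lemmas \<open>N\<close> bounds the cost of one call of the inner solver \<open>A\<close>, and the
  summand 2 pays for the evaluation of \<open>\<psi>\<close>.\<close>

lemma interval_search_correct:
  fixes A :: "real \<Rightarrow> 'a \<times> nat"
  assumes N: "\<And>z. 0 \<le> z \<Longrightarrow> z \<le> 2 * M \<Longrightarrow> real (snd (A z)) \<le> N"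
    and e: "0 < \<epsilon>\<^sub>2"
    and "M \<le> b * 2 ^ k" "0 \<le> a" "a < b" "b \<le> 2 * M" "\<psi> (fst (A a)) > \<epsilon>\<^sub>2"
  shows "\<exists>a' b' T'. interval_search A \<psi> M \<epsilon>\<^sub>2 a b (fst (A b)) T = Some ((a', b', fst (A b')), T')
    \<and> 0 \<le> a' \<and> a' < b' \<and> b' \<le> 2 * M \<and> \<psi> (fst (A a')) > \<epsilon>\<^sub>2
    \<and> (\<psi> (fst (A b')) \<le> \<epsilon>\<^sub>2 \<or> M \<le> b') \<and> real T' \<le> real T + real k * (N + 2)"
  using assms(3-)
proof (induction k arbitrary: a b T)
  case 0
  then have "interval_search A \<psi> M \<epsilon>\<^sub>2 a b (fst (A b)) T = Some ((a, b, fst (A b)), T)"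
    by (subst interval_search.simps) auto
  then show ?case using 0 by auto
next
  case (Suc k)
  have N0: "0 \<le> N" using N[of b] Suc.prems by (simp add: order_trans[OF of_nat_0_le_iff])
  show ?case
  proof (cases "\<psi> (fst (A b)) > \<epsilon>\<^sub>2 \<and> b < M")
    case False
    then have "interval_search A \<psi> M \<epsilon>\<^sub>2 a b (fst (A b)) T = Some ((a, b, fst (A b)), T)"
      using e by (subst interval_search.simps) auto
    then show ?thesis using False Suc.prems N0 by auto
  next
    case True
    then have eq: "interval_search A \<psi> M \<epsilon>\<^sub>2 a b (fst (A b)) T
      = interval_search A \<psi> M \<epsilon>\<^sub>2 b (2 * b) (fst (A (2 * b))) (T + snd (A (2 * b)) + 2)"
      by (subst interval_search.simps) (auto split: prod.split)
    have "real (snd (A (2 * b))) \<le> N" using N[of "2 * b"] True Suc.prems by auto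
    moreover have "M \<le> 2 * b * 2 ^ k" "0 \<le> b" "b < 2 * b" "2 * b \<le> 2 * M" "\<psi> (fst (A b)) > \<epsilon>\<^sub>2"
      using Suc.prems True by auto
    note Suc.IH[OF this, of "T + snd (A (2 * b)) + 2"]
    ultimately show ?thesis unfolding eq by (force simp: algebra_simps)
  qed
qed

text \<open>The assumption on \<open>w\<close> says that an interval with the two endpoint properties that the
  bisection maintains is wider than the stopping width. Halving the interval preserves these
  properties, so the bisection has to stop by returning a pair, after at most \<open>k\<close> steps.\<close>

lemma bisection_correct:
  fixes A :: "real \<Rightarrow> 'a \<times> nat"
  assumes N: "\<And>z. 0 \<le> z \<Longrightarrow> z \<le> m \<Longrightarrow> real (snd (A z)) \<le> N"
    and e: "0 < \<epsilon>\<^sub>2"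
    and w: "\<And>a b. 0 \<le> a \<Longrightarrow> a < b \<Longrightarrow> b \<le> m \<Longrightarrow> \<psi> (fst (A a)) > \<epsilon>\<^sub>2 \<Longrightarrow> \<psi> (fst (A b)) \<le> \<epsilon>\<^sub>2
      \<Longrightarrow> \<bar>b * \<psi> (fst (A b))\<bar> > \<epsilon>\<^sub>3 \<Longrightarrow> w < b - a"
    and "0 \<le> a" "a < b" "b \<le> m" "\<psi> (fst (A a)) > \<epsilon>\<^sub>2" "\<psi> (fst (A b)) \<le> \<epsilon>\<^sub>2"
      "\<bar>b * \<psi> (fst (A b))\<bar> > \<epsilon>\<^sub>3" "b - a \<le> 2 ^ k * w"
  shows "\<exists>z T'. bisection A \<psi> \<epsilon>\<^sub>2 \<epsilon>\<^sub>3 w a b (fst (A b)) T = Some ((fst (A z), z), T')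
    \<and> 0 < z \<and> z \<le> m \<and> \<psi> (fst (A z)) \<le> \<epsilon>\<^sub>2 \<and> \<bar>z * \<psi> (fst (A z))\<bar> \<le> \<epsilon>\<^sub>3
    \<and> real T' \<le> real T + real k * (N + 2)"
  using assms(4-)
proof (induction k arbitrary: a b T)
  case 0
  then show ?case using w[of a b] by simp
next
  case (Suc k)
  define z where "z = (a + b) / 2"
  let ?T = "T + snd (A z) + 2"
  have wab: "w < b - a" using w[of a b] Suc.prems by auto
  have z: "0 < z" "a < z" "z < b" "z - a \<le> 2 ^ k * w" "b - z \<le> 2 ^ k * w" "z \<le> m"
    using Suc.prems by (auto simp: z_def field_simps)
  have Nz: "real (snd (A z)) \<le> N" using N[of z] z Suc.prems by auto
  have N0: "0 \<le> N" using Nz by linarith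
  have eq: "bisection A \<psi> \<epsilon>\<^sub>2 \<epsilon>\<^sub>3 w a b (fst (A b)) T =
    (if \<psi> (fst (A z)) > \<epsilon>\<^sub>2 then bisection A \<psi> \<epsilon>\<^sub>2 \<epsilon>\<^sub>3 w z b (fst (A b)) ?T
     else if \<bar>z * \<psi> (fst (A z))\<bar> \<le> \<epsilon>\<^sub>3 then Some ((fst (A z), z), ?T)
     else bisection A \<psi> \<epsilon>\<^sub>2 \<epsilon>\<^sub>3 w a z (fst (A z)) ?T)"
    using wab e by (subst bisection.simps) (auto simp: z_def[symmetric] Let_def split: prod.split)
  consider (up) "\<psi> (fst (A z)) > \<epsilon>\<^sub>2"
    | (ret) "\<psi> (fst (A z)) \<le> \<epsilon>\<^sub>2" "\<bar>z * \<psi> (fst (A z))\<bar> \<le> \<epsilon>\<^sub>3"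
    | (down) "\<psi> (fst (A z)) \<le> \<epsilon>\<^sub>2" "\<bar>z * \<psi> (fst (A z))\<bar> > \<epsilon>\<^sub>3" by linarith
  then show ?case
  proof cases
    case up
    have *: "0 \<le> z" "z < b" "b \<le> m" "\<psi> (fst (A z)) > \<epsilon>\<^sub>2" "\<psi> (fst (A b)) \<le> \<epsilon>\<^sub>2"
      "\<bar>b * \<psi> (fst (A b))\<bar> > \<epsilon>\<^sub>3" "b - z \<le> 2 ^ k * w"
      using up Suc.prems z by auto
    from Suc.IH[OF *, of ?T] Nz up show ?thesis unfolding eq by (force simp: algebra_simps)
  next
    case ret
    have "0 \<le> real k * (N + 2)" using N0 by simp
    moreover have "real (Suc k) * (N + 2) = (N + 2) + real k * (N + 2)" by (simp add: algebra_simps)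
    moreover have "real ?T \<le> real T + (N + 2)" using Nz by simp
    ultimately have "real ?T \<le> real T + real (Suc k) * (N + 2)" by linarith
    then show ?thesis using ret z unfolding eq by auto
  next
    case down
    have *: "0 \<le> a" "a < z" "z \<le> m" "\<psi> (fst (A a)) > \<epsilon>\<^sub>2" "\<psi> (fst (A z)) \<le> \<epsilon>\<^sub>2"
      "\<bar>z * \<psi> (fst (A z))\<bar> > \<epsilon>\<^sub>3" "z - a \<le> 2 ^ k * w"
      using down Suc.prems z by auto
    from Suc.IH[OF *, of ?T] Nz down show ?thesis unfolding eq by (force simp: algebra_simps)
  qed
qed

text \<open>The dual search for any inner solver \<open>A\<close>: it suffices that multipliers of size at least
  \<open>M\<close> make the constraint hold and that a search interval which the bisection would keep is
  wider than the stopping width \<open>\<mu> \<delta>\<^sup>3\<close>, so that the bisection can only end by returning a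
  nearly complementary pair.\<close>

lemma dual_correct:
  fixes apg :: "'a apg_mu"
    and \<phi>\<^sub>1 \<psi>\<^sub>1 :: "'a \<Rightarrow> real" and \<phi>\<^sub>2 \<psi>\<^sub>2 :: "'a \<Rightarrow> ereal" and L\<^sub>\<phi> L\<^sub>\<psi> D \<mu> \<delta> M N :: real and x\<^sub>i\<^sub>n :: 'a
  defines "S \<equiv> \<lambda>z. apg (\<lambda>x. \<phi>\<^sub>1 x + z * \<psi>\<^sub>1 x) (\<lambda>x. \<phi>\<^sub>2 x + ereal z * \<psi>\<^sub>2 x)
                       (L\<^sub>\<phi> + z * L\<^sub>\<psi>) \<mu> D (\<mu> * \<delta>\<^sup>2) x\<^sub>i\<^sub>n"
    and "\<psi> \<equiv> cval \<psi>\<^sub>1 \<psi>\<^sub>2"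
  assumes N: "\<And>z. 0 \<le> z \<Longrightarrow> z \<le> 2 * M \<Longrightarrow> real (snd (S z)) \<le> N"
    and d: "0 < \<delta>" and M: "1 \<le> M"
    and big: "\<And>b. M \<le> b \<Longrightarrow> b \<le> 2 * M \<Longrightarrow> \<psi> (fst (S b)) \<le> \<delta>"
    and w: "\<And>a b. 0 \<le> a \<Longrightarrow> a < b \<Longrightarrow> b \<le> 2 * M \<Longrightarrow> \<psi> (fst (S a)) > \<delta> \<Longrightarrow> \<psi> (fst (S b)) \<le> \<delta>
      \<Longrightarrow> \<bar>b * \<psi> (fst (S b))\<bar> > 4 * M * \<delta> \<Longrightarrow> \<mu> * \<delta> ^ 3 < b - a"
    and k: "M \<le> 2 ^ k" "2 * M \<le> 2 ^ j * (\<mu> * \<delta> ^ 3)"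
  shows "\<exists>z T. dual apg D \<phi>\<^sub>1 \<phi>\<^sub>2 L\<^sub>\<phi> \<mu> \<psi>\<^sub>1 \<psi>\<^sub>2 L\<^sub>\<psi> 1 M x\<^sub>i\<^sub>n \<delta> = Some ((fst (S z), z), T)
    \<and> 0 \<le> z \<and> z \<le> 2 * M \<and> \<psi> (fst (S z)) \<le> \<delta> \<and> (z = 0 \<or> \<bar>z * \<psi> (fst (S z))\<bar> \<le> 4 * M * \<delta>)
    \<and> real T \<le> real (2 + k + j) * (N + 2)"
proof -
  have N0: "0 \<le> N" using N[of 0] M by linarith
  have Sz: "apg (\<lambda>x. \<phi>\<^sub>1 x + z * \<psi>\<^sub>1 x) (\<lambda>x. \<phi>\<^sub>2 x + ereal z * \<psi>\<^sub>2 x) (L\<^sub>\<phi> + z * L\<^sub>\<psi>) \<mu> D (\<mu> * \<delta>\<^sup>2) x\<^sub>i\<^sub>n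
    = S z" for z by (simp add: S_def)
  have un: "dual apg D \<phi>\<^sub>1 \<phi>\<^sub>2 L\<^sub>\<phi> \<mu> \<psi>\<^sub>1 \<psi>\<^sub>2 L\<^sub>\<psi> 1 M x\<^sub>i\<^sub>n \<delta> =
    (if \<psi> (fst (S 0)) \<le> \<delta> then Some ((fst (S 0), 0), snd (S 0) + 2)
     else case interval_search S \<psi> M \<delta> 0 1 (fst (S 1)) (snd (S 0) + 2 + snd (S 1) + 2) of
         None \<Rightarrow> None
       | Some ((a, b, x\<^sub>b), T) \<Rightarrow>
           if \<bar>b * \<psi> x\<^sub>b\<bar> \<le> 4 * M * \<delta> then Some ((x\<^sub>b, b), T)
           else bisection S \<psi> \<delta> (4 * M * \<delta>) (\<mu> * \<delta> ^ 3) a b x\<^sub>b T)"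
    using d unfolding dual_def Let_def Sz \<psi>_def by (auto split: prod.split)
  show ?thesis
  proof (cases "\<psi> (fst (S 0)) \<le> \<delta>")
    case True
    have "real (snd (S 0) + 2) \<le> 1 * (N + 2)" using N[of 0] M by simp
    also have "\<dots> \<le> real (2 + k + j) * (N + 2)" using N0 by (intro mult_right_mono) auto
    finally show ?thesis unfolding un using True d M by auto
  next
    case False
    let ?T0 = "snd (S 0) + 2 + snd (S 1) + 2"
    have "M \<le> 1 * 2 ^ k" "(0::real) \<le> 0" "(0::real) < 1" "1 \<le> 2 * M" "\<psi> (fst (S 0)) > \<delta>"
      using k M False by auto
    from interval_search_correct[where A = S and \<psi> = \<psi>, OF N d this, of ?T0]
    obtain a b T where ab: "interval_search S \<psi> M \<delta> 0 1 (fst (S 1)) ?T0 = Some ((a, b, fst (S b)), T)"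
      "0 \<le> a" "a < b" "b \<le> 2 * M" "\<psi> (fst (S a)) > \<delta>" "\<psi> (fst (S b)) \<le> \<delta> \<or> M \<le> b"
      "real T \<le> real ?T0 + real k * (N + 2)" by blast
    have pb: "\<psi> (fst (S b)) \<le> \<delta>" using ab big by auto
    have T0: "real ?T0 \<le> 2 * (N + 2)" using N[of 0] N[of 1] M by simp
    show ?thesis
    proof (cases "\<bar>b * \<psi> (fst (S b))\<bar> \<le> 4 * M * \<delta>")
      case True
      have "real T \<le> real (2 + k) * (N + 2)" using ab T0 by (simp add: algebra_simps)
      also have "\<dots> \<le> real (2 + k + j) * (N + 2)" using N0 by (intro mult_right_mono) auto
      finally show ?thesis unfolding un using False ab True pb by auto
    next
      case no: False
      have "0 < \<mu> * \<delta> ^ 3" using k(2) M by (smt (verit) zero_less_mult_iff zero_less_power)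
      then have "b - a \<le> 2 ^ j * (\<mu> * \<delta> ^ 3)" using ab k(2) by linarith
      from bisection_correct[where A = S and \<psi> = \<psi> and m = "2 * M" and \<epsilon>\<^sub>3 = "4 * M * \<delta>" and T = T,
          OF N d w ab(2-5) pb _ this] no
      obtain z T' where "bisection S \<psi> \<delta> (4 * M * \<delta>) (\<mu> * \<delta> ^ 3) a b (fst (S b)) T = Some ((fst (S z), z), T')"
        "0 < z" "z \<le> 2 * M" "\<psi> (fst (S z)) \<le> \<delta>" "\<bar>z * \<psi> (fst (S z))\<bar> \<le> 4 * M * \<delta>"
        "real T' \<le> real T + real j * (N + 2)" by (auto simp: not_le)
      moreover from this have "real T' \<le> real (2 + k + j) * (N + 2)"
        using ab T0 by (simp add: algebra_simps)
      ultimately show ?thesis unfolding un using False ab no by auto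
    qed
  qed
qed


section \<open>The value function test\<close>

context sbo_setting
begin

text \<open>Two approximate minimizers for different multipliers: because of the strong
  convexity, the constraint values differ by at most a multiple of the distance of the multipliers
  plus a multiple of the inexactness \<open>e\<close>.\<close>

lemma penalized_compare:
  assumes "y \<in> X" "y' \<in> X" "0 < \<eta>" "z \<le> z'"
    and m: "\<And>u. u \<in> X \<Longrightarrow> penalized a \<eta> c z y - e * norm (u - y) + \<eta> / 2 * (norm (u - y))\<^sup>2
      \<le> penalized a \<eta> c z u"
    and m': "\<And>u. u \<in> X \<Longrightarrow> penalized a \<eta> c z' y' - e * norm (u - y') + \<eta> / 2 * (norm (u - y'))\<^sup>2
      \<le> penalized a \<eta> c z' u"
    and e: "0 \<le> e"
  shows "\<eta> * (f y - f y') \<le> B * (2 * e + (z' - z) * B)"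
proof -
  let ?r = "norm (y - y')"
  have "penalized a \<eta> c z y - e * ?r + \<eta> / 2 * ?r\<^sup>2 \<le> penalized a \<eta> c z y'"
    using m[OF assms(2)] by (simp add: norm_minus_commute)
  moreover have "penalized a \<eta> c z' y' - e * ?r + \<eta> / 2 * ?r\<^sup>2 \<le> penalized a \<eta> c z' y"
    using m'[OF assms(1)] by simp
  ultimately have "\<eta> * ?r\<^sup>2 \<le> 2 * e * ?r + (z' - z) * (f y - f y')"
    by (simp add: penalized_def algebra_simps)
  also have "(z' - z) * (f y - f y') \<le> (z' - z) * (B * ?r)"
    using f_lip[OF assms(1,2)] assms(4) by (intro mult_left_mono) auto
  finally have "?r * (\<eta> * ?r) \<le> ?r * (2 * e + (z' - z) * B)"
    by (simp add: algebra_simps power2_eq_square)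
  then have *: "\<eta> * ?r \<le> 2 * e + (z' - z) * B"
  proof (cases "?r = 0")
    case True
    then show ?thesis using e assms(4) B_ge_1 by simp
  next
    case False
    then have "0 < ?r" by simp
    then show ?thesis using \<open>?r * (\<eta> * ?r) \<le> _\<close> by (rule mult_left_le_imp_le[rotated])
  qed
  have "\<eta> * (f y - f y') \<le> \<eta> * (B * ?r)"
    using f_lip[OF assms(1,2)] assms(3) by (intro mult_left_mono) auto
  also have "\<dots> = B * (\<eta> * ?r)" by simp
  also have "\<dots> \<le> B * (2 * e + (z' - z) * B)" using * B_ge_1 by (intro mult_left_mono) auto
  finally show ?thesis .
qed

text \<open>The output \<open>(x, z)\<close> of a test describes an affine minorant of the value function of the
  lower level, up to the error \<open>\<delta>\<close>: for points \<open>y\<close> with \<open>f y \<le> c'\<close> the inequality for \<open>g x\<close> bounds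
  \<open>g y\<close> below by \<open>g x - \<delta> - z (c' - c)\<close>. The three contributions to the error are the
  complementarity defect \<open>\<delta> / C\<^sub>D\<close>, the regularization, at most \<open>\<eta> D\<^sup>2\<close>, and the inexactness of the
  inner solver, at most \<open>\<eta> D\<close>; the constant \<open>C\<^sub>D = 1 + D + D\<^sup>2\<close> makes their sum equal to \<open>\<delta>\<close>.

  The point \<open>a\<close> is a Slater point: \<open>f a \<le> c - \<Delta>\<close>. It bounds the useful multipliers by \<open>M\<close>. The
  number \<open>W\<close> only serves to bound the logarithms, whose arguments are at most powers of \<open>W\<close>.\<close>

lemma vtest_correct:
  assumes xin: "xin \<in> X" and a: "a \<in> X" and M: "1 \<le> M"
    and \<Delta>: "f a \<le> c - \<Delta>" "g a - g_star P \<le> M * \<Delta>" "0 < \<Delta>"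
    and \<delta>: "0 < \<delta>" "\<delta> \<le> 1 / B"
    and W: "2 \<le> W" "C\<^sub>D \<le> W" "M \<le> W" "1 / \<delta> \<le> W" "L_g1 P \<le> W" "L_f1 P \<le> W"
  shows "\<exists>x z n. vtest apg\<^sub>\<mu> P D a M c \<delta> xin = Some ((x, z), n) \<and> x \<in> X \<and> 0 \<le> z
    \<and> f x \<le> c + \<delta> / 4 \<and> z * (f x - c) \<le> \<delta> / C\<^sub>D
    \<and> (\<forall>y\<in>X. g x \<le> g y + \<delta> + z * (f y - c))
    \<and> real n \<le> 1008 * K * (log 2 W)\<^sup>2 * sqrt (C\<^sub>D * (L_g1 P + M * L_f1 P) / \<delta>)"
proof -
  define \<eta> where "\<eta> = \<delta> / C\<^sub>D"
  define d where "d = \<delta> / (4 * C\<^sub>D * M)"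
  define e where "e = \<eta> * d\<^sup>2"
  define S where "S = (\<lambda>z. apg\<^sub>\<mu> (\<lambda>x. g_1 P x + \<eta> / 2 * (norm (x - a))\<^sup>2 + z * (f_1 P x - c))
      (\<lambda>x. g_2 P x + ereal z * f_2 P x) (L_g1 P + \<eta> + z * L_f1 P) \<eta> D e xin)"
  define \<psi> where "\<psi> = cval (\<lambda>x. f_1 P x - c) (f_2 P)"
  define L where "L = L_g1 P + \<eta> + 2 * M * L_f1 P"
  define N where "N = K * (sqrt (L / \<eta>) * (1 + real (nat \<lceil>log 2 (L * D / e)\<rceil>)))"
  define w where "w = \<eta> * d ^ 3"
  define k where "k = nat \<lceil>log 2 M\<rceil>"
  define j where "j = nat \<lceil>log 2 (2 * M / w)\<rceil>"
  have B: "B * \<delta> \<le> 1" using \<delta> B_ge_1 by (simp add: field_simps)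
  have "1 * \<delta> \<le> B * \<delta>" using \<delta> B_ge_1 by (intro mult_right_mono) auto
  then have \<delta>1: "\<delta> \<le> 1" using B by simp
  have CD: "1 \<le> C\<^sub>D" using C_D_ge by simp
  have \<eta>: "0 < \<eta>" "\<eta> \<le> 1"
    using \<delta> CD \<delta>1 by (auto simp: \<eta>_def field_simps)
  have CM: "1 \<le> C\<^sub>D * M" using mult_mono[OF CD M] CD by simp
  have d: "0 < d" "4 * d \<le> \<delta>" "4 * M * d = \<eta>"
    using \<delta> CD M CM mult_left_mono[OF CM, of \<delta>] by (auto simp: d_def \<eta>_def field_simps)
  have Bd: "B * d \<le> 1 / 4"
  proof -
    have "B * (4 * d) \<le> B * \<delta>" using d(2) B_ge_1 by (intro mult_left_mono) auto
    then have "4 * (B * d) \<le> B * \<delta>" by (simp add: mult.left_commute)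
    then show ?thesis using B by linarith
  qed
  have d1: "d \<le> 1 / 4" using d \<delta>1 by simp
  have e: "0 < e" using \<eta> d by (simp add: e_def)
  have w: "0 < w" using \<eta> d by (simp add: w_def)
  have "0 \<le> 2 * M * L_f1 P" using L_f1_pos M by simp
  then have L: "1 \<le> L" "\<eta> \<le> L" using L_g1_ge_1 \<eta> unfolding L_def by linarith+
  have \<psi>: "\<psi> x = f x - c" if "x \<in> X" for x
    using X_finite[OF that] by (auto simp: \<psi>_def cval_def composite_def)
  have S: "fst (S z) \<in> X"
    "\<And>u. u \<in> X \<Longrightarrow> penalized a \<eta> c z (fst (S z)) - e * norm (u - fst (S z)) + \<eta> / 2 * (norm (u - fst (S z)))\<^sup>2
        \<le> penalized a \<eta> c z u"
    "real (snd (S z)) \<le> K * (sqrt ((L_g1 P + \<eta> + z * L_f1 P) / \<eta>)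
        * (1 + real (nat \<lceil>log 2 ((L_g1 P + \<eta> + z * L_f1 P) * D / e)\<rceil>)))"
    if "0 \<le> z" for z
    using apg_mu_penalized[OF xin \<eta>(1) that e, of a c "fst (S z)" "snd (S z)"] by (simp_all add: S_def)
  have SN: "real (snd (S z)) \<le> N" if z: "0 \<le> z" "z \<le> 2 * M" for z
  proof -
    have zL: "L_g1 P + \<eta> + z * L_f1 P \<le> L" using z L_f1_pos by (simp add: L_def mult_right_mono)
    have pos: "0 < L_g1 P + \<eta> + z * L_f1 P" using z L_f1_pos L_g1_ge_1 \<eta> by (simp add: add_pos_nonneg)
    have "sqrt ((L_g1 P + \<eta> + z * L_f1 P) / \<eta>) \<le> sqrt (L / \<eta>)"
      using zL \<eta> by (simp add: divide_right_mono)
    moreover have "log 2 ((L_g1 P + \<eta> + z * L_f1 P) * D / e) \<le> log 2 (L * D / e)"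
      using zL pos D_pos e L by (intro log_mono) (auto simp: divide_right_mono mult_right_mono)
    then have "nat \<lceil>log 2 ((L_g1 P + \<eta> + z * L_f1 P) * D / e)\<rceil> \<le> nat \<lceil>log 2 (L * D / e)\<rceil>"
      by (intro nat_mono ceiling_mono)
    ultimately show ?thesis
      unfolding N_def using S(3)[OF z(1)] K_ge_1 pos \<eta> L
      by (elim order_trans) (intro mult_left_mono mult_mono, auto)
  qed
  \<comment> \<open>For a multiplier \<open>b \<ge> M\<close> a constraint violation above \<open>d\<close> would give the computed point a larger
    penalized value than the Slater point has, by more than the error of the inner solver.\<close>
  have big: "\<psi> (fst (S b)) \<le> d" if b: "M \<le> b" "b \<le> 2 * M" for b
  proof (rule ccontr)
    assume "\<not> \<psi> (fst (S b)) \<le> d"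
    let ?x = "fst (S b)"
    have b0: "0 \<le> b" using b M by simp
    have x: "?x \<in> X" using S(1)[OF b0] .
    have fx: "d < f ?x - c" using \<open>\<not> _\<close> \<psi>[OF x] by simp
    let ?r = "norm (a - ?x)"
    \<comment> \<open>Completing the square bounds the error of the inner solver by \<open>\<eta> d\<^sup>4 / 2\<close>.\<close>
    have "0 \<le> \<eta> / 2 * (?r - d\<^sup>2)\<^sup>2" using \<eta> by simp
    then have "e * ?r - \<eta> / 2 * ?r\<^sup>2 \<le> \<eta> / 2 * (d\<^sup>2)\<^sup>2"
      by (simp add: e_def power2_diff algebra_simps)
    also have "\<dots> < d"
    proof -
      have "d * (\<eta> * d ^ 3) < d * 2"
        using \<eta> d d1 mult_mono[of \<eta> 1 "d ^ 3" 1] power_le_one[of d 3] by (intro mult_strict_left_mono) auto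
      then show ?thesis by (simp add: eval_nat_numeral algebra_simps)
    qed
    finally have "penalized a \<eta> c b ?x < penalized a \<eta> c b a + d"
      using S(2)[OF b0 a] by simp
    moreover have "penalized a \<eta> c b a \<le> g a - b * \<Delta>"
      using \<Delta> b0 mult_left_mono[of "f a - c" "- \<Delta>" b] by (simp add: penalized_def)
    moreover have "g_star P + b * d \<le> penalized a \<eta> c b ?x"
    proof -
      have "b * d \<le> b * (f ?x - c)" using fx b0 by (intro mult_left_mono) auto
      moreover have "0 \<le> \<eta> / 2 * (norm (?x - a))\<^sup>2" using \<eta> by simp
      ultimately show ?thesis using g_star_le[OF x] unfolding penalized_def by linarith
    qed
    moreover have "M * \<Delta> \<le> b * \<Delta>" "1 * d \<le> b * d" using b M \<Delta> d by (auto intro: mult_right_mono)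
    ultimately show False using \<Delta>(2) by linarith
  qed
  \<comment> \<open>At the left end of a search interval \<open>\<psi> > d\<close>. At the right end \<open>\<psi> \<le> d\<close> and the failure of
    approximate complementarity forces \<open>\<psi> < - 2 d\<close>. By the comparison of approximate minimizers
    such a change of \<open>\<psi>\<close> is impossible on an interval of length \<open>\<eta> d\<^sup>3\<close>, as \<open>B d \<le> 1 / 4\<close>.\<close>
  have width: "\<eta> * d ^ 3 < z' - z"
    if z: "0 \<le> z" "z < z'" "z' \<le> 2 * M" "d < \<psi> (fst (S z))" "\<psi> (fst (S z')) \<le> d"
      "4 * M * d < \<bar>z' * \<psi> (fst (S z'))\<bar>" for z z'
  proof (rule ccontr)
    assume "\<not> \<eta> * d ^ 3 < z' - z"
    then have zz: "z' - z \<le> \<eta> * d ^ 3" by simp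
    let ?y = "fst (S z)" and ?y' = "fst (S z')"
    have z': "0 \<le> z'" using z by simp
    note y = S(1)[OF z(1)] S(1)[OF z']
    let ?p = "\<psi> ?y'"
    have "z' * ?p \<le> 2 * M * d"
      using z z' d M mult_left_mono[OF z(5) z'] mult_right_mono[OF z(3), of d] by linarith
    moreover have Md: "0 < M * d" using M d by simp
    ultimately have neg: "z' * ?p < - (4 * M * d)" using z(6) by linarith
    have "?p < - 2 * d"
    proof (rule ccontr)
      assume "\<not> ?p < - 2 * d"
      then have "z' * (- 2 * d) \<le> z' * ?p" using z' by (intro mult_left_mono) auto
      moreover have "z' * (2 * d) \<le> 2 * M * (2 * d)" using z d by (intro mult_right_mono) auto
      ultimately show False using neg by (simp add: algebra_simps)
    qed
    then have "3 * d < f ?y - f ?y'" using z(4) \<psi>[OF y(1)] \<psi>[OF y(2)] by simp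
    then have "\<eta> * (3 * d) < \<eta> * (f ?y - f ?y')" using \<eta> by simp
    also have "\<dots> \<le> B * (2 * e + (z' - z) * B)"
      using penalized_compare[OF y \<eta>(1) less_imp_le[OF z(2)] S(2)[OF z(1)] S(2)[OF z']] e by simp
    also have "\<dots> \<le> B * (2 * e + \<eta> * d ^ 3 * B)"
      using zz B_ge_1 by (intro mult_left_mono add_left_mono mult_right_mono) auto
    also have "\<dots> = \<eta> * d * (2 * (B * d) + (B * d)\<^sup>2)"
      by (simp add: e_def eval_nat_numeral algebra_simps)
    also have "\<dots> \<le> \<eta> * d * (2 * (1 / 4) + (1 / 4)\<^sup>2)"
      using Bd B_ge_1 d \<eta> by (intro mult_left_mono add_mono power_mono) auto
    also have "\<dots> \<le> \<eta> * (3 * d)" using \<eta> d by (simp add: power2_eq_square)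
    finally show False by simp
  qed
  have k: "M \<le> 2 ^ k" unfolding k_def using M by (intro le_two_power_nat_ceil_log) auto
  have "2 * M / w \<le> 2 ^ j" unfolding j_def using M w by (intro le_two_power_nat_ceil_log) auto
  then have j: "2 * M \<le> 2 ^ j * (\<eta> * d ^ 3)" using w by (simp add: w_def field_simps)
  have vt: "vtest apg\<^sub>\<mu> P D a M c \<delta> xin = dual apg\<^sub>\<mu> D
        (\<lambda>x. g_1 P x + \<eta> / 2 * (norm (x - a))\<^sup>2) (g_2 P) (L_g1 P + \<eta>) \<eta>
        (\<lambda>x. f_1 P x - c) (f_2 P) (L_f1 P) 1 M xin d"
    by (simp add: vtest_def \<eta>_def d_def Let_def)
  have Sapp: "apg\<^sub>\<mu> (\<lambda>x. g_1 P x + \<eta> / 2 * (norm (x - a))\<^sup>2 + z * (f_1 P x - c))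
      (\<lambda>x. g_2 P x + ereal z * f_2 P x) (L_g1 P + \<eta> + z * L_f1 P) \<eta> D e xin = S z" for z
    by (simp add: S_def)
  obtain z T where zT: "vtest apg\<^sub>\<mu> P D a M c \<delta> xin = Some ((fst (S z), z), T)"
    "0 \<le> z" "z \<le> 2 * M" "\<psi> (fst (S z)) \<le> d" "z = 0 \<or> \<bar>z * \<psi> (fst (S z))\<bar> \<le> 4 * M * d"
    "real T \<le> real (2 + k + j) * (N + 2)"
    using dual_correct[where apg = apg\<^sub>\<mu> and D = D and L\<^sub>\<phi> = "L_g1 P + \<eta>" and L\<^sub>\<psi> = "L_f1 P"
      and \<phi>\<^sub>1 = "\<lambda>x. g_1 P x + \<eta> / 2 * (norm (x - a))\<^sup>2" and \<phi>\<^sub>2 = "g_2 P" and \<mu> = \<eta>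
      and \<psi>\<^sub>1 = "\<lambda>x. f_1 P x - c" and \<psi>\<^sub>2 = "f_2 P" and x\<^sub>i\<^sub>n = xin and \<delta> = d and M = M and N = N
      and k = k and j = j, folded e_def, unfolded Sapp, folded \<psi>_def, OF SN d(1) M big width k j]
    unfolding vt by blast
  let ?x = "fst (S z)"
  have x: "?x \<in> X" using S(1)[OF zT(2)] .
  have compl: "\<bar>z * (f ?x - c)\<bar> \<le> \<delta> / C\<^sub>D"
    using zT(5) \<psi>[OF x] d(3) \<eta> by (auto simp: \<eta>_def)
  have minorant: "g ?x \<le> g y + \<delta> + z * (f y - c)" if y: "y \<in> X" for y
  proof -
    have "e * norm (y - ?x) \<le> \<eta> * D"
    proof -
      have "e \<le> \<eta>" using \<eta> d d1 by (simp add: e_def power_le_one mult_left_le)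
      then show ?thesis using dist_le_D[OF y x] \<eta> e by (intro mult_mono) auto
    qed
    moreover have "\<eta> / 2 * (norm (y - a))\<^sup>2 \<le> \<eta> * D\<^sup>2"
    proof -
      have "(norm (y - a))\<^sup>2 \<le> D\<^sup>2" using dist_le_D[OF y a] by (intro power_mono) auto
      then show ?thesis using \<eta> mult_mono[of "\<eta> / 2" \<eta> "(norm (y - a))\<^sup>2" "D\<^sup>2"] by auto
    qed
    moreover have "0 \<le> \<eta> / 2 * (norm (?x - a))\<^sup>2" "0 \<le> \<eta> / 2 * (norm (y - ?x))\<^sup>2" using \<eta> by auto
    moreover have "\<eta> * D + \<eta> * D\<^sup>2 + \<delta> / C\<^sub>D = \<delta>"
    proof -
      have "\<eta> * D + \<eta> * D\<^sup>2 + \<delta> / C\<^sub>D = \<eta> * (1 + D + D\<^sup>2)" by (simp add: \<eta>_def algebra_simps)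
      also have "\<dots> = \<delta>" using C_D_ge(4) CD by (simp add: \<eta>_def)
      finally show ?thesis .
    qed
    ultimately show ?thesis
      using S(2)[OF zT(2) y] compl unfolding penalized_def by linarith
  qed
  have cost: "real T \<le> 1008 * K * (log 2 W)\<^sup>2 * sqrt (C\<^sub>D * (L_g1 P + M * L_f1 P) / \<delta>)"
  proof -
    define l where "l = log 2 W"
    define s where "s = sqrt (L / \<eta>)"
    have l1: "1 \<le> l" using W by (simp add: l_def)
    have W0: "0 \<le> W" using W by simp
    have DW: "D \<le> W" using C_D_ge(2) W(2) by (rule order_trans)
    have inv_\<eta>: "1 / \<eta> \<le> W ^ 2"
    proof -
      have "1 / \<eta> = C\<^sub>D * (1 / \<delta>)" using \<delta> CD by (simp add: \<eta>_def)
      also have "\<dots> \<le> W * W" using W CD \<delta> by (intro mult_mono) auto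
      finally show ?thesis by (simp add: power2_eq_square)
    qed
    have inv_d: "1 / d \<le> W ^ 5"
    proof -
      have "1 / d = (2 * 2) * (C\<^sub>D * M * (1 / \<delta>))" using \<delta> CD M by (simp add: d_def)
      also have "\<dots> \<le> (W * W) * (W * W * W)" using W CD \<delta> M W0 by (intro mult_mono) auto
      finally show ?thesis by (simp add: eval_nat_numeral)
    qed
    have inv_e: "1 / e \<le> W ^ 12"
    proof -
      have "1 / e = (1 / \<eta>) * (1 / d) ^ 2" by (simp add: e_def power_divide)
      also have "\<dots> \<le> W ^ 2 * (W ^ 5) ^ 2"
        using inv_\<eta> inv_d \<eta> d by (intro mult_mono power_mono) auto
      finally show ?thesis by (simp flip: power_mult power_add)
    qed
    have inv_w: "1 / w \<le> W ^ 17"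
    proof -
      have "1 / w = (1 / \<eta>) * (1 / d) ^ 3" by (simp add: w_def power_divide)
      also have "\<dots> \<le> W ^ 2 * (W ^ 5) ^ 3"
        using inv_\<eta> inv_d \<eta> d by (intro mult_mono power_mono) auto
      finally show ?thesis by (simp flip: power_mult power_add)
    qed
    have LW: "L \<le> W ^ 4"
    proof -
      have "L \<le> 2 * W + 2 * (W * W)"
        using \<eta> W L_f1_pos M mult_mono[of M W "L_f1 P" W] by (simp add: L_def)
      also have "\<dots> \<le> W * W + W * (W * W)" using W by (intro add_mono mult_right_mono) auto
      also have "\<dots> \<le> W * (W * W) + W * (W * W)"
        using W by (intro add_mono) (auto simp: mult_le_cancel_right1)
      also have "\<dots> = 2 * (W * W * W)" by simp
      also have "\<dots> \<le> W * (W * W * W)" using W by (intro mult_right_mono) auto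
      finally show ?thesis by (simp add: eval_nat_numeral)
    qed
    have "L * D * (1 / e) \<le> W ^ 4 * W * W ^ 12"
      using LW inv_e L e D_pos DW W0 by (intro mult_mono) auto
    then have "L * D / e \<le> W ^ 17" by (simp add: eval_nat_numeral)
    then have log1: "real (nat \<lceil>log 2 (L * D / e)\<rceil>) \<le> 17 * l + 1"
      using nat_ceil_log_le[of "L * D / e" W 17] L e D_pos W by (simp add: l_def)
    have "2 * M * (1 / w) \<le> W * W * W ^ 17"
      using inv_w w M W by (intro mult_mono) auto
    then have "2 * M / w \<le> W ^ 19" by (simp add: eval_nat_numeral)
    then have log2: "real j \<le> 19 * l + 1"
      using nat_ceil_log_le[of "2 * M / w" W 19] M w W by (simp add: l_def j_def)
    have log3: "real k \<le> l + 1"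
      using nat_ceil_log_le[of M W 1] M W by (simp add: l_def k_def)
    have s1: "1 \<le> s" using L \<eta> by (simp add: s_def)
    have calls: "real (2 + k + j) \<le> 24 * l" using log2 log3 l1 by simp
    have Ks: "1 \<le> K * s" using mult_mono[of 1 K 1 s] K_ge_1 s1 by simp
    have "N \<le> K * (s * (19 * l))"
      unfolding N_def s_def[symmetric] using K_ge_1 s1 log1 l1 by (intro mult_left_mono) auto
    moreover have "2 \<le> 2 * (K * s * l)" using mult_mono[OF Ks l1] Ks by simp
    ultimately have N2: "N + 2 \<le> K * s * (21 * l)" by (simp add: algebra_simps)
    have s2: "s \<le> 2 * sqrt (C\<^sub>D * (L_g1 P + M * L_f1 P) / \<delta>)"
    proof -
      have "L \<le> 4 * (L_g1 P + M * L_f1 P)"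
      proof -
        have "0 \<le> M * L_f1 P" using L_f1_pos M by simp
        moreover have "L = L_g1 P + \<eta> + 2 * (M * L_f1 P)" by (simp add: L_def)
        moreover have "4 * (L_g1 P + M * L_f1 P) = 4 * L_g1 P + 4 * (M * L_f1 P)" by simp
        ultimately show ?thesis using \<eta> L_g1_ge_1 by linarith
      qed
      then have "L * (C\<^sub>D / \<delta>) \<le> 4 * (L_g1 P + M * L_f1 P) * (C\<^sub>D / \<delta>)"
        using CD \<delta> by (intro mult_right_mono) auto
      then have "L / \<eta> \<le> 2\<^sup>2 * (C\<^sub>D * (L_g1 P + M * L_f1 P) / \<delta>)"
        by (simp add: \<eta>_def mult_ac)
      then have "s \<le> sqrt (2\<^sup>2 * (C\<^sub>D * (L_g1 P + M * L_f1 P) / \<delta>))"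
        unfolding s_def by (rule real_sqrt_le_mono)
      then show ?thesis unfolding real_sqrt_mult[of "2\<^sup>2"] by simp
    qed
    have "0 \<le> N" using SN[of 0] M by linarith
    then have "real T \<le> 24 * l * (K * s * (21 * l))"
      using zT(6) calls N2 l1 by (elim order_trans) (intro mult_mono, auto)
    also have "\<dots> = 504 * K * l\<^sup>2 * s" by (simp add: power2_eq_square)
    also have "\<dots> \<le> 504 * K * l\<^sup>2 * (2 * sqrt (C\<^sub>D * (L_g1 P + M * L_f1 P) / \<delta>))"
      using s2 K_ge_1 by (intro mult_left_mono) auto
    finally show ?thesis by (simp add: l_def)
  qed
  show ?thesis
    using zT x compl minorant d \<psi>[OF x] cost
    by (intro exI[of _ ?x] exI[of _ z] exI[of _ T]) auto
qed

end

section \<open>The initial lower bound\<close>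

context sbo_setting
begin

text \<open>The cost of one round splits into a part growing like \<open>1 / \<Delta>\<close> and a part growing like
  \<open>1 / sqrt \<Delta>\<close>; the first one comes from the bound \<open>\<Omega> / \<Delta>\<close> on \<open>M\<close>.\<close>

lemma lbinit_step_cost:
  assumes D: "0 < \<Delta>" "\<Delta> \<le> 1" and M: "0 \<le> M" "M \<le> \<Omega> / \<Delta>" and l: "1 \<le> l"
    and n: "real n\<^sub>1 \<le> K * (1 + D * sqrt (L_f1 P / \<Delta>))" "real n\<^sub>2 \<le> K * (1 + D * sqrt (L_g1 P / \<Delta>))"
      "real n\<^sub>3 \<le> 1008 * K * l\<^sup>2 * sqrt (C\<^sub>D * (L_g1 P + M * L_f1 P) / \<Delta>)"
  shows "real (n\<^sub>1 + n\<^sub>2 + n\<^sub>3 + 8) \<le> 1019 * K * l\<^sup>2 *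
    (sqrt (C\<^sub>D * L_f1 P * \<Omega>) / \<Delta> + sqrt (C\<^sub>D * L_g1 P) / sqrt \<Delta>)"
proof -
  define a b where "a = sqrt (C\<^sub>D * L_f1 P * \<Omega>) / \<Delta>" and "b = sqrt (C\<^sub>D * L_g1 P) / sqrt \<Delta>"
  have CD: "1 \<le> C\<^sub>D" using C_D_ge by simp
  have b_eq: "b = sqrt (C\<^sub>D * L_g1 P / \<Delta>)" by (simp add: b_def real_sqrt_divide)
  have a_eq: "a = sqrt (C\<^sub>D * L_f1 P * \<Omega> / \<Delta>\<^sup>2)" using D by (simp add: a_def real_sqrt_divide)
  have Dsq: "D \<le> sqrt C\<^sub>D" using C_D_ge(3) D_pos by (intro real_le_rsqrt)
  have a0: "0 \<le> a" using D CD L_f1_pos Omega_ge_1 by (simp add: a_def)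
  have "1 \<le> C\<^sub>D * L_g1 P" using mult_mono[OF CD L_g1_ge_1] CD by simp
  then have b1: "1 \<le> b" using D unfolding b_eq by (simp add: le_divide_eq)
  have "sqrt (L_f1 P / \<Delta>) \<le> sqrt (L_f1 P * \<Omega> / \<Delta>\<^sup>2)"
  proof (rule real_sqrt_le_mono)
    have "L_f1 P / \<Delta> * 1 \<le> L_f1 P / \<Delta> * (\<Omega> / \<Delta>)"
      using D L_f1_pos Omega_ge_1 by (intro mult_left_mono) (auto simp: le_divide_eq)
    then show "L_f1 P / \<Delta> \<le> L_f1 P * \<Omega> / \<Delta>\<^sup>2" by (simp add: power2_eq_square)
  qed
  then have "D * sqrt (L_f1 P / \<Delta>) \<le> sqrt C\<^sub>D * sqrt (L_f1 P * \<Omega> / \<Delta>\<^sup>2)"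
    using Dsq D_pos L_f1_pos D CD by (intro mult_mono) auto
  also have "\<dots> = a" unfolding a_eq real_sqrt_mult[symmetric] by (simp add: mult.assoc)
  finally have 1: "D * sqrt (L_f1 P / \<Delta>) \<le> a" .
  have "D * sqrt (L_g1 P / \<Delta>) \<le> sqrt C\<^sub>D * sqrt (L_g1 P / \<Delta>)"
    using Dsq L_g1_ge_1 D by (intro mult_right_mono) auto
  also have "\<dots> = b" unfolding b_eq real_sqrt_mult[symmetric] by simp
  finally have 2: "D * sqrt (L_g1 P / \<Delta>) \<le> b" .
  have "C\<^sub>D * (L_g1 P + M * L_f1 P) / \<Delta> \<le> C\<^sub>D * L_g1 P / \<Delta> + C\<^sub>D * L_f1 P * \<Omega> / \<Delta>\<^sup>2"
  proof -
    have "C\<^sub>D * L_f1 P / \<Delta> * M \<le> C\<^sub>D * L_f1 P / \<Delta> * (\<Omega> / \<Delta>)"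
      using M CD L_f1_pos D by (intro mult_left_mono) auto
    then show ?thesis by (simp add: power2_eq_square algebra_simps add_divide_distrib)
  qed
  then have "sqrt (C\<^sub>D * (L_g1 P + M * L_f1 P) / \<Delta>) \<le> sqrt (C\<^sub>D * L_g1 P / \<Delta> + C\<^sub>D * L_f1 P * \<Omega> / \<Delta>\<^sup>2)"
    by (rule real_sqrt_le_mono)
  also have "\<dots> \<le> b + a" unfolding a_eq b_eq
    using CD L_g1_ge_1 L_f1_pos Omega_ge_1 D by (intro sqrt_add_le_add_sqrt) auto
  finally have 3: "sqrt (C\<^sub>D * (L_g1 P + M * L_f1 P) / \<Delta>) \<le> b + a" .
  have l2: "1 \<le> l\<^sup>2" using l by simp
  have "1 \<le> K * l\<^sup>2" using mult_mono[OF K_ge_1 l2] K_ge_1 by simp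
  have Kl: "K \<le> K * l\<^sup>2" using mult_left_mono[OF l2, of K] K_ge_1 by simp
  have "real n\<^sub>1 \<le> K * (1 + a)" using n(1) 1 K_ge_1 by (elim order_trans) (intro mult_left_mono, auto)
  moreover have "real n\<^sub>2 \<le> K * (1 + b)" using n(2) 2 K_ge_1 by (elim order_trans) (intro mult_left_mono, auto)
  moreover have "K * (1 + a) + K * (1 + b) \<le> (K * l\<^sup>2) * (3 * (a + b))"
  proof -
    have "K * (1 + a) + K * (1 + b) = K * (2 + (a + b))" by (simp add: algebra_simps)
    also have "\<dots> \<le> (K * l\<^sup>2) * (3 * (a + b))" using Kl K_ge_1 a0 b1 by (intro mult_mono) auto
    finally show ?thesis .
  qed
  moreover have "real n\<^sub>3 \<le> 1008 * K * l\<^sup>2 * (b + a)"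
    using n(3) 3 K_ge_1 by (elim order_trans) (intro mult_left_mono, auto)
  moreover have "8 \<le> (K * l\<^sup>2) * (8 * (a + b))"
    using mult_mono[OF \<open>1 \<le> K * l\<^sup>2\<close>, of 8 "8 * (a + b)"] a0 b1 \<open>1 \<le> K * l\<^sup>2\<close> by simp
  ultimately have "real (n\<^sub>1 + n\<^sub>2 + n\<^sub>3 + 8) \<le> 1019 * K * l\<^sup>2 * (a + b)"
    by (simp add: algebra_simps)
  then show ?thesis by (simp add: a_def b_def)
qed

text \<open>A round with accuracy \<open>\<Delta> \<le> 1 / Q\<close> returns: then \<open>f\<close> at the tested point is at most
  \<open>(p\<^sup>* + f\<^sup>*) / 2\<close>, so that \<open>g\<close> exceeds \<open>g\<^sup>*\<close> by at least \<open>m\<^sub>0\<close>. A round that returns has found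
  \<open>l \<le> p\<^sup>*\<close>, since otherwise the minorant at a solution would give \<open>g \<le> g\<^sup>* + \<Delta>\<close>. In the bound on
  the cost, \<open>4 Q - 2 / \<Delta>'\<close> and \<open>6 sqrt Q - 4 / sqrt \<Delta>'\<close> dominate the geometric sums of \<open>1 / \<Delta>\<close> and
  \<open>1 / sqrt \<Delta>\<close> over the remaining rounds, so the number of rounds does not enter as a factor.\<close>

lemma lbinit_loop_correct:
  assumes Q: "1 \<le> Q" "8 / (p_star P - f_star P) \<le> Q" "8 / m_0 P \<le> Q"
    and W: "2 \<le> W" "C\<^sub>D \<le> W" "2 * \<Omega> * Q \<le> W" "L_g1 P \<le> W" "L_f1 P \<le> W"
  defines "U \<equiv> 1019 * K * (log 2 W)\<^sup>2"
    and "a \<equiv> sqrt (C\<^sub>D * L_f1 P * \<Omega>)" and "b \<equiv> sqrt (C\<^sub>D * L_g1 P)"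
  assumes "\<Delta>' / 2 \<le> 1 / B" "1 / Q \<le> \<Delta>'" "\<Delta>' / 2 \<le> 2 ^ k / Q"
    and "xf \<in> X" "xg \<in> X" "xt \<in> X"
  shows "\<exists>l \<Delta> x M T'. lbinit_loop apg\<^sub>0 apg\<^sub>\<mu> P D \<Delta>' xf xg xt T = Some ((l, \<Delta>, x, M), T')
    \<and> x \<in> X \<and> 1 / (2 * Q) \<le> \<Delta> \<and> \<Delta> \<le> 1 / B \<and> l = f x + \<Delta> \<and> l \<le> p_star P
    \<and> 1 \<le> M \<and> M \<le> \<Omega> / \<Delta> \<and> g x - g_star P \<le> M * \<Delta>
    \<and> real T' \<le> real T + U * (a * (4 * Q - 2 / \<Delta>') + b * (6 * sqrt Q - 4 / sqrt \<Delta>'))"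
  using assms(12-)
proof (induction k arbitrary: \<Delta>' xf xg xt T rule: less_induct)
  case (less k \<Delta>' xf xg xt T)
  define \<Delta> where "\<Delta> = \<Delta>' / 2"
  have Q0: "0 < Q" using Q by simp
  have "0 < 1 / Q" using Q0 by simp
  then have "0 < \<Delta>'" using less.prems(2) by (rule less_le_trans)
  then have \<Delta>: "0 < \<Delta>" by (simp add: \<Delta>_def)
  have low: "1 / (2 * Q) \<le> \<Delta>" using less.prems(2) by (simp add: \<Delta>_def)
  have \<Delta>B: "\<Delta> \<le> 1 / B" using less.prems(1) by (simp add: \<Delta>_def)
  also have "\<dots> \<le> 1" using B_ge_1 by simp
  finally have \<Delta>1: "\<Delta> \<le> 1" .
  have inv: "1 / \<Delta> \<le> 2 * Q" using low \<Delta> Q0 by (simp add: field_simps)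
  obtain x n\<^sub>1 where x_eq: "apg\<^sub>0 (f_1 P) (\<lambda>x. f_2 P x + indicator_fun X x) (L_f1 P) \<Delta> xf D = (x, n\<^sub>1)"
    by fastforce
  obtain y n\<^sub>2 where y_eq: "apg\<^sub>0 (g_1 P) (g_2 P) (L_g1 P) \<Delta> xg D = (y, n\<^sub>2)"
    by fastforce
  note x = apg0_f[OF \<open>xf \<in> X\<close> \<Delta> x_eq] and y = apg0_g[OF \<open>xg \<in> X\<close> \<Delta> y_eq]
  define l where "l = f x + \<Delta>"
  define M where "M = max ((g x - g y + 1) / \<Delta>) 1"
  have M1: "1 \<le> M" by (simp add: M_def)
  have M\<Omega>: "M \<le> \<Omega> / \<Delta>"
  proof -
    have "(g x - g y + 1) / \<Delta> \<le> \<Omega> / \<Delta>"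
      using Omega_bound[OF x(1)] g_star_le[OF y(1)] \<Delta> by (intro divide_right_mono) auto
    moreover have "1 \<le> \<Omega> / \<Delta>" using Omega_ge_1 \<Delta> \<Delta>1 by (simp add: le_divide_eq)
    ultimately show ?thesis by (simp add: M_def)
  qed
  have M\<Delta>: "g x - g_star P \<le> M * \<Delta>"
  proof -
    have "(g x - g y + 1) / \<Delta> * \<Delta> \<le> M * \<Delta>" unfolding M_def using \<Delta> by (intro mult_right_mono) auto
    then show ?thesis using y(2) \<Delta> \<Delta>1 by simp
  qed
  have "\<Omega> / \<Delta> \<le> \<Omega> * (2 * Q)" using inv Omega_ge_1 mult_left_mono[OF inv, of \<Omega>] by simp
  then have MW: "M \<le> W" using M\<Omega> W(3) by (simp add: mult_ac)
  have "2 * Q * 1 \<le> 2 * Q * \<Omega>" using Q0 Omega_ge_1 by (intro mult_left_mono) auto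
  then have \<Delta>W: "1 / \<Delta> \<le> W" using inv W(3) by (simp add: mult_ac)
  have "f x \<le> l - \<Delta>" by (simp add: l_def)
  from vtest_correct[OF \<open>xt \<in> X\<close> x(1) M1 this M\<Delta> \<Delta> \<Delta> \<Delta>B W(1,2) MW \<Delta>W W(4,5)]
  obtain u z n\<^sub>3 where vt: "vtest apg\<^sub>\<mu> P D x M l \<Delta> xt = Some ((u, z), n\<^sub>3)" and u: "u \<in> X" and z: "0 \<le> z"
    and fu: "f u \<le> l + \<Delta> / 4" and min: "\<And>y. y \<in> X \<Longrightarrow> g u \<le> g y + \<Delta> + z * (f y - l)"
    and n3: "real n\<^sub>3 \<le> 1008 * K * (log 2 W)\<^sup>2 * sqrt (C\<^sub>D * (L_g1 P + M * L_f1 P) / \<Delta>)"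
    by metis
  let ?T = "T + n\<^sub>1 + n\<^sub>2 + n\<^sub>3 + 8"
  have eq: "lbinit_loop apg\<^sub>0 apg\<^sub>\<mu> P D \<Delta>' xf xg xt T =
    (if g u - g y > \<Delta> then Some ((l, \<Delta>, x, M), ?T)
     else lbinit_loop apg\<^sub>0 apg\<^sub>\<mu> P D \<Delta> x y u ?T)"
    by (subst lbinit_loop.simps)
       (simp add: Let_def x_eq y_eq vt flip: \<Delta>_def l_def M_def)
  define r where "r = 1 / sqrt \<Delta>'"
  have \<Delta>': "0 < \<Delta>'" using \<Delta> by (simp add: \<Delta>_def)
  have r: "0 < r" "r \<le> sqrt Q" "4 / sqrt \<Delta>' = 4 * r" "1 / sqrt \<Delta> = sqrt 2 * r"
  proof -
    show "0 < r" "4 / sqrt \<Delta>' = 4 * r" using \<Delta>' by (auto simp: r_def)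
    have "1 / \<Delta>' \<le> Q" using less.prems(2) \<Delta>' Q0 by (simp add: field_simps)
    then show "r \<le> sqrt Q" using real_sqrt_le_mono[of "1 / \<Delta>'" Q] by (simp add: r_def real_sqrt_divide)
    show "1 / sqrt \<Delta> = sqrt 2 * r" by (simp add: r_def \<Delta>_def real_sqrt_divide)
  qed
  have s2: "4 / 3 \<le> sqrt (2::real)" "sqrt (2::real) \<le> 2"
    by (rule real_le_rsqrt, simp add: power2_eq_square) (rule real_le_lsqrt, auto)
  have s2r: "4 / 3 * r \<le> sqrt 2 * r" "sqrt 2 * r \<le> 2 * r"
    using s2 r(1) by (auto intro!: mult_right_mono simp del: mult_le_cancel_right_pos)
  have a0: "0 \<le> a" and b0: "0 \<le> b" and U0: "0 \<le> U"
    using C_D_ge(1) L_f1_pos Omega_ge_1 L_g1_ge_1 K_ge_1 by (auto simp: a_def b_def U_def)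
  have l1: "1 \<le> log 2 W" using W by simp
  have "real (n\<^sub>1 + n\<^sub>2 + n\<^sub>3 + 8) \<le> U * (a / \<Delta> + b / sqrt \<Delta>)"
    using lbinit_step_cost[OF \<Delta> \<Delta>1 _ M\<Omega> l1 x(3) y(3) n3] M1 by (simp add: U_def a_def b_def)
  also have "a / \<Delta> + b / sqrt \<Delta> = a * (2 / \<Delta>') + b * (sqrt 2 * r)"
    unfolding r(4)[symmetric] by (simp add: \<Delta>_def)
  finally have step: "real ?T \<le> real T + U * (a * (2 / \<Delta>') + b * (sqrt 2 * r))" by simp
  show ?case
  proof (cases "g u - g y > \<Delta>")
    case True
    have "l \<le> p_star P"
    proof (rule ccontr)
      assume "\<not> l \<le> p_star P"
      obtain xs where xs: "xs \<in> X" "g xs = g_star P" "f xs = p_star P" using solution_exists by metis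
      have "z * (f xs - l) \<le> 0" using \<open>\<not> _\<close> xs z by (simp add: mult_le_0_iff)
      then show False using min[OF xs(1)] xs True g_star_le[OF y(1)] by simp
    qed
    moreover have "real ?T \<le> real T + U * (a * (4 * Q - 2 / \<Delta>') + b * (6 * sqrt Q - 4 / sqrt \<Delta>'))"
    proof -
      have "2 / \<Delta>' \<le> 4 * Q - 2 / \<Delta>'" using less.prems(2) \<Delta>' Q0 by (simp add: field_simps)
      moreover have "sqrt 2 * r \<le> 6 * sqrt Q - 4 / sqrt \<Delta>'"
        unfolding r(3) using r(1,2) s2r(2) by linarith
      ultimately have "U * (a * (2 / \<Delta>') + b * (sqrt 2 * r))
        \<le> U * (a * (4 * Q - 2 / \<Delta>') + b * (6 * sqrt Q - 4 / sqrt \<Delta>'))"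
        using a0 b0 U0 by (intro mult_left_mono add_mono) auto
      then show ?thesis using step by simp
    qed
    ultimately show ?thesis unfolding eq using True x(1) low \<Delta>B M1 M\<Omega> M\<Delta> l_def by simp
  next
    case False
    have "\<not> \<Delta> \<le> 1 / Q"
    proof
      assume small: "\<Delta> \<le> 1 / Q"
      have "1 / Q \<le> (p_star P - f_star P) / 8" "1 / Q \<le> m_0 P / 8"
        using Q p_star_gt m_0_bounds(1) Q0 by (simp_all add: field_simps)
      moreover obtain w where "w \<in> X" "f w = f_star P" using f_star_attained by metis
      ultimately have "f u \<le> (p_star P + f_star P) / 2"
        using fu x(2)[of w] small \<Delta> by (simp add: l_def)
      then have "g_star P + m_0 P \<le> g u" using m_0_bounds(2)[OF u] by simp
      then show False using False y(2) \<open>1 / Q \<le> m_0 P / 8\<close> small \<Delta> by simp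
    qed
    then have \<Delta>Q: "1 / Q \<le> \<Delta>" "1 / Q < \<Delta>" by auto
    then obtain j where j: "k = Suc j" using less.prems(3) by (cases k) (auto simp: \<Delta>_def)
    have jj: "\<Delta> / 2 \<le> 2 ^ j / Q" using less.prems(3) j by (simp add: \<Delta>_def mult.commute)
    have "\<Delta> / 2 \<le> 1 / B" using \<Delta>B \<Delta> by simp
    from less.IH[OF _ this \<Delta>Q(1) jj x(1) y(1) u, of ?T] j
    obtain l' \<Delta>'' x' M' T' where IH: "lbinit_loop apg\<^sub>0 apg\<^sub>\<mu> P D \<Delta> x y u ?T = Some ((l', \<Delta>'', x', M'), T')"
      "x' \<in> X \<and> 1 / (2 * Q) \<le> \<Delta>'' \<and> \<Delta>'' \<le> 1 / B \<and> l' = f x' + \<Delta>'' \<and> l' \<le> p_star P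
      \<and> 1 \<le> M' \<and> M' \<le> \<Omega> / \<Delta>'' \<and> g x' - g_star P \<le> M' * \<Delta>''"
      "real T' \<le> real ?T + U * (a * (4 * Q - 2 / \<Delta>) + b * (6 * sqrt Q - 4 / sqrt \<Delta>))" by blast
    have "U * (a * (2 / \<Delta>') + b * (sqrt 2 * r)) + U * (a * (4 * Q - 2 / \<Delta>) + b * (6 * sqrt Q - 4 / sqrt \<Delta>))
      = U * (a * (2 / \<Delta>' + (4 * Q - 2 / \<Delta>)) + b * (sqrt 2 * r + (6 * sqrt Q - 4 * (1 / sqrt \<Delta>))))"
      by (simp add: algebra_simps)
    also have "\<dots> \<le> U * (a * (4 * Q - 2 / \<Delta>') + b * (6 * sqrt Q - 4 / sqrt \<Delta>'))"
    proof -
      have "2 / \<Delta>' + (4 * Q - 2 / \<Delta>) \<le> 4 * Q - 2 / \<Delta>'" by (simp add: \<Delta>_def)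
      moreover have "sqrt 2 * r + (6 * sqrt Q - 4 * (1 / sqrt \<Delta>)) \<le> 6 * sqrt Q - 4 / sqrt \<Delta>'"
        unfolding r(3,4) using s2r(1) r(1) by linarith
      ultimately show ?thesis using a0 b0 U0 by (intro mult_left_mono add_mono) auto
    qed
    finally have "real T' \<le> real T + U * (a * (4 * Q - 2 / \<Delta>') + b * (6 * sqrt Q - 4 / sqrt \<Delta>'))"
      using step IH(3) by linarith
    then show ?thesis unfolding eq using IH False by auto
  qed
qed

end

section \<open>The Newton iteration\<close>

context sbo_setting
begin

text \<open>The state of the loop is accompanied by a reference point \<open>q\<close> and by numbers \<open>G\<close> and \<open>Z\<close>: the
  point, gap and multiplier of the last Newton step, or suitable initial values. A Newton step at
  least halves the product \<open>G * Z\<close> and any other step which continues halves \<open>\<delta>\<close>, while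
  \<open>G * Z \<ge> \<kappa>\<close> and \<open>\<delta> \<ge> \<delta>\<^sub>m\<close> remain true. So \<open>\<delta> * (G * Z)\<close> is a potential bounding the number of
  steps.\<close>

lemma sntvfa_loop_correct:
  assumes eps: "0 < \<epsilon>" "\<epsilon> \<le> 1" and v: "g_star P \<le> v" "v \<le> g_star P + \<epsilon> / 8"
    and a: "a \<in> X" and M: "1 \<le> M" and \<Delta>: "f a \<le> l\<^sub>0 - \<Delta>" "g a - g_star P \<le> M * \<Delta>" "0 < \<Delta>"
  defines "\<delta>\<^sub>m \<equiv> \<epsilon> / (20 * (D\<^sup>2 + 2))" and "\<kappa> \<equiv> \<epsilon>\<^sup>2 / (8 * B * C\<^sub>D)"
  assumes W: "2 \<le> W" "C\<^sub>D \<le> W" "M \<le> W" "1 / \<delta>\<^sub>m \<le> W" "L_g1 P \<le> W" "L_f1 P \<le> W"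
  defines "N \<equiv> 1008 * K * (log 2 W)\<^sup>2 * sqrt (C\<^sub>D * (L_g1 P + M * L_f1 P) / \<delta>\<^sub>m)"
  assumes "l\<^sub>0 \<le> c" "c \<le> p_star P" "\<delta>\<^sub>m \<le> \<delta>" "\<delta> \<le> 1 / B" "xw \<in> X" "q \<in> X"
    and "0 < G" "0 < Z" "g q - v \<le> G" "(f q - c) * Z \<le> - (13 / 16) * G" "\<kappa> \<le> G * Z"
      "\<delta> * (G * Z) \<le> 2 ^ k * (\<delta>\<^sub>m * \<kappa>)"
  shows "\<exists>x T'. sntvfa_loop apg\<^sub>\<mu> P \<epsilon> D v a M c \<delta> xw T = Some (x, T') \<and> x \<in> X
    \<and> f x \<le> p_star P + \<epsilon> \<and> g x \<le> g_star P + \<epsilon> \<and> real T' \<le> real T + real (k + 1) * (N + 2)"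
  using assms(19-)
proof (induction k arbitrary: c \<delta> xw q G Z T rule: less_induct)
  case (less k c \<delta> xw q G Z T)
  have CD: "1 \<le> C\<^sub>D" using C_D_ge by simp
  have \<delta>m: "0 < \<delta>\<^sub>m" using eps by (simp add: \<delta>\<^sub>m_def add_nonneg_pos)
  have \<kappa>: "0 < \<kappa>" using eps B_ge_1 CD by (simp add: \<kappa>_def)
  have \<delta>: "0 < \<delta>" using less.prems \<delta>m by simp
  have inv: "1 / \<delta> \<le> 1 / \<delta>\<^sub>m" using less.prems \<delta>m by (simp add: frac_le)
  have "f a \<le> c - \<Delta>" using \<Delta> less.prems by simp
  from vtest_correct[OF \<open>xw \<in> X\<close> a M this \<Delta>(2,3) \<delta> \<open>\<delta> \<le> 1 / B\<close> W(1,2,3) order_trans[OF inv W(4)] W(5,6)]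
  obtain x z n where vt: "vtest apg\<^sub>\<mu> P D a M c \<delta> xw = Some ((x, z), n)" and x: "x \<in> X" and z: "0 \<le> z"
    and fx: "f x \<le> c + \<delta> / 4" and cp: "z * (f x - c) \<le> \<delta> / C\<^sub>D"
    and min: "\<And>y. y \<in> X \<Longrightarrow> g x \<le> g y + \<delta> + z * (f y - c)"
    and n: "real n \<le> 1008 * K * (log 2 W)\<^sup>2 * sqrt (C\<^sub>D * (L_g1 P + M * L_f1 P) / \<delta>)"
    by metis
  have nN: "real n \<le> N"
  proof -
    have "0 \<le> M * L_f1 P" using M L_f1_pos by simp
    then have "C\<^sub>D * (L_g1 P + M * L_f1 P) * (1 / \<delta>) \<le> C\<^sub>D * (L_g1 P + M * L_f1 P) * (1 / \<delta>\<^sub>m)"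
      using inv CD L_g1_ge_1 by (intro mult_left_mono) auto
    then show ?thesis
      using n K_ge_1 unfolding N_def by (elim order_trans) (intro mult_left_mono real_sqrt_le_mono, auto)
  qed
  have N0: "0 \<le> N" using nN by linarith
  define gap where "gap = g x - v"
  define err where "err = (D\<^sup>2 + 2) * \<delta>"
  have err: "2 * \<delta> \<le> err" using \<delta> by (simp add: err_def algebra_simps)
  have err_pos: "0 < err" using err \<delta> by simp
  let ?T = "T + n + 2"
  obtain xs where xs: "xs \<in> X" "g xs = g_star P" "f xs = p_star P" using solution_exists by metis
  have model: "gap \<le> \<delta> + z * (p_star P - c)"
    using min[OF xs(1)] xs v by (simp add: gap_def)
  have eq: "sntvfa_loop apg\<^sub>\<mu> P \<epsilon> D v a M c \<delta> xw T =
    (if gap \<le> 7 * \<epsilon> / 8 \<and> \<delta> \<le> \<epsilon> then Some (x, ?T)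
     else if z = 0 \<and> err \<le> \<epsilon> then Some (x, ?T)
     else if z > 0 \<and> err \<le> gap / 8
       then sntvfa_loop apg\<^sub>\<mu> P \<epsilon> D v a M (c + (gap - err) / z) \<delta> x ?T
     else sntvfa_loop apg\<^sub>\<mu> P \<epsilon> D v a M c (\<delta> / 2) x ?T)"
    by (subst sntvfa_loop.simps) (simp add: vt Let_def gap_def err_def)
  have T: "real ?T \<le> real T + real (k + 1) * (N + 2)"
  proof -
    have "0 \<le> real k * (N + 2)" using N0 by simp
    moreover have "real (k + 1) * (N + 2) = (N + 2) + real k * (N + 2)" by (simp add: algebra_simps)
    moreover have "real ?T \<le> real T + (N + 2)" using nN by simp
    ultimately show ?thesis by linarith
  qed
  have T_IH: "real ?T + real (j + 1) * (N + 2) \<le> real T + real (k + 1) * (N + 2)" if "Suc j = k" for j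
  proof -
    have "real (k + 1) * (N + 2) = (N + 2) + real (j + 1) * (N + 2)"
      using that by (auto simp: algebra_simps)
    moreover have "real ?T \<le> real T + (N + 2)" using nN by simp
    ultimately show ?thesis by linarith
  qed
  consider (a) "gap \<le> 7 * \<epsilon> / 8" "\<delta> \<le> \<epsilon>"
    | (b) "\<not> (gap \<le> 7 * \<epsilon> / 8 \<and> \<delta> \<le> \<epsilon>)" "z = 0" "err \<le> \<epsilon>"
    | (c) "\<not> (gap \<le> 7 * \<epsilon> / 8 \<and> \<delta> \<le> \<epsilon>)" "z > 0" "err \<le> gap / 8"
    | (d) "\<not> (gap \<le> 7 * \<epsilon> / 8 \<and> \<delta> \<le> \<epsilon>)" "\<not> (z = 0 \<and> err \<le> \<epsilon>)" "\<not> (z > 0 \<and> err \<le> gap / 8)"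
    by blast
  then show ?case
  proof cases
    case a
    then have "f x \<le> p_star P + \<epsilon>" "g x \<le> g_star P + \<epsilon>"
      using fx less.prems v \<delta> by (auto simp: gap_def)
    then show ?thesis using a x T unfolding eq by auto
  next
    case b
    have "g x \<le> g_star P + \<delta>" using min[OF xs(1)] xs b by simp
    then have "f x \<le> p_star P + \<epsilon>" "g x \<le> g_star P + \<epsilon>"
      using fx less.prems b err \<delta> by auto
    then show ?thesis using b x T unfolding eq by auto
  next
    case c
    define c' where "c' = c + (gap - err) / z"
    have gap: "0 < gap" using c err_pos by simp
    have c': "c \<le> c'" using c gap by (simp add: c'_def)
    have "gap - err \<le> z * (p_star P - c)" using model err \<delta> by simp
    then have "c' \<le> p_star P" using c by (simp add: c'_def field_simps)
    \<comment> \<open>The new minorant, evaluated at the reference point: \<open>15/16\<close> of the gap ratio plus \<open>13/16\<close> of the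
      multiplier ratio is at most 1, so the product of the two ratios is at most \<open>64/195 < 1/2\<close>.\<close>
    have step: "(15 / 16) * gap * Z + (13 / 16) * z * G \<le> G * Z"
    proof -
      have "gap \<le> G + \<delta> + z * (f q - c)" using min[OF \<open>q \<in> X\<close>] less.prems by (simp add: gap_def)
      then have "(15 / 16) * gap \<le> G + z * (f q - c)" using c(3) err by simp
      then have "(15 / 16) * gap * Z \<le> (G + z * (f q - c)) * Z"
        using less.prems by (intro mult_right_mono) auto
      moreover have "z * ((f q - c) * Z) \<le> z * (- (13 / 16) * G)"
        using less.prems z by (intro mult_left_mono) auto
      ultimately show ?thesis by (simp add: algebra_simps)
    qed
    have half: "gap * z \<le> (G * Z) / 2"
    proof -
      let ?p = "(15 / 16) * gap * Z" and ?q = "(13 / 16) * z * G"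
      have GZ: "0 < G * Z" using less.prems by simp
      have pq: "0 \<le> ?p" "0 \<le> ?q" using gap z less.prems by auto
      have "4 * (?p * ?q) \<le> (?p + ?q)\<^sup>2"
        using zero_le_power2[of "?p - ?q"] by (simp add: power2_eq_square algebra_simps)
      also have "\<dots> \<le> (G * Z)\<^sup>2" using step pq by (intro power_mono) auto
      finally have "(G * Z) * ((195 / 64) * (gap * z)) \<le> (G * Z) * (G * Z)"
        by (simp add: power2_eq_square algebra_simps)
      then have "(195 / 64) * (gap * z) \<le> G * Z" using GZ by (simp only: mult_le_cancel_left_pos)
      moreover have "0 \<le> gap * z" using gap z by simp
      ultimately show ?thesis by simp
    qed
    \<comment> \<open>The gap is at least \<open>8 err\<close>, and the minorant at a solution bounds the multiplier below by
      a multiple of the gap divided by \<open>p\<^sup>* - c \<le> B D\<close>. With \<open>C\<^sub>D\<close> in place of \<open>D\<close> the bound \<open>\<kappa>\<close> is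
      also below the initial value of \<open>G * Z\<close> when \<open>D\<close> is tiny.\<close>
    have low: "\<kappa> \<le> gap * z"
    proof -
      have "(2 / 5) * \<epsilon> \<le> gap"
      proof -
        have "(D\<^sup>2 + 2) * \<delta>\<^sub>m \<le> err" unfolding err_def using less.prems by (intro mult_left_mono) auto
        moreover have "(D\<^sup>2 + 2) * \<delta>\<^sub>m = \<epsilon> / 20"
          unfolding \<delta>\<^sub>m_def using add_nonneg_pos[of "D\<^sup>2" 2] by (simp add: field_simps)
        ultimately show ?thesis using c(3) by simp
      qed
      then have g2: "((2 / 5) * \<epsilon>)\<^sup>2 \<le> gap\<^sup>2" using eps by (intro power_mono) auto
      have "p_star P - c \<le> B * C\<^sub>D"
      proof -
        have "f xs - f a \<le> B * norm (xs - a)" using f_lip[OF xs(1) a] by simp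
        also have "\<dots> \<le> B * C\<^sub>D" using dist_le_D[OF xs(1) a] C_D_ge(2) B_ge_1 by (intro mult_left_mono) auto
        finally show ?thesis using xs \<Delta> less.prems by simp
      qed
      then have "z * (p_star P - c) \<le> z * (B * C\<^sub>D)" using z by (intro mult_left_mono)
      then have "(7 / 8) * gap \<le> z * (B * C\<^sub>D)" using model c(3) err \<delta> by simp
      then have "gap * ((7 / 8) * gap) \<le> gap * (z * (B * C\<^sub>D))" using gap by (intro mult_left_mono) auto
      then have "7 * gap\<^sup>2 \<le> (gap * z) * (8 * B * C\<^sub>D)" by (simp add: power2_eq_square algebra_simps)
      moreover have "4 * \<epsilon>\<^sup>2 \<le> 25 * gap\<^sup>2" using g2 by (simp add: power2_eq_square)
      moreover have "0 \<le> \<epsilon>\<^sup>2" by simp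
      ultimately have "\<epsilon>\<^sup>2 \<le> (gap * z) * (8 * B * C\<^sub>D)" by linarith
      then show ?thesis unfolding \<kappa>_def using B_ge_1 CD by (simp add: divide_le_eq)
    qed
    have ref: "(f x - c') * z \<le> - (13 / 16) * gap"
    proof -
      have "(f x - c') * z = z * (f x - c) - (gap - err)" using c by (simp add: c'_def field_simps)
      moreover have "\<delta> / C\<^sub>D \<le> \<delta>" using CD \<delta> by (simp add: divide_le_eq)
      ultimately show ?thesis using cp c(3) err by simp
    qed
    have mono: "\<delta> * (gap * z) \<le> \<delta> * (G * Z) / 2"
      using half mult_left_mono[OF half, of \<delta>] \<delta> by simp
    moreover have "\<delta>\<^sub>m * \<kappa> \<le> \<delta> * (gap * z)" using low less.prems \<delta>m \<kappa> \<delta> by (intro mult_mono) auto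
    moreover have "0 < \<delta>\<^sub>m * \<kappa>" using \<delta>m \<kappa> by simp
    ultimately obtain j where j: "Suc j = k" using less.prems(12) by (cases k) auto
    have "\<delta> * (gap * z) \<le> 2 ^ j * (\<delta>\<^sub>m * \<kappa>)" using mono less.prems(12) j by auto
    then have "\<exists>x' T'. sntvfa_loop apg\<^sub>\<mu> P \<epsilon> D v a M c' \<delta> x ?T = Some (x', T') \<and> x' \<in> X
      \<and> f x' \<le> p_star P + \<epsilon> \<and> g x' \<le> g_star P + \<epsilon> \<and> real T' \<le> real ?T + real (j + 1) * (N + 2)"
      using j c' less.prems \<open>c' \<le> p_star P\<close> x gap c(2) ref low
      by (intro less.IH[where q = x and G = gap and Z = z]) (auto simp: gap_def)
    then show ?thesis using c T_IH[OF j] unfolding eq c'_def by force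
  next
    case d
    \<comment> \<open>If \<open>err\<close> were at most \<open>7 \<epsilon> / 64\<close>, one of the other three cases would apply. The constant in
      \<open>\<delta>\<^sub>m\<close> leaves room for one more halving, as \<open>1 / 20 \<le> 7 / 128\<close>.\<close>
    have "7 * \<epsilon> / 64 < err"
    proof (cases "\<delta> \<le> \<epsilon>")
      case True
      then show ?thesis using d z eps by (cases "z = 0") auto
    next
      case False
      then show ?thesis using err eps by simp
    qed
    then have half: "\<delta>\<^sub>m \<le> \<delta> / 2"
    proof -
      assume *: "7 * \<epsilon> / 64 < err"
      have p: "0 < D\<^sup>2 + 2" by (simp add: add_nonneg_pos)
      have "\<epsilon> \<le> (\<delta> / 2) * (20 * (D\<^sup>2 + 2))" using * eps by (simp add: err_def algebra_simps)
      then show ?thesis unfolding \<delta>\<^sub>m_def using p by (simp add: divide_le_eq)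
    qed
    have mono: "\<delta> / 2 * (G * Z) \<le> \<delta> * (G * Z) / 2" by simp
    moreover have "\<delta>\<^sub>m * \<kappa> \<le> \<delta> / 2 * (G * Z)" using half less.prems \<delta>m \<kappa> \<delta> by (intro mult_mono) auto
    moreover have "0 < \<delta>\<^sub>m * \<kappa>" using \<delta>m \<kappa> by simp
    ultimately obtain j where j: "Suc j = k" using less.prems(12) by (cases k) auto
    have "\<delta> / 2 * (G * Z) \<le> 2 ^ j * (\<delta>\<^sub>m * \<kappa>)" using less.prems(12) j by auto
    then have "\<exists>x' T'. sntvfa_loop apg\<^sub>\<mu> P \<epsilon> D v a M c (\<delta> / 2) x ?T = Some (x', T') \<and> x' \<in> X
      \<and> f x' \<le> p_star P + \<epsilon> \<and> g x' \<le> g_star P + \<epsilon> \<and> real T' \<le> real ?T + real (j + 1) * (N + 2)"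
      using j less.prems x half \<delta>
      by (intro less.IH[where q = q and G = G and Z = Z]) auto
    then show ?thesis using d T_IH[OF j] unfolding eq by force
  qed
qed

end

section \<open>Complexity\<close>

lemma log_2_le: "1 \<le> W \<Longrightarrow> log 2 W \<le> 2 * ln (W :: real)"
proof -
  assume W: "1 \<le> W"
  have "1 / 2 \<le> ln (2 :: real)" using ln2_ge_two_thirds by linarith
  then have "ln W * 1 \<le> ln W * (2 * ln 2)" using W by (intro mult_left_mono) auto
  then show ?thesis by (simp add: log_def divide_le_eq)
qed

context sbo_setting
begin

abbreviation "\<Lambda> \<equiv> log_factor P D"


text \<open>The logarithms are estimated through \<open>exp \<Lambda>\<close>, which bounds \<open>C\<^sub>D\<close>, \<open>\<Omega>\<close> and the Lipschitz
  constants of the gradients.\<close>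

lemma log_factor_bounds:
  shows log_factor_ge_1: "1 \<le> \<Lambda>"
    and exp_log_factor_ge: "2 \<le> exp \<Lambda>" "C\<^sub>D \<le> exp \<Lambda>" "L_g1 P \<le> exp \<Lambda>" "L_f1 P \<le> exp \<Lambda>"
      "2 * \<Omega> \<le> exp \<Lambda>"
proof -
  note CD = C_D_ge(1)
  have ln0: "0 \<le> ln (1 + L_f1 P)" "0 \<le> ln (L_g1 P)" "0 \<le> ln C\<^sub>D" "0 \<le> ln \<Omega>"
    using L_f1_pos L_g1_ge_1 CD Omega_ge_1 by auto
  show 1: "1 \<le> \<Lambda>" using ln0 unfolding log_factor_def by linarith
  have e: "2 \<le> exp (1::real)" using exp_ge_add_one_self[of 1] by simp
  also have "exp 1 \<le> exp \<Lambda>" using 1 by simp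
  finally show "2 \<le> exp \<Lambda>" .
  have le: "p \<le> exp \<Lambda>" if "0 < p" "ln p \<le> \<Lambda>" for p
    using that by (metis exp_le_cancel_iff exp_ln)
  show "C\<^sub>D \<le> exp \<Lambda>" "L_g1 P \<le> exp \<Lambda>"
    using ln0 CD L_g1_ge_1 by (intro le; simp add: log_factor_def)+
  have "1 + L_f1 P \<le> exp \<Lambda>"
    using ln0 L_f1_pos by (intro le) (simp_all add: log_factor_def)
  then show "L_f1 P \<le> exp \<Lambda>" by simp
  have "2 * \<Omega> \<le> exp 1 * \<Omega>" using e Omega_ge_1 by (intro mult_right_mono) auto
  also have "\<dots> = exp (1 + ln \<Omega>)" using Omega_ge_1 by (simp add: exp_add)
  also have "\<dots> \<le> exp \<Lambda>" using ln0 by (simp add: log_factor_def)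
  finally show "2 * \<Omega> \<le> exp \<Lambda>" .
qed

lemma Q_init_ge:
  assumes "0 < \<delta>" "\<delta> \<le> 1 / B"
  shows "B \<le> Q_init P \<delta>" "1 \<le> Q_init P \<delta>" "1 / Q_init P \<delta> \<le> \<delta>"
    "8 / (p_star P - f_star P) \<le> Q_init P \<delta>" "8 / m_0 P \<le> Q_init P \<delta>"
proof -
  have *: "1 / \<delta> \<le> Q_init P \<delta>" "8 / (p_star P - f_star P) \<le> Q_init P \<delta>" "8 / m_0 P \<le> Q_init P \<delta>"
    unfolding Q_init_def by (rule Max_ge; simp)+
  then show "8 / (p_star P - f_star P) \<le> Q_init P \<delta>" "8 / m_0 P \<le> Q_init P \<delta>" by auto
  have "B \<le> 1 / \<delta>" using assms B_ge_1 by (simp add: field_simps)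
  then show "B \<le> Q_init P \<delta>" using * by simp
  then show 1: "1 \<le> Q_init P \<delta>" using B_ge_1 by simp
  show "1 / Q_init P \<delta> \<le> \<delta>" using *(1) 1 assms by (simp add: field_simps)
qed

lemma lbinit_correct:
  assumes \<delta>: "0 < \<delta>" "\<delta> \<le> 1 / B" and x: "xf \<in> X" "xg \<in> X"
  defines "Q \<equiv> Q_init P \<delta>"
  shows "\<exists>l \<Delta> x M T. lbinit apg\<^sub>0 apg\<^sub>\<mu> P \<delta> D xf xg = Some ((l, \<Delta>, x, M), T)
    \<and> x \<in> X \<and> 1 / (2 * Q) \<le> \<Delta> \<and> \<Delta> \<le> 1 / B \<and> l = f x + \<Delta> \<and> l \<le> p_star P
    \<and> 1 \<le> M \<and> M \<le> \<Omega> / \<Delta> \<and> g x - g_star P \<le> M * \<Delta>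
    \<and> real T \<le> 10 ^ 9 * K * \<Lambda> ^ 3 * pre_bound P D \<delta>"
proof -
  note Q = Q_init_ge[OF \<delta>, folded Q_def]
  have Q0: "0 < Q" using Q by simp
  define W where "W = exp \<Lambda> * Q"
  have up: "y \<le> W" if "y \<le> exp \<Lambda>" for y
  proof -
    have "exp \<Lambda> * 1 \<le> exp \<Lambda> * Q" using Q(2) by (intro mult_left_mono) auto
    then show ?thesis using that unfolding W_def by linarith
  qed
  note W = exp_log_factor_ge(1-4)[THEN up]
  have W3: "2 * \<Omega> * Q \<le> W" unfolding W_def using exp_log_factor_ge(5) Q0 by (intro mult_right_mono) auto
  obtain k where "\<delta> * Q < 2 ^ k" using real_arch_pow[of 2 "\<delta> * Q"] by auto
  then have k: "2 * \<delta> / 2 \<le> 2 ^ k / Q" using Q0 by (simp add: field_simps)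
  have start: "2 * \<delta> / 2 \<le> 1 / B" "1 / Q \<le> 2 * \<delta>" using \<delta> Q(3) by auto
  define a where "a = sqrt (C\<^sub>D * L_f1 P * \<Omega>)"
  define b where "b = sqrt (C\<^sub>D * L_g1 P)"
  define U where "U = 1019 * K * (log 2 W)\<^sup>2"
  have a0: "0 \<le> a" and b0: "0 \<le> b" and U0: "0 \<le> U"
    using C_D_ge(1) L_f1_pos Omega_ge_1 L_g1_ge_1 K_ge_1 by (auto simp: a_def b_def U_def)
  from lbinit_loop_correct[OF Q(2,4,5) W(1,2) W3 W(3,4) start k x x(1), of 0]
  obtain l \<Delta> y M T where T: "lbinit apg\<^sub>0 apg\<^sub>\<mu> P \<delta> D xf xg = Some ((l, \<Delta>, y, M), T)"
    "y \<in> X \<and> 1 / (2 * Q) \<le> \<Delta> \<and> \<Delta> \<le> 1 / B \<and> l = f y + \<Delta> \<and> l \<le> p_star P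
    \<and> 1 \<le> M \<and> M \<le> \<Omega> / \<Delta> \<and> g y - g_star P \<le> M * \<Delta>"
    "real T \<le> U * (a * (4 * Q - 2 / (2 * \<delta>)) + b * (6 * sqrt Q - 4 / sqrt (2 * \<delta>)))"
    unfolding lbinit_def U_def a_def b_def by auto
  have lnQ: "0 \<le> ln Q" using Q(2) by simp
  have "log 2 W \<le> 2 * ln W" using W(1) by (intro log_2_le) simp
  also have "ln W = \<Lambda> + ln Q" using Q0 by (simp add: W_def ln_mult)
  also have "\<Lambda> + ln Q \<le> \<Lambda> * (1 + ln Q)"
    using mult_right_mono[OF log_factor_ge_1 lnQ] by (simp add: algebra_simps)
  finally have "log 2 W \<le> 2 * (\<Lambda> * (1 + ln Q))" by simp
  moreover have "0 \<le> log 2 W" using W(1) by simp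
  ultimately have "(log 2 W)\<^sup>2 \<le> (2 * (\<Lambda> * (1 + ln Q)))\<^sup>2" by (intro power_mono)
  then have "U \<le> 1019 * K * (2 * (\<Lambda> * (1 + ln Q)))\<^sup>2"
    unfolding U_def using K_ge_1 by (intro mult_left_mono) auto
  also have "\<dots> = 4076 * K * \<Lambda>\<^sup>2 * (1 + ln Q)\<^sup>2" by (simp add: power_mult_distrib)
  finally have U: "U \<le> 4076 * K * \<Lambda>\<^sup>2 * (1 + ln Q)\<^sup>2" .
  have "a * (4 * Q - 2 / (2 * \<delta>)) + b * (6 * sqrt Q - 4 / sqrt (2 * \<delta>)) \<le> a * (6 * Q) + b * (6 * sqrt Q)"
  proof (intro add_mono mult_left_mono a0 b0)
    have "0 \<le> 2 / (2 * \<delta>)" "0 \<le> 4 / sqrt (2 * \<delta>)" using \<delta> by auto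
    then show "4 * Q - 2 / (2 * \<delta>) \<le> 6 * Q" "6 * sqrt Q - 4 / sqrt (2 * \<delta>) \<le> 6 * sqrt Q"
      using Q0 by linarith+
  qed
  then have "real T \<le> U * (a * (6 * Q) + b * (6 * sqrt Q))"
    using T(3) U0 by (elim order_trans) (intro mult_left_mono)
  also have "\<dots> \<le> 4076 * K * \<Lambda>\<^sup>2 * (1 + ln Q)\<^sup>2 * (a * (6 * Q) + b * (6 * sqrt Q))"
    using U a0 b0 Q0 by (intro mult_right_mono) auto
  also have "\<dots> = 24456 * K * \<Lambda>\<^sup>2 * pre_bound P D \<delta>"
    by (simp add: pre_bound_def Let_def a_def b_def Q_def algebra_simps)
  also have "\<dots> \<le> 10 ^ 9 * K * \<Lambda> ^ 3 * pre_bound P D \<delta>"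
  proof -
    have "0 \<le> pre_bound P D \<delta>"
      using a0 b0 Q0 by (simp add: pre_bound_def Let_def a_def b_def Q_def)
    moreover have "\<Lambda>\<^sup>2 \<le> \<Lambda> ^ 3" using log_factor_ge_1 by (intro power_increasing) auto
    ultimately show ?thesis using K_ge_1 by (intro mult_right_mono mult_mono) auto
  qed
  finally show ?thesis using T by blast
qed

lemma sntvfa_correct:
  assumes \<delta>: "0 < \<delta>" "\<delta> \<le> 1 / B" and eps: "0 < \<epsilon>" "\<epsilon> \<le> 1" "\<epsilon> \<le> 36 * \<delta>"
    and x\<^sub>i\<^sub>n: "xf \<in> X" "xg \<in> X"
  shows "\<exists>x T out T\<^sub>p\<^sub>r\<^sub>e. sntvfa apg\<^sub>0 apg\<^sub>\<mu> P \<epsilon> D \<delta> xf xg = Some (x, T)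
    \<and> x \<in> X \<and> f x \<le> p_star P + \<epsilon> \<and> g x \<le> g_star P + \<epsilon>
    \<and> lbinit apg\<^sub>0 apg\<^sub>\<mu> P \<delta> D xf xg = Some (out, T\<^sub>p\<^sub>r\<^sub>e)
    \<and> real T\<^sub>p\<^sub>r\<^sub>e \<le> 10 ^ 9 * K * \<Lambda> ^ 3 * pre_bound P D \<delta>
    \<and> real T \<le> real T\<^sub>p\<^sub>r\<^sub>e + 10 ^ 9 * K * (\<Lambda> + ln (Q_init P \<delta>)) ^ 3 * main_bound P D \<delta> \<epsilon>"
proof -
  define Q where "Q = Q_init P \<delta>"
  note Q = Q_init_ge[OF \<delta>, folded Q_def]
  have Q0: "0 < Q" using Q by simp
  note CD = C_D_ge(1)
  from lbinit_correct[OF \<delta> x\<^sub>i\<^sub>n, folded Q_def]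
  obtain l \<Delta> a M T\<^sub>p\<^sub>r\<^sub>e where init: "lbinit apg\<^sub>0 apg\<^sub>\<mu> P \<delta> D xf xg = Some ((l, \<Delta>, a, M), T\<^sub>p\<^sub>r\<^sub>e)"
    and a: "a \<in> X" and \<Delta>: "1 / (2 * Q) \<le> \<Delta>" "\<Delta> \<le> 1 / B" and l: "l = f a + \<Delta>" "l \<le> p_star P"
    and M: "1 \<le> M" "M \<le> \<Omega> / \<Delta>" "g a - g_star P \<le> M * \<Delta>"
    and pre: "real T\<^sub>p\<^sub>r\<^sub>e \<le> 10 ^ 9 * K * \<Lambda> ^ 3 * pre_bound P D \<delta>"
    by blast
  have "0 < 1 / (2 * Q)" using Q0 by simp
  then have \<Delta>0: "0 < \<Delta>" using \<Delta>(1) by (rule less_le_trans)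
  have inv\<Delta>: "1 / \<Delta> \<le> 2 * Q" using \<Delta>(1) \<Delta>0 Q0 by (simp add: field_simps)
  have "1 / B \<le> 1" using B_ge_1 by simp
  then have \<Delta>1: "\<Delta> \<le> 1" using \<Delta>(2) by simp
  have MQ: "M \<le> 2 * \<Omega> * Q"
    using M(2) mult_left_mono[OF inv\<Delta>, of \<Omega>] Omega_ge_1 by (simp add: mult_ac)
  obtain y n where y_eq: "apg\<^sub>0 (g_1 P) (g_2 P) (L_g1 P) (\<epsilon> / 8) xg D = (y, n)" by fastforce
  have "0 < \<epsilon> / 8" using eps by simp
  note y = apg0_g[OF x\<^sub>i\<^sub>n(2) this y_eq]
  have eq: "sntvfa apg\<^sub>0 apg\<^sub>\<mu> P \<epsilon> D \<delta> xf xg =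
    (if f y - l \<le> \<epsilon> then Some (y, T\<^sub>p\<^sub>r\<^sub>e + n + 2)
     else sntvfa_loop apg\<^sub>\<mu> P \<epsilon> D (g y) a M l \<delta> y (T\<^sub>p\<^sub>r\<^sub>e + n + 4))"
    by (simp add: sntvfa_def init y_eq)
  define E where "E = D * sqrt (L_g1 P / \<epsilon>)"
  define R where "R = sqrt (C\<^sub>D * (D\<^sup>2 + 2) * (L_g1 P + L_f1 P * \<Omega> * Q) / \<epsilon>)"
  define h where "h = 1 + ln (1 / \<epsilon>)"
  define H where "H = \<Lambda> + ln Q"
  have main: "main_bound P D \<delta> \<epsilon> = E + R * h ^ 3"
    by (simp add: main_bound_def E_def R_def h_def Q_def)
  have lnQ: "0 \<le> ln Q" using Q by simp
  have h1: "1 \<le> h" using eps by (simp add: h_def)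
  have H1: "1 \<le> H" using log_factor_ge_1 lnQ by (simp add: H_def)
  have E0: "0 \<le> E" using D_pos L_g1_ge_1 eps by (simp add: E_def)
  have LQ: "0 \<le> L_f1 P * \<Omega> * Q" using L_f1_pos Omega_ge_1 Q0 by simp
  have R1: "1 \<le> R"
  proof -
    have "1 * 1 * 1 \<le> C\<^sub>D * (D\<^sup>2 + 2) * (L_g1 P + L_f1 P * \<Omega> * Q)"
      using CD L_g1_ge_1 LQ by (intro mult_mono) auto
    then show ?thesis unfolding R_def using eps by (simp add: le_divide_eq)
  qed
  have "sqrt (L_g1 P / (\<epsilon> / 8)) \<le> 3 * sqrt (L_g1 P / \<epsilon>)"
  proof -
    have "sqrt (L_g1 P / (\<epsilon> / 8)) \<le> sqrt (3\<^sup>2 * (L_g1 P / \<epsilon>))"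
      using L_g1_ge_1 eps by (intro real_sqrt_le_mono) (simp add: field_simps)
    then show ?thesis unfolding real_sqrt_mult[of "3\<^sup>2"] by simp
  qed
  then have "D * sqrt (L_g1 P / (\<epsilon> / 8)) \<le> D * (3 * sqrt (L_g1 P / \<epsilon>))"
    using D_pos by (intro mult_left_mono) auto
  then have "1 + D * sqrt (L_g1 P / (\<epsilon> / 8)) \<le> 1 + 3 * E" by (simp add: E_def)
  then have "K * (1 + D * sqrt (L_g1 P / (\<epsilon> / 8))) \<le> K * (1 + 3 * E)"
    using K_ge_1 by (intro mult_left_mono) auto
  then have n: "real n \<le> K * (1 + 3 * E)" using y(3) by linarith
  have HRh: "1 \<le> H ^ 3 * (R * h ^ 3)"
    using mult_mono[of 1 "H ^ 3" 1 "R * h ^ 3"] mult_mono[of 1 R 1 "h ^ 3"] H1 R1 h1 by simp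
  have HE: "E \<le> H ^ 3 * E" using mult_right_mono[of 1 "H ^ 3" E] H1 E0 by simp
  have n4: "real n + 4 \<le> K * (5 * (H ^ 3 * main_bound P D \<delta> \<epsilon>))"
  proof -
    have "4 \<le> K * 4" using K_ge_1 by simp
    then have "real n + 4 \<le> K * (5 + 3 * E)" using n by (simp add: algebra_simps)
    also have "5 + 3 * E \<le> 5 * (H ^ 3 * main_bound P D \<delta> \<epsilon>)"
    proof -
      have "H ^ 3 * main_bound P D \<delta> \<epsilon> = H ^ 3 * E + H ^ 3 * (R * h ^ 3)"
        by (simp add: main algebra_simps)
      then show ?thesis using HRh HE E0 by linarith
    qed
    finally show ?thesis using K_ge_1 by (simp add: mult_left_mono)
  qed
  have mb0: "0 \<le> H ^ 3 * main_bound P D \<delta> \<epsilon>"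
    unfolding main using H1 E0 R1 h1 by auto
  show ?thesis
  proof (cases "f y - l \<le> \<epsilon>")
    case True
    have "real (T\<^sub>p\<^sub>r\<^sub>e + n + 2) \<le> real T\<^sub>p\<^sub>r\<^sub>e + K * (5 * (H ^ 3 * main_bound P D \<delta> \<epsilon>))"
      using n4 by simp
    also have "K * (5 * (H ^ 3 * main_bound P D \<delta> \<epsilon>)) \<le> K * (10 ^ 9 * (H ^ 3 * main_bound P D \<delta> \<epsilon>))"
      using K_ge_1 mb0 by (intro mult_left_mono mult_right_mono) auto
    finally have "real (T\<^sub>p\<^sub>r\<^sub>e + n + 2) \<le> real T\<^sub>p\<^sub>r\<^sub>e + 10 ^ 9 * K * H ^ 3 * main_bound P D \<delta> \<epsilon>"
      by (simp add: mult_ac)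
    moreover have "f y \<le> p_star P + \<epsilon>" "g y \<le> g_star P + \<epsilon>" using True l y(2) eps by auto
    ultimately show ?thesis unfolding eq H_def Q_def using True y(1) init pre by auto
  next
    case False
    define \<delta>m where "\<delta>m = \<epsilon> / (20 * (D\<^sup>2 + 2))"
    define \<kappa> where "\<kappa> = \<epsilon>\<^sup>2 / (8 * B * C\<^sub>D)"
    define W\<^sub>0 where "W\<^sub>0 = exp \<Lambda> * Q / \<epsilon>"
    have D2: "0 < D\<^sup>2 + 2" by (simp add: add_nonneg_pos)
    have \<delta>m: "0 < \<delta>m" "\<delta>m \<le> \<delta>"
    proof -
      show "0 < \<delta>m" using eps D2 by (simp add: \<delta>m_def)
      have "\<delta> * 36 \<le> \<delta> * (20 * (D\<^sup>2 + 2))" using \<delta> by (intro mult_left_mono) auto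
      then have "\<epsilon> \<le> \<delta> * (20 * (D\<^sup>2 + 2))" using eps(3) by linarith
      then show "\<delta>m \<le> \<delta>" unfolding \<delta>m_def using D2 by (simp add: divide_le_eq)
    qed
    have \<kappa>: "0 < \<kappa>" using eps B_ge_1 CD by (simp add: \<kappa>_def)
    have up: "p \<le> W\<^sub>0" if "p \<le> exp \<Lambda> * Q" for p
    proof -
      have "exp \<Lambda> * Q * 1 \<le> exp \<Lambda> * Q * (1 / \<epsilon>)" using eps Q0 by (intro mult_left_mono) auto
      then show ?thesis using that by (simp add: W\<^sub>0_def)
    qed
    have up': "p \<le> W\<^sub>0" if "p \<le> exp \<Lambda>" for p
    proof -
      have "exp \<Lambda> * 1 \<le> exp \<Lambda> * Q" using Q(2) by (intro mult_left_mono) auto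
      then show ?thesis using that by (intro up) linarith
    qed
    note W = exp_log_factor_ge[THEN up']
    have W0: "0 \<le> W\<^sub>0" "1 \<le> W\<^sub>0" using W(1) by auto
    have WM: "M \<le> W\<^sub>0"
    proof -
      have "2 * \<Omega> * Q \<le> exp \<Lambda> * Q" using exp_log_factor_ge(5) Q0 by (intro mult_right_mono) auto
      then show ?thesis using MQ by (intro up) simp
    qed
    have WQ: "Q \<le> W\<^sub>0" using log_factor_ge_1 Q0 by (intro up) simp
    have We: "1 / \<epsilon> \<le> W\<^sub>0"
    proof -
      have "1 * 1 \<le> exp \<Lambda> * Q" using log_factor_ge_1 Q(2) by (intro mult_mono) auto
      then show ?thesis unfolding W\<^sub>0_def using eps by (intro divide_right_mono) auto
    qed
    have D3: "D\<^sup>2 + 2 \<le> 4 * C\<^sub>D" using C_D_ge by simp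
    have inv: "1 / \<delta>m \<le> W\<^sub>0 ^ 9"
    proof -
      have "1 / \<delta>m = 20 * (D\<^sup>2 + 2) * (1 / \<epsilon>)" by (simp add: \<delta>m_def)
      also have "\<dots> \<le> 2 ^ 5 * (2 ^ 2 * C\<^sub>D) * (1 / \<epsilon>)"
        using D3 D2 eps by (intro mult_mono) auto
      also have "\<dots> \<le> W\<^sub>0 ^ 5 * (W\<^sub>0 ^ 2 * W\<^sub>0) * W\<^sub>0"
        using W We CD eps W0 by (intro mult_mono power_mono) auto
      finally show ?thesis by (simp add: eval_nat_numeral mult_ac)
    qed
    have up9: "p \<le> W\<^sub>0 ^ 9" if "p \<le> W\<^sub>0" for p
      using that power_increasing[of 1 9 W\<^sub>0] W0 by simp
    \<comment> \<open>The initial reference point is the Slater point \<open>a\<close>, with \<open>f a - l = - \<Delta>\<close>; \<open>Z\<close> is chosen such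
      that the invariant of the loop holds with equality.\<close>
    define G where "G = \<Omega>"
    define Z where "Z = 13 / 16 * \<Omega> / \<Delta>"
    have GZ: "0 < G" "0 < Z" using Omega_ge_1 \<Delta>0 by (auto simp: G_def Z_def)
    have yG: "g a - g y \<le> G" using Omega_bound[OF a] g_star_le[OF y(1)] by (simp add: G_def)
    have fZ: "(f a - l) * Z \<le> - (13 / 16) * G" using \<Delta>0 by (simp add: l G_def Z_def)
    have \<kappa>GZ: "\<kappa> \<le> G * Z"
    proof -
      have BC: "1 \<le> B * C\<^sub>D" using mult_mono[OF B_ge_1 CD] B_ge_1 by simp
      have "\<epsilon>\<^sup>2 \<le> 1" using eps by (simp add: power_le_one)
      then have "\<kappa> \<le> 13 / 16" unfolding \<kappa>_def using BC by (simp add: divide_le_eq)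
      also have "\<dots> \<le> 13 / 16 * (\<Omega> * (\<Omega> / \<Delta>))"
      proof -
        have "1 \<le> \<Omega> / \<Delta>" using Omega_ge_1 \<Delta>0 \<Delta>1 by (simp add: le_divide_eq)
        then have "1 * 1 \<le> \<Omega> * (\<Omega> / \<Delta>)" using Omega_ge_1 by (intro mult_mono) auto
        then show ?thesis by simp
      qed
      also have "\<dots> = G * Z" by (simp add: G_def Z_def)
      finally show ?thesis .
    qed
    define p where "p = \<delta> * (G * Z) / (\<delta>m * \<kappa>)"
    define k where "k = nat \<lceil>log 2 p\<rceil>"
    have p0: "0 < p" using GZ \<delta> \<delta>m \<kappa> by (simp add: p_def)
    have "p \<le> 2 ^ k" unfolding k_def using p0 by (rule le_two_power_nat_ceil_log)
    then have k: "\<delta> * (G * Z) \<le> 2 ^ k * (\<delta>m * \<kappa>)"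
      using \<delta>m \<kappa> by (simp add: p_def divide_le_eq)
    have p_le: "p \<le> W\<^sub>0 ^ 20"
    proof -
      have B\<delta>: "B * \<delta> \<le> 1" using \<delta> B_ge_1 by (simp add: field_simps)
      have "p = (B * \<delta>) * ((13 / 16) * (\<Omega> * (\<Omega> * (1 / \<Delta>)))) * (1 / \<delta>m) * (8 * C\<^sub>D * (1 / \<epsilon>)\<^sup>2)"
        using eps B_ge_1 CD \<Delta>0 by (simp add: p_def \<kappa>_def G_def Z_def field_simps)
      also have "\<dots> \<le> 1 * (1 * (W\<^sub>0 * (W\<^sub>0 * (2 * Q)))) * W\<^sub>0 ^ 9 * (2 ^ 3 * C\<^sub>D * (1 / \<epsilon>)\<^sup>2)"
        using B\<delta> W(5) inv\<Delta> inv Omega_ge_1 \<Delta>0 \<delta> \<delta>m B_ge_1 CD Q0 W0 eps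
        by (intro mult_mono) auto
      also have "\<dots> \<le> 1 * (1 * (W\<^sub>0 * (W\<^sub>0 * (W\<^sub>0 * W\<^sub>0)))) * W\<^sub>0 ^ 9 * (W\<^sub>0 ^ 3 * W\<^sub>0 * W\<^sub>0\<^sup>2)"
        using W We WQ Q0 W0 eps CD by (intro mult_mono power_mono) auto
      also have "\<dots> = W\<^sub>0 ^ 19" by (simp add: eval_nat_numeral mult_ac)
      also have "\<dots> \<le> W\<^sub>0 ^ 20" using W0 by (intro power_increasing) auto
      finally show ?thesis .
    qed
    define l\<^sub>0 where "l\<^sub>0 = log 2 W\<^sub>0"
    have l1: "1 \<le> l\<^sub>0" using W(1) by (simp add: l\<^sub>0_def)
    have k_le: "real k \<le> 20 * l\<^sub>0 + 1"
      using nat_ceil_log_le[OF p0 p_le W(1)] by (simp add: k_def l\<^sub>0_def)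
    define N where "N = 1008 * K * (log 2 (W\<^sub>0 ^ 9))\<^sup>2 * sqrt (C\<^sub>D * (L_g1 P + M * L_f1 P) / \<delta>m)"
    have fa: "f a \<le> l - \<Delta>" by (simp add: l)
    note loop = sntvfa_loop_correct[OF eps(1,2) g_star_le[OF y(1)] y(2) a M(1) fa M(3) \<Delta>0
      up9[OF W(1)] up9[OF W(2)] up9[OF WM], folded \<delta>m_def \<kappa>_def, OF inv up9[OF W(3)] up9[OF W(4)]
      order_refl l(2) \<delta>m(2) \<delta>(2) y(1) a GZ yG fZ \<kappa>GZ k, folded N_def, of "T\<^sub>p\<^sub>r\<^sub>e + n + 4"]
    then obtain x T where xT: "sntvfa_loop apg\<^sub>\<mu> P \<epsilon> D (g y) a M l \<delta> y (T\<^sub>p\<^sub>r\<^sub>e + n + 4) = Some (x, T)"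
      "x \<in> X" "f x \<le> p_star P + \<epsilon>" "g x \<le> g_star P + \<epsilon>"
      "real T \<le> real (T\<^sub>p\<^sub>r\<^sub>e + n + 4) + real (k + 1) * (N + 2)" by blast
    have l0_le: "l\<^sub>0 \<le> 2 * (H * h)"
    proof -
      have "l\<^sub>0 \<le> 2 * ln W\<^sub>0" unfolding l\<^sub>0_def using W0 by (intro log_2_le)
      also have "ln W\<^sub>0 = H + ln (1 / \<epsilon>)" using Q0 eps by (simp add: W\<^sub>0_def H_def ln_mult ln_div)
      also have "H + ln (1 / \<epsilon>) \<le> H * h"
        using mult_right_mono[OF H1, of "h - 1"] h1 by (simp add: h_def algebra_simps)
      finally show ?thesis by simp
    qed
    have sR: "sqrt (C\<^sub>D * (L_g1 P + M * L_f1 P) / \<delta>m) \<le> 7 * R"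
    proof -
      have "M * L_f1 P \<le> 2 * (L_f1 P * \<Omega> * Q)"
        using mult_right_mono[OF MQ, of "L_f1 P"] L_f1_pos by (simp add: mult_ac)
      then have "L_g1 P + M * L_f1 P \<le> 2 * (L_g1 P + L_f1 P * \<Omega> * Q)"
        using L_g1_ge_1 by simp
      then have "C\<^sub>D * (L_g1 P + M * L_f1 P) \<le> C\<^sub>D * (2 * (L_g1 P + L_f1 P * \<Omega> * Q))"
        using CD by (intro mult_left_mono) auto
      then have "C\<^sub>D * (L_g1 P + M * L_f1 P) / \<delta>m \<le> C\<^sub>D * (2 * (L_g1 P + L_f1 P * \<Omega> * Q)) / \<delta>m"
        using \<delta>m by (intro divide_right_mono) auto
      also have "\<dots> = 40 * (C\<^sub>D * (D\<^sup>2 + 2) * (L_g1 P + L_f1 P * \<Omega> * Q) / \<epsilon>)"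
      proof -
        have "r * (2 * s) / (\<epsilon> / (20 * t)) = 40 * (r * t * s / \<epsilon>)" for r s t :: real
          by simp
        then show ?thesis unfolding \<delta>m_def .
      qed
      also have "\<dots> \<le> 7\<^sup>2 * (C\<^sub>D * (D\<^sup>2 + 2) * (L_g1 P + L_f1 P * \<Omega> * Q) / \<epsilon>)"
        using CD D2 L_g1_ge_1 LQ eps by (intro mult_right_mono) auto
      finally have "sqrt (C\<^sub>D * (L_g1 P + M * L_f1 P) / \<delta>m)
        \<le> sqrt (7\<^sup>2 * (C\<^sub>D * (D\<^sup>2 + 2) * (L_g1 P + L_f1 P * \<Omega> * Q) / \<epsilon>))" by (rule real_sqrt_le_mono)
      then show ?thesis unfolding real_sqrt_mult[of "7\<^sup>2"] R_def by simp
    qed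
    have "log 2 (W\<^sub>0 ^ 9) = 9 * l\<^sub>0" using W0 by (simp add: l\<^sub>0_def log_nat_power)
    then have "N \<le> 1008 * K * (9 * l\<^sub>0)\<^sup>2 * (7 * R)"
      unfolding N_def using sR K_ge_1 by (simp only:) (intro mult_left_mono, auto)
    then have N_le: "N \<le> 571536 * (K * l\<^sub>0\<^sup>2 * R)" by (simp add: power_mult_distrib)
    have "1 \<le> K * l\<^sub>0\<^sup>2" using mult_mono[of 1 K 1 "l\<^sub>0\<^sup>2"] K_ge_1 l1 by simp
    then have "1 \<le> K * l\<^sub>0\<^sup>2 * R" using mult_mono[of 1 "K * l\<^sub>0\<^sup>2" 1 R] R1 by simp
    then have N2: "N + 2 \<le> 571538 * (K * l\<^sub>0\<^sup>2 * R)" using N_le by simp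
    have k1: "real (k + 1) \<le> 22 * l\<^sub>0" using k_le l1 by simp
    have "real (k + 1) * (N + 2) \<le> 22 * l\<^sub>0 * (571538 * (K * l\<^sub>0\<^sup>2 * R))"
    proof -
      have "0 \<le> N + 2"
        using K_ge_1 CD L_g1_ge_1 L_f1_pos M \<delta>m by (auto simp: N_def intro!: add_nonneg_nonneg)
      then show ?thesis using k1 N2 l1 by (intro mult_mono) auto
    qed
    also have "\<dots> = 12573836 * (K * R) * l\<^sub>0 ^ 3" by (simp add: eval_nat_numeral)
    also have "\<dots> \<le> 12573836 * (K * R) * (2 * (H * h)) ^ 3"
      using l0_le l1 K_ge_1 R1 by (intro mult_left_mono power_mono) auto
    also have "\<dots> = 100590688 * K * (H ^ 3 * (R * h ^ 3))" by (simp add: power_mult_distrib)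
    also have "\<dots> \<le> 100590688 * K * (H ^ 3 * main_bound P D \<delta> \<epsilon>)"
      unfolding main using E0 H1 K_ge_1 by (intro mult_left_mono) auto
    finally have newton: "real (k + 1) * (N + 2) \<le> 100590688 * (K * (H ^ 3 * main_bound P D \<delta> \<epsilon>))"
      by (simp add: mult_ac)
    have "0 \<le> K * (H ^ 3 * main_bound P D \<delta> \<epsilon>)" using mb0 K_ge_1 by simp
    moreover have "real n + 4 \<le> 5 * (K * (H ^ 3 * main_bound P D \<delta> \<epsilon>))" using n4 by (simp add: mult_ac)
    moreover have "real (T\<^sub>p\<^sub>r\<^sub>e + n + 4) = real T\<^sub>p\<^sub>r\<^sub>e + (real n + 4)" by simp
    ultimately have "real T \<le> real T\<^sub>p\<^sub>r\<^sub>e + 10 ^ 9 * (K * (H ^ 3 * main_bound P D \<delta> \<epsilon>))"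
      using xT(5) newton by simp
    then have "real T \<le> real T\<^sub>p\<^sub>r\<^sub>e + 10 ^ 9 * K * H ^ 3 * main_bound P D \<delta> \<epsilon>"
      by (simp add: mult_ac)
    then show ?thesis unfolding eq H_def Q_def using False xT init pre by auto
  qed
qed

end

lemma apg_0_spec_mono:
  fixes apg :: "('a::euclidean_space) apg_0"
  assumes "apg_0_spec K apg" "K \<le> K'"
  shows "apg_0_spec K' apg"
  unfolding apg_0_spec_def
proof (intro allI impI)
  fix \<phi>\<^sub>1 :: "'a \<Rightarrow> real" and \<phi>\<^sub>2 :: "'a \<Rightarrow> ereal" and x :: 'a
    and L \<delta> D :: real
  assume pre: "smooth_convex L \<phi>\<^sub>1 \<and> proper_lsc_convex \<phi>\<^sub>2 \<and> 0 < \<delta> \<and>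
     minimizers (composite \<phi>\<^sub>1 \<phi>\<^sub>2) \<noteq> {} \<and> infdist x (minimizers (composite \<phi>\<^sub>1 \<phi>\<^sub>2)) \<le> D"
  have "0 \<le> D" using pre infdist_nonneg order_trans by blast
  then have "K * (1 + D * sqrt (L / \<delta>)) \<le> K' * (1 + D * sqrt (L / \<delta>))"
    using pre assms(2) by (intro mult_right_mono) (auto simp: smooth_convex_def)
  then show "case apg \<phi>\<^sub>1 \<phi>\<^sub>2 L \<delta> x D of (y, n) \<Rightarrow> y \<in> edom \<phi>\<^sub>2 \<and>
        (\<forall>u. composite \<phi>\<^sub>1 \<phi>\<^sub>2 y \<le> composite \<phi>\<^sub>1 \<phi>\<^sub>2 u + ereal \<delta>) \<and>
        real n \<le> K' * (1 + D * sqrt (L / \<delta>))"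
    using assms(1)[unfolded apg_0_spec_def, THEN spec, THEN spec, THEN spec, THEN spec, THEN spec,
        THEN spec, THEN mp, OF pre]
    by (auto split: prod.splits)
qed

lemma apg_mu_spec_mono:
  fixes apg :: "('a::euclidean_space) apg_mu"
  assumes "apg_mu_spec K apg" "K \<le> K'"
  shows "apg_mu_spec K' apg"
  unfolding apg_mu_spec_def
proof (intro allI impI)
  fix \<phi>\<^sub>1 :: "'a \<Rightarrow> real" and \<phi>\<^sub>2 :: "'a \<Rightarrow> ereal" and x :: 'a
    and L \<mu> D \<delta> :: real
  assume pre: "smooth_convex L \<phi>\<^sub>1 \<and> 0 < \<mu> \<and> strongly_convex \<mu> \<phi>\<^sub>1 \<and> proper_lsc_convex \<phi>\<^sub>2 \<and>
     0 < \<delta> \<and> bounded (edom \<phi>\<^sub>2) \<and> diameter (edom \<phi>\<^sub>2) \<le> D \<and> x \<in> edom \<phi>\<^sub>2"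
  let ?c = "sqrt (L / \<mu>) * (1 + real (nat \<lceil>log 2 (L * D / \<delta>)\<rceil>))"
  have "K * ?c \<le> K' * ?c"
    using pre assms(2) by (intro mult_right_mono) (auto simp: smooth_convex_def)
  then show "case apg \<phi>\<^sub>1 \<phi>\<^sub>2 L \<mu> D \<delta> x of (y, n) \<Rightarrow> y \<in> edom \<phi>\<^sub>2 \<and>
        subdiff (composite \<phi>\<^sub>1 \<phi>\<^sub>2) y \<noteq> {} \<and> infdist 0 (subdiff (composite \<phi>\<^sub>1 \<phi>\<^sub>2) y) \<le> \<delta> \<and>
        real n \<le> K' * ?c"
    using assms(1)[unfolded apg_mu_spec_def, THEN spec, THEN spec, THEN spec, THEN spec, THEN spec,
        THEN spec, THEN spec, THEN mp, OF pre]
    by (auto split: prod.splits)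
qed

theorem theorem4p1:
  fixes K\<^sub>0 K\<^sub>\<mu> :: real
  shows "\<exists>(K::real) (p::nat).
    \<forall>(P :: (real ^ 'n) sbo) apg\<^sub>0 apg\<^sub>\<mu> l_f2 D\<^sub>g B\<^sub>f \<delta>\<^sub>i\<^sub>n\<^sub>i\<^sub>t \<epsilon> xf\<^sub>i\<^sub>n\<^sub>i\<^sub>t xg\<^sub>i\<^sub>n\<^sub>i\<^sub>t.
      sbo_problem P \<longrightarrow> assumption_A P l_f2 \<longrightarrow>
      apg_0_spec K\<^sub>0 apg\<^sub>0 \<longrightarrow> apg_mu_spec K\<^sub>\<mu> apg\<^sub>\<mu> \<longrightarrow>
      diameter (edom (g_2 P)) \<le> D\<^sub>g \<longrightarrow>
      1 \<le> B\<^sub>f \<longrightarrow> B\<^sub>f-lipschitz_on (edom (g_2 P)) (\<lambda>x. real_of_ereal (obj_f P x)) \<longrightarrow>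
      0 < \<delta>\<^sub>i\<^sub>n\<^sub>i\<^sub>t \<longrightarrow> \<delta>\<^sub>i\<^sub>n\<^sub>i\<^sub>t \<le> 1 / B\<^sub>f \<longrightarrow>
      0 < \<epsilon> \<longrightarrow> \<epsilon> \<le> min 1 (36 * \<delta>\<^sub>i\<^sub>n\<^sub>i\<^sub>t) \<longrightarrow>
      xf\<^sub>i\<^sub>n\<^sub>i\<^sub>t \<in> edom (g_2 P) \<longrightarrow> xg\<^sub>i\<^sub>n\<^sub>i\<^sub>t \<in> edom (g_2 P) \<longrightarrow>
      (\<exists>x T out T\<^sub>p\<^sub>r\<^sub>e.
         sntvfa apg\<^sub>0 apg\<^sub>\<mu> P \<epsilon> D\<^sub>g \<delta>\<^sub>i\<^sub>n\<^sub>i\<^sub>t xf\<^sub>i\<^sub>n\<^sub>i\<^sub>t xg\<^sub>i\<^sub>n\<^sub>i\<^sub>t = Some (x, T) \<and>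
         eps_optimal P \<epsilon> \<epsilon> x \<and>
         lbinit apg\<^sub>0 apg\<^sub>\<mu> P \<delta>\<^sub>i\<^sub>n\<^sub>i\<^sub>t D\<^sub>g xf\<^sub>i\<^sub>n\<^sub>i\<^sub>t xg\<^sub>i\<^sub>n\<^sub>i\<^sub>t = Some (out, T\<^sub>p\<^sub>r\<^sub>e) \<and>
         real T\<^sub>p\<^sub>r\<^sub>e \<le> K * log_factor P D\<^sub>g ^ p * pre_bound P D\<^sub>g \<delta>\<^sub>i\<^sub>n\<^sub>i\<^sub>t \<and>
         real T \<le> real T\<^sub>p\<^sub>r\<^sub>e
           + K * (log_factor P D\<^sub>g + ln (Q_init P \<delta>\<^sub>i\<^sub>n\<^sub>i\<^sub>t)) ^ p * main_bound P D\<^sub>g \<delta>\<^sub>i\<^sub>n\<^sub>i\<^sub>t \<epsilon>)"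
proof (intro exI[of _ "10 ^ 9 * max 1 (max K\<^sub>0 K\<^sub>\<mu>)"] exI[of _ "3::nat"] allI impI)
  let ?K = "max 1 (max K\<^sub>0 K\<^sub>\<mu>)"
  fix P :: "(real ^ 'n) sbo" and apg\<^sub>0 :: "(real ^ 'n) apg_0" and apg\<^sub>\<mu> :: "(real ^ 'n) apg_mu"
    and l_f2 D\<^sub>g B\<^sub>f \<delta>\<^sub>i\<^sub>n\<^sub>i\<^sub>t \<epsilon> xf\<^sub>i\<^sub>n\<^sub>i\<^sub>t xg\<^sub>i\<^sub>n\<^sub>i\<^sub>t
  assume A: "sbo_problem P" "assumption_A P l_f2" "apg_0_spec K\<^sub>0 apg\<^sub>0" "apg_mu_spec K\<^sub>\<mu> apg\<^sub>\<mu>"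
    "diameter (edom (g_2 P)) \<le> D\<^sub>g" "1 \<le> B\<^sub>f"
    "B\<^sub>f-lipschitz_on (edom (g_2 P)) (\<lambda>x. real_of_ereal (obj_f P x))"
    and \<delta>: "0 < \<delta>\<^sub>i\<^sub>n\<^sub>i\<^sub>t" "\<delta>\<^sub>i\<^sub>n\<^sub>i\<^sub>t \<le> 1 / B\<^sub>f" and \<epsilon>: "0 < \<epsilon>" "\<epsilon> \<le> min 1 (36 * \<delta>\<^sub>i\<^sub>n\<^sub>i\<^sub>t)"
    and x: "xf\<^sub>i\<^sub>n\<^sub>i\<^sub>t \<in> edom (g_2 P)" "xg\<^sub>i\<^sub>n\<^sub>i\<^sub>t \<in> edom (g_2 P)"
  interpret sbo_setting P apg\<^sub>0 apg\<^sub>\<mu> ?K D\<^sub>g B\<^sub>f l_f2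
    using A apg_0_spec_mono[OF A(3), of ?K] apg_mu_spec_mono[OF A(4), of ?K]
    by unfold_locales auto
  have "\<epsilon> \<le> 1" "\<epsilon> \<le> 36 * \<delta>\<^sub>i\<^sub>n\<^sub>i\<^sub>t" using \<epsilon> by auto
  from sntvfa_correct[OF \<delta> \<epsilon>(1) this x]
  obtain y T out T\<^sub>p\<^sub>r\<^sub>e where
    "sntvfa apg\<^sub>0 apg\<^sub>\<mu> P \<epsilon> D\<^sub>g \<delta>\<^sub>i\<^sub>n\<^sub>i\<^sub>t xf\<^sub>i\<^sub>n\<^sub>i\<^sub>t xg\<^sub>i\<^sub>n\<^sub>i\<^sub>t = Some (y, T)"
    and y: "y \<in> edom (g_2 P)" "rf P y \<le> p_star P + \<epsilon>" "rg P y \<le> g_star P + \<epsilon>"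
    and "lbinit apg\<^sub>0 apg\<^sub>\<mu> P \<delta>\<^sub>i\<^sub>n\<^sub>i\<^sub>t D\<^sub>g xf\<^sub>i\<^sub>n\<^sub>i\<^sub>t xg\<^sub>i\<^sub>n\<^sub>i\<^sub>t = Some (out, T\<^sub>p\<^sub>r\<^sub>e)"
    "real T\<^sub>p\<^sub>r\<^sub>e \<le> 10 ^ 9 * ?K * log_factor P D\<^sub>g ^ 3 * pre_bound P D\<^sub>g \<delta>\<^sub>i\<^sub>n\<^sub>i\<^sub>t"
    "real T \<le> real T\<^sub>p\<^sub>r\<^sub>e + 10 ^ 9 * ?K * (log_factor P D\<^sub>g + ln (Q_init P \<delta>\<^sub>i\<^sub>n\<^sub>i\<^sub>t)) ^ 3
      * main_bound P D\<^sub>g \<delta>\<^sub>i\<^sub>n\<^sub>i\<^sub>t \<epsilon>"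
    by blast
  moreover have "eps_optimal P \<epsilon> \<epsilon> y" using y by (simp add: eps_optimal_def obj_X)
  ultimately show "\<exists>x T out T\<^sub>p\<^sub>r\<^sub>e.
         sntvfa apg\<^sub>0 apg\<^sub>\<mu> P \<epsilon> D\<^sub>g \<delta>\<^sub>i\<^sub>n\<^sub>i\<^sub>t xf\<^sub>i\<^sub>n\<^sub>i\<^sub>t xg\<^sub>i\<^sub>n\<^sub>i\<^sub>t = Some (x, T) \<and>
         eps_optimal P \<epsilon> \<epsilon> x \<and>
         lbinit apg\<^sub>0 apg\<^sub>\<mu> P \<delta>\<^sub>i\<^sub>n\<^sub>i\<^sub>t D\<^sub>g xf\<^sub>i\<^sub>n\<^sub>i\<^sub>t xg\<^sub>i\<^sub>n\<^sub>i\<^sub>t = Some (out, T\<^sub>p\<^sub>r\<^sub>e) \<and>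
         real T\<^sub>p\<^sub>r\<^sub>e \<le> 10 ^ 9 * ?K * log_factor P D\<^sub>g ^ 3 * pre_bound P D\<^sub>g \<delta>\<^sub>i\<^sub>n\<^sub>i\<^sub>t \<and>
         real T \<le> real T\<^sub>p\<^sub>r\<^sub>e
           + 10 ^ 9 * ?K * (log_factor P D\<^sub>g + ln (Q_init P \<delta>\<^sub>i\<^sub>n\<^sub>i\<^sub>t)) ^ 3 * main_bound P D\<^sub>g \<delta>\<^sub>i\<^sub>n\<^sub>i\<^sub>t \<epsilon>"
    by blast
qed

end
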